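(* Let $(X,0)$ be a complex normal surface singularity whose link is a rational homology sphere, with a fixed good resolution with dual graph $\Gamma$ and vertex set $V$. For any $\emptyset\neq I\subset V$, any $\ell'_0\in\mathcal S'$ with $[\ell'_0]=h_0$, and any $h\in H$, the following identities hold: (a) $\mathrm{mpc}^{\pi_I(\mathcal S'_{\mathbb R})}\big((f_{\ell'_0})_h(\mathbf t_I)\big)=\widetilde q_{h-h_0,I}\big(r_h-\check\ell_0(h)\big)=q_{[Z_K]-h+h_0,\,I}\big(Z_K-r_h+\ell'_0\big)$; (b) $\mathrm{pc}^{\pi_I(\mathcal S'_{\mathbb R})}\big((f_{\ell'_0})_h(\mathbf t_I)\big)=\widetilde Q_{h-h_0,I}\big(r_h-\check\ell_0(h)\big)=Q_{[Z_K]-h+h_0,\,I}\big(Z_K-r_h+\ell'_0\big)$; where $\check\ell_0(h):=\ell'_0+r_{h-h_0}$.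
   Context: Lattices. Let $\tilde X\to X$ be the good resolution, $\{E_v\}_{v\in V}$ the irreducible exceptional curves; since the link $\Sigma$ is a rational homology sphere, $\Gamma$ is a connected tree and all $E_v$ are rational. $L=\bigoplus_v\mathbb Z E_v$ carries the negative definite intersection form $(\cdot,\cdot)$; $L'=\{\ell'\in L\otimes\mathbb Q:(\ell',\ell)\in\mathbb Z\ \forall\ell\in L\}$; it is freely generated by the $E_v^*$ with $(E_u^*,E_v)=-\delta_{u,v}$. $H:=L'/L$, and $[\ell']$ is the class of $\ell'$ in $H$. For $h\in H$, $r_h=\sum_v l'_vE_v\in L'$ is the unique representative of $h$ with all $0\le l'_v<1$. $Z_K\in L'$ is determined by $(Z_K,E_v)=(E_v,E_v)+2$ for all $v$. The Lipman cone is $\mathcal S'=\{\ell'\in L':(\ell',E_v)\le0\ \forall v\}=\mathbb Z_{\ge0}\langle E_v^*\rangle_v$, and $\mathcal S'_{\mathbb R}$ is the real cone generated by the $E^*_v$. For $I\subset V$, $\pi_I$ is the projection $\sum_{v\in V}l_vE_v\mapsto\sum_{v\in I}l_vE_v$, also written $\ell'|_I$; $L_I=\pi_I(L)$, $L'_I=\pi_I(L')$. For $x,y$ in $L'_I$: $x\ge y$ means $x_v\ge y_v$ for all $v\in I$; $x\prec y$ means $x_v<y_v$ for all $v\in I$. Series. For $\ell'=\sum_vl'_vE_v$, $\mathbf t^{\ell'}=\prod_vt_v^{l'_v}$. Let $f(\mathbf t)=\prod_{v\in V}(1-\mathbf t^{E_v^*})^{\mathrm{val}(v)-2}$, with $\mathrm{val}(v)$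 the valence of $v$ in $\Gamma$, and let $Z(\mathbf t)=\sum_{\ell'}z(\ell')\mathbf t^{\ell'}$ be its Taylor expansion at the origin (supported in $\mathcal S'$). The twisted zeta function is $f_{\ell'_0}(\mathbf t)=\mathbf t^{\ell'_0}f(\mathbf t)$, with Taylor expansion at the origin $\mathbf t^{\ell'_0}Z(\mathbf t)$. The $h$-part of a series $S(\mathbf t)=\sum_{\ell'\in L'} a(\ell')\mathbf t^{\ell'}$ is $S_h(\mathbf t)=\sum_{[\ell']=h}a(\ell')\mathbf t^{\ell'}$, and $S_h(\mathbf t_I):=S_h(\mathbf t)|_{t_v=1,\,v\notin I}$. The symbol $(f_{\ell'_0})_h(\mathbf t_I)$ denotes the reduced $h$-part of the Taylor expansion of $f_{\ell'_0}$ at the origin, i.e. $\mathbf t_I^{\ell'_0}Z_{h-h_0}(\mathbf t_I)$, where $\mathbf t_I^{\ell'_0}:=\mathbf t^{\ell'_0}|_{t_v=1,\,v\notin I}$. Counting functions. For $x\in L'$ put $Q^{(S)}_{h,I}(x)=\sum a(\ell')$ over $\ell'$ with $[\ell']=h$ and $\ell'|_I\not\ge x|_I$, and $q^{(S)}_{h,I}(x)=\sum a(\ell')$ over $\ell'$ with $[\ell']=h$ and $\ell'|_I\prec x|_I$ (for the series considered here these sums are finite). For $S=Z$ write $Q_{h,I}$ and $q_{h,I}$. Periodic constants. Let $\mathcal K\subset L'_I\otimes\mathbb R$ be a full-dimensional closed real cone. $Q^{(S)}_{h,I}$ admits a quasi-polynomial in $\mathcal K$ if there are $\ell'_*\in\mathcal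 K$, a finite index sublattice $\widetilde L\subset L_I$ and a quasi-polynomial $\widetilde Q^{(S)}_{h,I}$ on $\widetilde L$ with $\widetilde Q^{(S)}_{h,I}(\ell)=Q^{(S)}_{h,I}(r_h|_I+\ell)$ for all $\ell\in(\ell'_*+\mathcal K)\cap\widetilde L$ (here the counting function is viewed as a function of the projection of its argument to $L'_I$). Then $\mathrm{pc}^{\mathcal K}(S_h(\mathbf t_I)):=\widetilde Q^{(S)}_{h,I}(0)$. Replacing $Q$ by $q$ one obtains $\widetilde q^{(S)}_{h,I}$ and $\mathrm{mpc}^{\mathcal K}(S_h(\mathbf t_I)):=\widetilde q^{(S)}_{h,I}(0)$. These numbers do not depend on the choice of $\ell'_*$ and $\widetilde L$. It is known that $Q_{h,I}$ and $q_{h,I}$ (and the counting functions of the twisted series) admit quasi-polynomials in the cone $\pi_I(\mathcal S'_{\mathbb R})$, defined on $L_I$; those of $Z_h(\mathbf t_I)$ are denoted $\widetilde Q_{h,I}$ and $\widetilde q_{h,I}$, and they are evaluated on elements of $L$ through the projection $L\to L_I$. Note that $r_h-\check\ell_0(h)\in L$. *)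

theory Defs
  imports "HOL-Analysis.Analysis" "HOL-Algebra.Coset"
    "HOL-Computational_Algebra.Formal_Power_Series"
begin

text \<open>
  The singularity enters only through the dual graph of its good resolution: a connected tree
  of rational curves, with vertex set the finite type \<open>'v\<close>, and with negative definite
  intersection form.  By theorems of Du Val, Mumford and Grauert these are exactly the dual graphs
  of good resolutions of normal surface singularities whose link is a rational homology sphere.
  The real vector space spanned by the exceptional curves is \<open>real ^ 'v\<close>.
\<close>

record 'v resolution_graph =
  adj :: "'v \<Rightarrow> 'v \<Rightarrow> bool"
  self_int :: "'v \<Rightarrow> int"

definition is_cycle :: "('v \<Rightarrow> 'v \<Rightarrow> bool) \<Rightarrow> 'v list \<Rightarrow> bool" where
  "is_cycle E c \<longleftrightarrow> length c \<ge> 3 \<and> distinct c \<and> successively E c \<and> E (last c) (hd c)"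

definition is_tree :: "('v \<Rightarrow> 'v \<Rightarrow> bool) \<Rightarrow> bool" where
  "is_tree E \<longleftrightarrow> symp E \<and> irreflp E \<and> (\<forall>u v. E\<^sup>*\<^sup>* u v) \<and> (\<nexists>c. is_cycle E c)"

definition val :: "'v::finite resolution_graph \<Rightarrow> 'v \<Rightarrow> nat" where
  "val G v = card {u. adj G v u}"

definition int_number :: "'v::finite resolution_graph \<Rightarrow> 'v \<Rightarrow> 'v \<Rightarrow> int" where
  "int_number G u v = (if u = v then self_int G v else if adj G u v then 1 else 0)"

definition int_form :: "'v::finite resolution_graph \<Rightarrow> real ^ 'v \<Rightarrow> real ^ 'v \<Rightarrow> real" where
  "int_form G x y = (\<Sum>u\<in>UNIV. \<Sum>v\<in>UNIV. of_int (int_number G u v) * x $ u * y $ v)"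

definition QHS_resolution_graph :: "'v::finite resolution_graph \<Rightarrow> bool" where
  "QHS_resolution_graph G \<longleftrightarrow> is_tree (adj G) \<and> (\<forall>x. x \<noteq> 0 \<longrightarrow> int_form G x x < 0)"

abbreviation E_curve :: "'v::finite \<Rightarrow> real ^ 'v" where
  "E_curve v \<equiv> axis v 1"

definition lat :: "(real ^ 'v::finite) set" where
  "lat = {x. \<forall>v. x $ v \<in> \<int>}"

definition dual_lat :: "'v::finite resolution_graph \<Rightarrow> (real ^ 'v) set" where
  "dual_lat G = {x. (\<forall>v. x $ v \<in> \<rat>) \<and> (\<forall>y\<in>lat. int_form G x y \<in> \<int>)}"

definition dual_vec :: "'v::finite resolution_graph \<Rightarrow> 'v \<Rightarrow> real ^ 'v" where
  "dual_vec G u = (THE x. x \<in> dual_lat G \<and>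
     (\<forall>v. int_form G x (E_curve v) = (if u = v then -1 else 0)))"

definition add_group :: "'a::ab_group_add set \<Rightarrow> 'a monoid" where
  "add_group A = \<lparr>carrier = A, mult = (+), one = 0\<rparr>"

text \<open>
  The group \<open>H = L'/L\<close>; it is written multiplicatively, following \<^theory>\<open>HOL-Algebra.Coset\<close>.
\<close>

definition disc_group :: "'v::finite resolution_graph \<Rightarrow> (real ^ 'v) set monoid" where
  "disc_group G = add_group (dual_lat G) Mod lat"

definition cls :: "'v::finite resolution_graph \<Rightarrow> real ^ 'v \<Rightarrow> (real ^ 'v) set" where
  "cls G x = lat #>\<^bsub>add_group (dual_lat G)\<^esub> x"

abbreviation disc_diff ::
    "'v::finite resolution_graph \<Rightarrow> (real ^ 'v) set \<Rightarrow> (real ^ 'v) set \<Rightarrow> (real ^ 'v) set" where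
  "disc_diff G a b \<equiv> a \<otimes>\<^bsub>disc_group G\<^esub> inv\<^bsub>disc_group G\<^esub> b"

definition repr :: "'v::finite resolution_graph \<Rightarrow> (real ^ 'v) set \<Rightarrow> real ^ 'v" where
  "repr G h = (THE r. r \<in> dual_lat G \<and> cls G r = h \<and> (\<forall>v. 0 \<le> r $ v \<and> r $ v < 1))"

definition Z_K :: "'v::finite resolution_graph \<Rightarrow> real ^ 'v" where
  "Z_K G = (THE x. x \<in> dual_lat G \<and>
     (\<forall>v. int_form G x (E_curve v) = int_form G (E_curve v) (E_curve v) + 2))"

definition lipman_cone :: "'v::finite resolution_graph \<Rightarrow> (real ^ 'v) set" where
  "lipman_cone G = {x \<in> dual_lat G. \<forall>v. int_form G x (E_curve v) \<le> 0}"

definition real_lipman_cone :: "'v::finite resolution_graph \<Rightarrow> (real ^ 'v) set" where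
  "real_lipman_cone G = {\<Sum>v\<in>UNIV. c v *\<^sub>R dual_vec G v | c. \<forall>v. 0 \<le> c v}"

text \<open>
  \<open>L\<^sub>I\<close> and \<open>L'\<^sub>I \<otimes> \<real>\<close> are regarded as subsets of \<open>real ^ 'v\<close>, with zero coordinates
  outside of \<open>I\<close>.
\<close>

definition proj :: "'v set \<Rightarrow> real ^ 'v::finite \<Rightarrow> real ^ 'v" where
  "proj I x = (\<chi> v. if v \<in> I then x $ v else 0)"

definition lat_on :: "'v set \<Rightarrow> (real ^ 'v::finite) set" where
  "lat_on I = proj I ` lat"

text \<open>
  A series \<open>\<Sum> a(l') t\<^bsup>l'\<^esup>\<close> is given by its coefficient function \<open>a\<close>.  In \<open>zcoeff\<close>, each factor
  \<open>(1 - t\<^bsup>E\<^sub>v\<^sup>*\<^esup>)\<^bsup>val(v) - 2\<^esup>\<close> is expanded as a power series in the monomial \<open>t\<^bsup>E\<^sub>v\<^sup>*\<^esup>\<close>, and the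
  expansions are multiplied; the index set of the sum has at most one element, since the \<open>E\<^sub>v\<^sup>*\<close>
  are linearly independent.
\<close>

definition zcoeff :: "'v::finite resolution_graph \<Rightarrow> real ^ 'v \<Rightarrow> real" where
  "zcoeff G l = (\<Sum>n | (\<Sum>v\<in>UNIV. real (n v) *\<^sub>R dual_vec G v) = l.
     \<Prod>v\<in>UNIV. fps_nth ((1 - fps_X) powi (int (val G v) - 2)) (n v))"

definition twisted_zcoeff :: "'v::finite resolution_graph \<Rightarrow> real ^ 'v \<Rightarrow> real ^ 'v \<Rightarrow> real" where
  "twisted_zcoeff G l0 l = zcoeff G (l - l0)"

text \<open>
  The sums are restricted to the support of \<open>a\<close> to make them finite sums for the series at hand.
  Both functions depend on \<open>x\<close> only through \<open>proj I x\<close>.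
\<close>

definition Q_count :: "'v::finite resolution_graph \<Rightarrow> (real ^ 'v \<Rightarrow> real) \<Rightarrow>
    (real ^ 'v) set \<Rightarrow> 'v set \<Rightarrow> real ^ 'v \<Rightarrow> real" where
  "Q_count G a h I x =
     (\<Sum>l | l \<in> dual_lat G \<and> cls G l = h \<and> \<not> (\<forall>v\<in>I. l $ v \<ge> x $ v) \<and> a l \<noteq> 0. a l)"

definition q_count :: "'v::finite resolution_graph \<Rightarrow> (real ^ 'v \<Rightarrow> real) \<Rightarrow>
    (real ^ 'v) set \<Rightarrow> 'v set \<Rightarrow> real ^ 'v \<Rightarrow> real" where
  "q_count G a h I x =
     (\<Sum>l | l \<in> dual_lat G \<and> cls G l = h \<and> (\<forall>v\<in>I. l $ v < x $ v) \<and> a l \<noteq> 0. a l)"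

definition finite_index_sublattice :: "'a::ab_group_add set \<Rightarrow> 'a set \<Rightarrow> bool" where
  "finite_index_sublattice M N \<longleftrightarrow>
     subgroup M (add_group N) \<and> finite (rcosets\<^bsub>add_group N\<^esub> M)"

definition quasi_polynomial_on :: "'a::real_normed_vector set \<Rightarrow> ('a \<Rightarrow> real) \<Rightarrow> bool" where
  "quasi_polynomial_on N g \<longleftrightarrow> (\<exists>M. finite_index_sublattice M N \<and>
     (\<forall>b\<in>N. \<exists>p. real_polynomial_function p \<and> (\<forall>l\<in>M. g (b + l) = p (b + l))))"

definition quasi_polynomial_in_cone ::
    "'a::real_normed_vector set \<Rightarrow> 'a set \<Rightarrow> ('a \<Rightarrow> real) \<Rightarrow> ('a \<Rightarrow> real) \<Rightarrow> bool" where
  "quasi_polynomial_in_cone K N F g \<longleftrightarrow> quasi_polynomial_on N g \<and>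
     (\<exists>s\<in>K. \<forall>l \<in> (\<lambda>k. s + k) ` K \<inter> N. g l = F l)"

text \<open>
  The counting functions of the series \<open>a\<close> are shifted by \<open>repr G h\<close>.  The descriptions by
  \<open>THE\<close> are meaningful only when the quasi-polynomial exists in the cone \<open>K\<close>; its values
  are then independent of all choices if \<open>K\<close> is full-dimensional in \<open>L'\<^sub>I \<otimes> \<real>\<close>.
\<close>

definition pc :: "'v::finite resolution_graph \<Rightarrow> (real ^ 'v) set \<Rightarrow> (real ^ 'v \<Rightarrow> real) \<Rightarrow>
    (real ^ 'v) set \<Rightarrow> 'v set \<Rightarrow> real" where
  "pc G K a h I = (THE c. \<exists>N g. finite_index_sublattice N (lat_on I) \<and>
     quasi_polynomial_in_cone K N (\<lambda>l. Q_count G a h I (proj I (repr G h) + l)) g \<and> c = g 0)"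

definition mpc :: "'v::finite resolution_graph \<Rightarrow> (real ^ 'v) set \<Rightarrow> (real ^ 'v \<Rightarrow> real) \<Rightarrow>
    (real ^ 'v) set \<Rightarrow> 'v set \<Rightarrow> real" where
  "mpc G K a h I = (THE c. \<exists>N g. finite_index_sublattice N (lat_on I) \<and>
     quasi_polynomial_in_cone K N (\<lambda>l. q_count G a h I (proj I (repr G h) + l)) g \<and> c = g 0)"

abbreviation lipman_proj :: "'v::finite resolution_graph \<Rightarrow> 'v set \<Rightarrow> (real ^ 'v) set" where
  "lipman_proj G I \<equiv> proj I ` real_lipman_cone G"

text \<open>
  The quasi-polynomials of \<open>Z\<^sub>h(t\<^sub>I)\<close>, as functions on \<open>L\<close>; unlike in \<open>pc\<close> and \<open>mpc\<close>, they are
  required on the whole lattice \<open>L\<^sub>I\<close>.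
\<close>

definition Q_tilde :: "'v::finite resolution_graph \<Rightarrow> (real ^ 'v) set \<Rightarrow> 'v set \<Rightarrow>
    real ^ 'v \<Rightarrow> real" where
  "Q_tilde G h I x = (THE c. \<exists>g. quasi_polynomial_in_cone (lipman_proj G I) (lat_on I)
     (\<lambda>l. Q_count G (zcoeff G) h I (proj I (repr G h) + l)) g \<and> c = g (proj I x))"

definition q_tilde :: "'v::finite resolution_graph \<Rightarrow> (real ^ 'v) set \<Rightarrow> 'v set \<Rightarrow>
    real ^ 'v \<Rightarrow> real" where
  "q_tilde G h I x = (THE c. \<exists>g. quasi_polynomial_in_cone (lipman_proj G I) (lat_on I)
     (\<lambda>l. q_count G (zcoeff G) h I (proj I (repr G h) + l)) g \<and> c = g (proj I x))"

definition ell_check :: "'v::finite resolution_graph \<Rightarrow> real ^ 'v \<Rightarrow> (real ^ 'v) set \<Rightarrow>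
    real ^ 'v" where
  "ell_check G l0 h = l0 + repr G (disc_diff G h (cls G l0))"

end

theory Submission
  imports Defs
begin

text \<open>
  For \<open>x \<in> L'\<close> put \<open>n\<^sub>w(x) = -(x, E\<^sub>w)\<close>.  In the basis \<open>E\<^sub>w\<^sup>*\<close> these are the coordinates of \<open>x\<close>, so the
  coefficient of \<open>Z\<close> at \<open>x\<close> is the product over \<open>w\<close> of the coefficients of \<open>X\<close> to the power \<open>n\<^sub>w(x)\<close>
  in \<open>(1 - X)\<close> to the power \<open>val w - 2\<close>, and a counting function at \<open>x\<close> is a sum of
  such products over the points \<open>x + l\<close> with \<open>l\<close> in a region of the lattice \<open>L\<close>.

  The source of duality is a symmetric function (\<open>reciprocal\<close>).  There is a function \<open>P\<close> on \<open>L'\<close> that is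
  quasi-polynomial everywhere, satisfies \<open>P(Z\<^sub>K - x) = P(x)\<close>, and equals the counting function at
  each \<open>x\<close> that is bounded below as follows: some real vector \<open>\<xi>\<close> with \<open>n\<^sub>w(\<xi>) \<ge> val w - 2\<close> for all \<open>w\<close> satisfies
  \<open>\<xi>\<^sub>u < x\<^sub>u \<le> \<xi>\<^sub>u + 1\<close> for \<open>u \<in> I\<close>.  Points deep in the projected Lipman cone are of
  this kind, hence \<open>P\<close> is the quasi-polynomial of the counting function.  The point
  \<open>Z\<^sub>K - r\<^sub>h + l\<^sub>0\<close> is of this kind too, with \<open>\<xi> = Z\<^sub>K - E + l\<^sub>0\<close>, where \<open>E\<close> is the sum of all curves.
  Therefore \<open>P(r\<^sub>h - l\<^sub>0) = P(Z\<^sub>K - r\<^sub>h + l\<^sub>0)\<close> is the value of the counting function there, and this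
  is the asserted duality.

  The function \<open>P\<close> is built for \<open>Q\<close>; the case of \<open>q\<close> follows by inclusion-exclusion
  (\<open>reciprocal_mixed\<close>).  Enlarging \<open>J\<close> by a vertex \<open>v\<close> changes \<open>Q\<close> by the sum over
  \<open>l\<^sub>v < 0\<close> and \<open>l\<^sub>u \<ge> 0\<close> for \<open>u \<in> J\<close>.  Three facts describe this sum.

  \<^item> At each \<open>x\<close> that is bounded below, the conditions at \<open>J\<close> may be replaced by fixing \<open>l\<^sub>u = 0\<close> and
    deleting \<open>J\<close> from the tree: only the component \<open>W\<close> of \<open>v\<close> remains
    (\<open>state_sum_pinned\<close>).  Leaves are summed out one at a time.  If \<open>c\<close> is a leaf with neighbour
    \<open>p\<close>, summing over \<open>l\<^sub>c\<close> replaces the local weight of \<open>p\<close> by its convolution with a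
    finitely supported kernel of total mass one, and \<open>\<xi>\<close> bounds the support of the kernel.  For \<open>c \<in> J\<close> and
    \<open>l\<^sub>p\<close> at most \<open>\<xi>\<^sub>p - x\<^sub>p\<close> the kernel is the unit mass at \<open>0\<close>, and this is exactly the effect of the deletion.

  \<^item> The remaining sum \<open>A\<close> over \<open>W\<close> vanishes at \<open>Z\<^sub>K - x\<close>, by the minimum principle for
    negative definite forms (\<open>subtree_sum_eq_0\<close>).  So \<open>A(x)\<close> may be replaced by
    \<open>A(x) + A(Z\<^sub>K - x)\<close>, which is symmetric by construction.

  \<^item> This symmetric sum is quasi-polynomial everywhere (\<open>quasi_poly_balanced_sum\<close>).  The rational
    function with expansion \<open>Z\<close> is invariant, up to a monomial, under inversion of the variables, so
    \<open>A(Z\<^sub>K - x)\<close> is a sum over \<open>l\<^sub>v \<ge> 0\<close> of coefficients of the expansion at infinity.  Raising the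
    bound on \<open>l\<^sub>v\<close> by one adds the difference of the two expansions on a slice.  After all vertices
    but \<open>v\<close> are summed out this is the difference of the two expansions of a Laurent polynomial times
    \<open>(1 - X)\<close> to the power \<open>-2\<close>, which is affine in the exponent; so the symmetric sum is quadratic
    up to periodicity.
\<close>

section \<open>Finitely supported sums and backward differences\<close>

text \<open>
  On coefficient sequences this is multiplication by \<open>1 - X\<close>.  The exponent of a vertex is thereby
  encoded as a number of differences, applied to an expansion of \<open>(1 - X)\<close> to the power \<open>-2\<close>,
  either at \<open>0\<close> or at infinity.
\<close>

definition bdiff :: "(int \<Rightarrow> real) \<Rightarrow> int \<Rightarrow> real" where
  "bdiff f m = f m - f (m - 1)"

lemma infsum_finite_support:
  fixes f :: "'a \<Rightarrow> real"
  assumes "finite {x \<in> A. f x \<noteq> 0}"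
  shows "infsum f A = sum f {x \<in> A. f x \<noteq> 0}"
proof -
  have "infsum f A = infsum f {x \<in> A. f x \<noteq> 0}"
    by (rule infsum_cong_neutral) auto
  with assms show ?thesis by simp
qed

lemma summable_on_finite_support:
  fixes f :: "'a \<Rightarrow> real"
  assumes "finite {x \<in> A. f x \<noteq> 0}"
  shows "f summable_on A"
proof -
  have "f summable_on {x \<in> A. f x \<noteq> 0}" using assms by (rule summable_on_finite)
  moreover have "f summable_on A \<longleftrightarrow> f summable_on {x \<in> A. f x \<noteq> 0}"
    by (rule summable_on_cong_neutral) auto
  ultimately show ?thesis by simp
qed

lemma infsum_difference:
  fixes f g :: "'a \<Rightarrow> real"
  assumes "f summable_on A" "g summable_on A"
  shows "(\<Sum>\<^sub>\<infinity>x\<in>A. f x - g x) = infsum f A - infsum g A"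
  using infsum_add[OF assms(1) summable_on_uminus[THEN iffD2, OF assms(2)]]
  by (simp add: infsum_uminus)

lemma bdiff_pow_shift:
  "(bdiff ^^ d) (\<lambda>m. f (a + m)) = (\<lambda>m. (bdiff ^^ d) f (a + m))"
  by (induction d) (auto simp: bdiff_def algebra_simps)

text \<open>
  Reflection of the exponent exchanges the expansions at \<open>0\<close> and at infinity; each factor \<open>1 - X\<close>
  contributes a sign and a shift by one.
\<close>

lemma bdiff_pow_reflect:
  "(bdiff ^^ d) (\<lambda>m. f (a - m)) = (\<lambda>m. (- 1) ^ d * (bdiff ^^ d) f (a + int d - m))"
  by (induction d) (auto simp: bdiff_def algebra_simps)

lemma finite_support_bdiff_pow:
  assumes "\<And>m. finite {j. b j * f (m - j) \<noteq> (0::real)}"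
  shows "finite {j::int. b j * (bdiff ^^ d) f (m - j) \<noteq> 0}"
proof (induction d arbitrary: m)
  case (Suc d)
  have "{j. b j * (bdiff ^^ Suc d) f (m - j) \<noteq> 0} \<subseteq>
      {j. b j * (bdiff ^^ d) f (m - j) \<noteq> 0} \<union> {j. b j * (bdiff ^^ d) f (m - 1 - j) \<noteq> 0}"
    by (auto simp: bdiff_def algebra_simps)
  then show ?case using Suc.IH[of m] Suc.IH[of "m - 1"] by (meson finite_Un finite_subset)
qed (use assms in auto)

text \<open>
  Summation by parts: one of the \<open>d + 1\<close> differences is moved to the other factor of the
  convolution.  When a leaf is summed out, this is what lowers the valence of its neighbour by one.
\<close>

lemma convolution_bdiff_pow:
  assumes fin: "\<And>m. finite {j. b j * f (m - j) \<noteq> (0::real)}"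
  shows "(\<Sum>\<^sub>\<infinity>j::int. b j * (bdiff ^^ Suc d) f (m - j))
       = (bdiff ^^ d) (\<lambda>m. \<Sum>\<^sub>\<infinity>j. (b j - b (j - 1)) * f (m - j)) m"
proof -
  define c where "c = (\<lambda>d m. \<Sum>\<^sub>\<infinity>j::int. b j * (bdiff ^^ d) f (m - j))"
  have s: "(\<lambda>j. b j * (bdiff ^^ d) f (m - j)) summable_on UNIV" for d m
    using finite_support_bdiff_pow[OF fin, of d m] by (intro summable_on_finite_support) simp
  have step: "c (Suc d) = bdiff (c d)" for d
  proof
    fix m
    have "c (Suc d) m = (\<Sum>\<^sub>\<infinity>j. b j * (bdiff ^^ d) f (m - j) - b j * (bdiff ^^ d) f (m - 1 - j))"
      unfolding c_def by (intro infsum_cong) (auto simp: bdiff_def algebra_simps)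
    also have "\<dots> = c d m - c d (m - 1)"
      unfolding c_def by (rule infsum_difference) (rule s)+
    also have "\<dots> = bdiff (c d) m" by (simp add: bdiff_def)
    finally show "c (Suc d) m = bdiff (c d) m" .
  qed
  have pow: "c (Suc d) = (bdiff ^^ d) (bdiff (c 0))"
    by (induction d) (simp_all add: step del: funpow.simps(2), simp add: step)
  have "bdiff (c 0) m = (\<Sum>\<^sub>\<infinity>j. (b j - b (j - 1)) * f (m - j))" for m
  proof -
    have "bij_betw (\<lambda>j::int. j - 1) UNIV UNIV" by (rule bij_betwI[of _ _ _ "\<lambda>j. j + 1"]) auto
    from infsum_reindex_bij_betw[OF this, of "\<lambda>j. b j * f (m - 1 - j)"]
    have e: "(\<Sum>\<^sub>\<infinity>j. b j * f (m - 1 - j)) = (\<Sum>\<^sub>\<infinity>j. b (j - 1) * f (m - j))"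
      by (simp add: algebra_simps)
    from summable_on_reindex_bij_betw[OF \<open>bij_betw (\<lambda>j::int. j - 1) UNIV UNIV\<close>, of "\<lambda>j. b j * f (m - 1 - j)"]
    have s2: "(\<lambda>j. b (j - 1) * f (m - j)) summable_on UNIV"
      using s[of 0 "m - 1"] by (simp add: algebra_simps)
    have "bdiff (c 0) m = (\<Sum>\<^sub>\<infinity>j. b j * f (m - j)) - (\<Sum>\<^sub>\<infinity>j. b (j - 1) * f (m - j))"
      by (simp add: bdiff_def[of "c 0"]) (simp add: c_def e)
    also have "\<dots> = (\<Sum>\<^sub>\<infinity>j. b j * f (m - j) - b (j - 1) * f (m - j))"
      using s[of 0 m] s2 by (intro infsum_difference[symmetric]) simp_all
    finally show ?thesis by (simp add: algebra_simps)
  qed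
  then have "bdiff (c 0) = (\<lambda>m. \<Sum>\<^sub>\<infinity>j. (b j - b (j - 1)) * f (m - j))" by auto
  with pow show ?thesis unfolding c_def by metis
qed

section \<open>State sums on a tree\<close>

text \<open>
  \<open>grows E W U\<close>: attaching leaves one by one turns \<open>W\<close> into \<open>U\<close>.  Read backwards, the derivation is an
  order in which the vertices of \<open>U\<close> outside \<open>W\<close> can be eliminated as leaves.
\<close>

inductive grows :: "('v \<Rightarrow> 'v \<Rightarrow> bool) \<Rightarrow> 'v set \<Rightarrow> 'v set \<Rightarrow> bool" for E W where
  refl: "grows E W W"
| attach: "grows E W U \<Longrightarrow> p \<in> U \<Longrightarrow> c \<notin> U \<Longrightarrow> \<forall>u\<in>U. E c u \<longleftrightarrow> u = p \<Longrightarrow>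
    grows E W (insert c U)"

definition nbrs :: "('v \<Rightarrow> 'v \<Rightarrow> bool) \<Rightarrow> 'v set \<Rightarrow> 'v \<Rightarrow> 'v set" where
  "nbrs E U w = {u \<in> U. E w u}"

definition configs :: "('v \<Rightarrow> int set) \<Rightarrow> 'v set \<Rightarrow> ('v \<Rightarrow> int) set" where
  "configs Y U = {l. (\<forall>w\<in>U. l w \<in> Y w) \<and> (\<forall>w. w \<notin> U \<longrightarrow> l w = 0)}"

text \<open>
  The vertex \<open>v\<close> is never eliminated.  The positive vector \<open>\<omega>\<close> is the direction in which the
  bounds on the local weights are allowed to grow.
\<close>

locale tree_sum =
  fixes E :: "'v::finite \<Rightarrow> 'v \<Rightarrow> bool" and v :: 'v and \<omega> :: "'v \<Rightarrow> real"
  assumes E_sym: "E a b \<Longrightarrow> E b a" and E_irrefl: "\<not> E a a" and \<omega>_pos: "\<omega> a > 0"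
begin

text \<open>
  A vertex \<open>w\<close> with value \<open>y\<close> carries a sequence \<open>H w y\<close>, the coefficients of \<open>(1 - X)\<close> to the power
  \<open>-2\<close> times a Laurent polynomial depending on \<open>y\<close>.  The differences, one for each
  neighbour in \<open>U\<close>, restore the exponent.  The offset \<open>s\<close> at \<open>v\<close> makes the dependence on the degree
  at \<open>v\<close> visible throughout an elimination.
\<close>

definition local_weight ::
    "'v set \<Rightarrow> int \<Rightarrow> ('v \<Rightarrow> int \<Rightarrow> int \<Rightarrow> real) \<Rightarrow> ('v \<Rightarrow> int) \<Rightarrow> 'v \<Rightarrow> real" where
  "local_weight U s H l w =
     (bdiff ^^ card (nbrs E U w)) (H w (l w)) ((if w = v then s else 0) - (\<Sum>u\<in>nbrs E U w. l u))"

definition weight :: "'v set \<Rightarrow> int \<Rightarrow> ('v \<Rightarrow> int \<Rightarrow> int \<Rightarrow> real) \<Rightarrow> ('v \<Rightarrow> int) \<Rightarrow> real" where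
  "weight U s H l = (\<Prod>w\<in>U. local_weight U s H l w)"

definition state_sum ::
    "('v \<Rightarrow> int set) \<Rightarrow> 'v set \<Rightarrow> int \<Rightarrow> ('v \<Rightarrow> int \<Rightarrow> int \<Rightarrow> real) \<Rightarrow> real" where
  "state_sum Y U s H = (\<Sum>\<^sub>\<infinity>l\<in>configs Y U. weight U s H l)"

definition finite_states ::
    "('v \<Rightarrow> int set) \<Rightarrow> 'v set \<Rightarrow> int \<Rightarrow> ('v \<Rightarrow> int \<Rightarrow> int \<Rightarrow> real) \<Rightarrow> bool" where
  "finite_states Y U s H \<longleftrightarrow> finite {l \<in> configs Y U. weight U s H l \<noteq> 0}"

text \<open>
  The local weight of a leaf \<open>c\<close> with value \<open>j\<close> when its only neighbour has value \<open>y\<close>.  As \<open>j\<close> runs from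
  minus to plus infinity it passes from \<open>0\<close> to \<open>1\<close>, so its first difference \<open>kernel\<close> is finitely
  supported of mass one.
\<close>

definition transfer :: "('v \<Rightarrow> int set) \<Rightarrow> ('v \<Rightarrow> int \<Rightarrow> int \<Rightarrow> real) \<Rightarrow> 'v \<Rightarrow> int \<Rightarrow> int \<Rightarrow> real" where
  "transfer Y H c y j = (if j \<in> Y c then bdiff (H c j) (- y) else 0)"

abbreviation kernel :: "('v \<Rightarrow> int set) \<Rightarrow> ('v \<Rightarrow> int \<Rightarrow> int \<Rightarrow> real) \<Rightarrow> 'v \<Rightarrow> int \<Rightarrow> int \<Rightarrow> real" where
  "kernel Y H c y j \<equiv> transfer Y H c y j - transfer Y H c y (j - 1)"

definition absorb :: "('v \<Rightarrow> int set) \<Rightarrow> ('v \<Rightarrow> int \<Rightarrow> int \<Rightarrow> real) \<Rightarrow> 'v \<Rightarrow> 'v \<Rightarrow>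
    'v \<Rightarrow> int \<Rightarrow> int \<Rightarrow> real" where
  "absorb Y H c p = H(p := \<lambda>y m. \<Sum>\<^sub>\<infinity>j. kernel Y H c y j * H p y (m - j))"

context
  fixes U c p
  assumes vU: "v \<in> U" and pU: "p \<in> U" and cU: "c \<notin> U" and leaf: "\<forall>u\<in>U. E c u \<longleftrightarrow> u = p"
begin

lemma nbrs_leaf: "nbrs E (insert c U) c = {p}"
  using pU leaf E_irrefl by (auto simp: nbrs_def)

lemma nbrs_parent: "nbrs E (insert c U) p = insert c (nbrs E U p)"
  using pU leaf E_sym by (auto simp: nbrs_def)

lemma leaf_notin_nbrs: "c \<notin> nbrs E U w"
  using cU by (auto simp: nbrs_def)

lemma nbrs_other: "w \<in> U \<Longrightarrow> w \<noteq> p \<Longrightarrow> nbrs E (insert c U) w = nbrs E U w"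
  using leaf E_sym by (auto simp: nbrs_def)

lemma weight_insert:
  assumes "l \<in> configs Y U"
  shows "weight (insert c U) s H (l(c := j)) =
    (\<Prod>w\<in>U - {p}. local_weight U s H l w) * (bdiff (H c j) (- l p) *
     (bdiff ^^ Suc (card (nbrs E U p))) (H p (l p))
       ((if p = v then s else 0) - (\<Sum>u\<in>nbrs E U p. l u) - j))"
proof -
  have cp: "c \<noteq> p" "c \<noteq> v" using cU pU vU by auto
  have 1: "local_weight (insert c U) s H (l(c := j)) c = bdiff (H c j) (- l p)"
    using cp by (simp add: local_weight_def nbrs_leaf)
  have s: "(\<Sum>u\<in>nbrs E U w. (l(c := j)) u) = (\<Sum>u\<in>nbrs E U w. l u)" for w
    by (rule sum.cong) (use leaf_notin_nbrs in auto)
  have 2: "local_weight (insert c U) s H (l(c := j)) p =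
     (bdiff ^^ Suc (card (nbrs E U p))) (H p (l p))
       ((if p = v then s else 0) - (\<Sum>u\<in>nbrs E U p. l u) - j)"
    unfolding local_weight_def nbrs_parent using cp leaf_notin_nbrs[of p] s[of p]
    by (simp add: algebra_simps del: funpow.simps)
  have 3: "local_weight (insert c U) s H (l(c := j)) w = local_weight U s H l w"
    if "w \<in> U - {p}" for w
    using that cU s[of w] unfolding local_weight_def by (simp add: nbrs_other del: fun_upd_apply) auto
  have "weight (insert c U) s H (l(c := j)) = local_weight (insert c U) s H (l(c := j)) c *
      (local_weight (insert c U) s H (l(c := j)) p *
        (\<Prod>w\<in>U - {p}. local_weight (insert c U) s H (l(c := j)) w))"
    unfolding weight_def using cU pU
    by (subst prod.insert) (auto simp: prod.remove[of U p])
  also have "\<dots> = bdiff (H c j) (- l p) * ((bdiff ^^ Suc (card (nbrs E U p))) (H p (l p))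
       ((if p = v then s else 0) - (\<Sum>u\<in>nbrs E U p. l u) - j) * (\<Prod>w\<in>U - {p}. local_weight U s H l w))"
    unfolding 1 2 using 3 by (simp del: funpow.simps)
  finally show ?thesis by (simp del: funpow.simps)
qed

lemma configs_insert_bij:
  "bij_betw (\<lambda>(l, j). l(c := j)) (configs Y U \<times> Y c) (configs Y (insert c U))"
proof (rule bij_betwI[of _ _ _ "\<lambda>l. (l(c := 0), l c)"])
  show "(\<lambda>(l, j). l(c := j)) \<in> configs Y U \<times> Y c \<rightarrow> configs Y (insert c U)"
    using cU by (auto simp: configs_def)
  show "(\<lambda>l. (l(c := 0), l c)) \<in> configs Y (insert c U) \<rightarrow> configs Y U \<times> Y c"
    using cU by (auto simp: configs_def)
  fix x assume "x \<in> configs Y U \<times> Y c"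
  then show "((case x of (l, j) \<Rightarrow> l(c := j))(c := 0), (case x of (l, j) \<Rightarrow> l(c := j)) c) = x"
    using cU by (auto simp: configs_def fun_eq_iff split: prod.splits)
next
  fix l assume "l \<in> configs Y (insert c U)"
  then show "(case (l(c := 0), l c) of (l, j) \<Rightarrow> l(c := j)) = l" by auto
qed

lemma weight_absorb:
  assumes comp: "\<And>y m. y \<in> Y p \<Longrightarrow> finite {j. transfer Y H c y j * H p y (m - j) \<noteq> 0}"
    and l: "l \<in> configs Y U"
  shows "(\<Sum>\<^sub>\<infinity>j\<in>Y c. weight (insert c U) s H (l(c := j))) = weight U s (absorb Y H c p) l"
proof -
  define a where "a = (if p = v then s else 0) - (\<Sum>u\<in>nbrs E U p. l u)"
  define q where "q = (\<Prod>w\<in>U - {p}. local_weight U s H l w)"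
  have lp: "l p \<in> Y p" using l pU by (auto simp: configs_def)
  have "(\<Sum>\<^sub>\<infinity>j\<in>Y c. weight (insert c U) s H (l(c := j)))
      = (\<Sum>\<^sub>\<infinity>j. q * (transfer Y H c (l p) j * (bdiff ^^ Suc (card (nbrs E U p))) (H p (l p)) (a - j)))"
    by (rule infsum_cong_neutral)
       (auto simp: weight_insert[OF l] transfer_def q_def a_def simp del: funpow.simps)
  also have "\<dots> = q * (\<Sum>\<^sub>\<infinity>j. transfer Y H c (l p) j * (bdiff ^^ Suc (card (nbrs E U p))) (H p (l p)) (a - j))"
    by (rule infsum_cmult_right')
  also have "\<dots> = q * (bdiff ^^ card (nbrs E U p)) (absorb Y H c p p (l p)) a"
    unfolding convolution_bdiff_pow[of "transfer Y H c (l p)" "H p (l p)", OF comp[OF lp]]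
    by (simp add: absorb_def)
  also have "(bdiff ^^ card (nbrs E U p)) (absorb Y H c p p (l p)) a = local_weight U s (absorb Y H c p) l p"
    by (simp add: local_weight_def a_def)
  also have "q = (\<Prod>w\<in>U - {p}. local_weight U s (absorb Y H c p) l w)"
    unfolding q_def by (rule prod.cong) (auto simp: local_weight_def absorb_def)
  finally show ?thesis
    unfolding weight_def using pU by (simp add: prod.remove[of U p] mult.commute)
qed

text \<open>
  Summing over the value of the leaf \<open>c\<close> affects only the weight of its neighbour \<open>p\<close>.  By
  summation by parts that weight is convolved with the first difference of \<open>transfer\<close>.
\<close>

lemma eliminate_leaf:
  assumes comp: "\<And>y m. y \<in> Y p \<Longrightarrow> finite {j. transfer Y H c y j * H p y (m - j) \<noteq> 0}"
    and fin: "finite_states Y (insert c U) s H"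
  shows "state_sum Y (insert c U) s H = state_sum Y U s (absorb Y H c p)"
    and "finite_states Y U s (absorb Y H c p)"
proof -
  let ?w = "\<lambda>l. weight (insert c U) s H l"
  have fin': "finite {x \<in> configs Y U \<times> Y c. ?w (case x of (l, j) \<Rightarrow> l(c := j)) \<noteq> 0}"
  proof (rule inj_on_finite[OF _ _ fin[unfolded finite_states_def]])
    show "inj_on (\<lambda>(l, j). l(c := j)) {x \<in> configs Y U \<times> Y c. ?w (case x of (l, j) \<Rightarrow> l(c := j)) \<noteq> 0}"
      using configs_insert_bij[of Y] by (auto simp: bij_betw_def intro: inj_on_subset)
    show "(\<lambda>(l, j). l(c := j)) ` {x \<in> configs Y U \<times> Y c. ?w (case x of (l, j) \<Rightarrow> l(c := j)) \<noteq> 0}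
       \<subseteq> {l \<in> configs Y (insert c U). ?w l \<noteq> 0}"
      using configs_insert_bij[of Y] by (auto simp: bij_betw_def)
  qed
  have "state_sum Y (insert c U) s H = (\<Sum>\<^sub>\<infinity>x\<in>configs Y U \<times> Y c. ?w (case x of (l, j) \<Rightarrow> l(c := j)))"
    unfolding state_sum_def by (rule infsum_reindex_bij_betw[OF configs_insert_bij, symmetric])
  also have "\<dots> = (\<Sum>\<^sub>\<infinity>(l, j)\<in>configs Y U \<times> Y c. ?w (l(c := j)))"
    by (rule infsum_cong) auto
  also have "\<dots> = (\<Sum>\<^sub>\<infinity>l\<in>configs Y U. \<Sum>\<^sub>\<infinity>j\<in>Y c. ?w (l(c := j)))"
  proof (rule infsum_Sigma'_banach[symmetric])
    show "(\<lambda>(l, j). ?w (l(c := j))) summable_on configs Y U \<times> Y c"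
      using summable_on_finite_support[OF fin'] by (simp add: case_prod_unfold)
  qed
  also have "\<dots> = state_sum Y U s (absorb Y H c p)"
    unfolding state_sum_def by (rule infsum_cong) (rule weight_absorb[OF comp])
  finally show "state_sum Y (insert c U) s H = state_sum Y U s (absorb Y H c p)" .
  have "{l \<in> configs Y U. weight U s (absorb Y H c p) l \<noteq> 0} \<subseteq>
      fst ` {x \<in> configs Y U \<times> Y c. ?w (case x of (l, j) \<Rightarrow> l(c := j)) \<noteq> 0}"
  proof
    fix l assume "l \<in> {l \<in> configs Y U. weight U s (absorb Y H c p) l \<noteq> 0}"
    then have l: "l \<in> configs Y U" and "(\<Sum>\<^sub>\<infinity>j\<in>Y c. ?w (l(c := j))) \<noteq> 0"
      using weight_absorb[OF comp] by auto
    then obtain j where "j \<in> Y c" "?w (l(c := j)) \<noteq> 0"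
      by (meson infsum_0)
    with l show "l \<in> fst ` {x \<in> configs Y U \<times> Y c. ?w (case x of (l, j) \<Rightarrow> l(c := j)) \<noteq> 0}"
      by (force simp: image_iff)
  qed
  with fin' show "finite_states Y U s (absorb Y H c p)"
    unfolding finite_states_def by (meson finite_imageI finite_subset)
qed

end

end

section \<open>Growth of the local data under elimination\<close>

context tree_sum
begin

text \<open>
  The shape of an expansion at \<open>0\<close> of \<open>(1 - X)\<close> to the power \<open>-2\<close> times a Laurent polynomial with value \<open>1\<close> at
  \<open>X = 1\<close>.  The slope of the affine part is that value; its constant term \<open>\<mu>\<close> is
  determined by the first moment of the Laurent polynomial.
\<close>

definition ramp :: "(int \<Rightarrow> real) \<Rightarrow> real \<Rightarrow> bool" where
  "ramp f \<mu> \<longleftrightarrow> (\<exists>M. \<forall>m<M. f m = 0) \<and> (\<exists>M. \<forall>m\<ge>M. f m = of_int m + \<mu>)"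

text \<open>
  The second and third clauses bound the support of the Laurent polynomial hidden in \<open>H w y\<close> from above and
  below.  For \<open>y \<ge> \<xi>\<^sub>w + t\<omega>\<^sub>w\<close> the upper bound is prescribed by the values of \<open>\<xi> + t\<omega>\<close> at the neighbours
  of \<open>w\<close>, and for \<open>y \<le> \<zeta>\<^sub>w - t\<omega>\<^sub>w\<close> the lower bound by those of \<open>\<zeta> - t\<omega>\<close>.  Using a
  whole ray of vectors instead of \<open>\<xi>\<close> alone is what makes the bounds
  survive an elimination, in which the values of the leaf are unbounded.
\<close>

definition admissible :: "('v \<Rightarrow> real) \<Rightarrow> ('v \<Rightarrow> real) \<Rightarrow> 'v set \<Rightarrow>
    ('v \<Rightarrow> int \<Rightarrow> int \<Rightarrow> real) \<Rightarrow> ('v \<Rightarrow> int \<Rightarrow> real) \<Rightarrow> bool" where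
  "admissible \<xi> \<zeta> U H \<mu> \<longleftrightarrow>
     (\<forall>w\<in>U. \<forall>y. ramp (H w y) (\<mu> w y)) \<and>
     (\<forall>w\<in>U. \<forall>y m t. 0 \<le> t \<longrightarrow> \<xi> w + t * \<omega> w \<le> of_int y \<longrightarrow>
        0 < of_int m + (\<Sum>u\<in>nbrs E U w. \<xi> u + t * \<omega> u) + card (nbrs E U w) \<longrightarrow>
        H w y m = of_int m + \<mu> w y) \<and>
     (\<forall>w\<in>U. \<forall>y m t. 0 \<le> t \<longrightarrow> of_int y \<le> \<zeta> w - t * \<omega> w \<longrightarrow>
        of_int m + (\<Sum>u\<in>nbrs E U w. \<zeta> u - t * \<omega> u) < 0 \<longrightarrow> H w y m = 0)"

lemma admissibleD:
  assumes "admissible \<xi> \<zeta> U H \<mu>" "w \<in> U"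
  shows "ramp (H w y) (\<mu> w y)"
    and "0 \<le> t \<Longrightarrow> \<xi> w + t * \<omega> w \<le> of_int y \<Longrightarrow>
        0 < of_int m + (\<Sum>u\<in>nbrs E U w. \<xi> u + t * \<omega> u) + card (nbrs E U w) \<Longrightarrow>
        H w y m = of_int m + \<mu> w y"
    and "0 \<le> t \<Longrightarrow> of_int y \<le> \<zeta> w - t * \<omega> w \<Longrightarrow>
        of_int m + (\<Sum>u\<in>nbrs E U w. \<zeta> u - t * \<omega> u) < 0 \<Longrightarrow> H w y m = 0"
  using assms unfolding admissible_def by blast+

definition allows_above :: "('v \<Rightarrow> real) \<Rightarrow> ('v \<Rightarrow> int set) \<Rightarrow> 'v \<Rightarrow> bool" where
  "allows_above \<xi> Y w \<longleftrightarrow> (\<forall>j. \<xi> w < of_int j \<longrightarrow> j \<in> Y w)"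

text \<open>
  The expansion at infinity of the rational function whose expansion at \<open>0\<close> is \<open>H w y\<close>: the two differ by the
  affine function that continues the ramp.
\<close>

definition opposite :: "('v \<Rightarrow> int \<Rightarrow> int \<Rightarrow> real) \<Rightarrow> ('v \<Rightarrow> int \<Rightarrow> real) \<Rightarrow> 'v \<Rightarrow> int \<Rightarrow> int \<Rightarrow> real" where
  "opposite H \<mu> w y m = H w y m - (of_int m + \<mu> w y)"

lemma exists_shift: "\<exists>t\<ge>0. of_int y \<le> a + t * \<omega> w" "\<exists>t\<ge>0. b - t * \<omega> w \<le> of_int y"
proof -
  show "\<exists>t\<ge>0. of_int y \<le> a + t * \<omega> w"
    by (rule exI[of _ "\<bar>of_int y - a\<bar> / \<omega> w"]) (use \<omega>_pos[of w] in \<open>auto simp: field_simps\<close>)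
  show "\<exists>t\<ge>0. b - t * \<omega> w \<le> of_int y"
    by (rule exI[of _ "\<bar>of_int y - b\<bar> / \<omega> w"]) (use \<omega>_pos[of w] in \<open>auto simp: field_simps\<close>)
qed

lemma sum_first_differences:
  fixes b :: "int \<Rightarrow> real"
  assumes "\<And>j. j < lo \<Longrightarrow> b j = 0" "\<And>j. hi \<le> j \<Longrightarrow> b j = 1" and "lo \<le> hi"
  shows "(\<Sum>j\<in>{lo..hi}. b j - b (j - 1)) = 1"
proof -
  have tel: "(\<Sum>j\<in>{lo..lo + int n}. b j - b (j - 1)) = b (lo + int n) - b (lo - 1)" for n
  proof (induction n)
    case (Suc n)
    have "{lo..lo + int (Suc n)} = insert (lo + int (Suc n)) {lo..lo + int n}" by auto
    then show ?case using Suc by (simp add: algebra_simps)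
  qed simp
  show ?thesis using tel[of "nat (hi - lo)"] assms by simp
qed

context
  fixes U c p \<xi> \<zeta> H \<mu> Y
  assumes vU: "v \<in> U" and pU: "p \<in> U" and cU: "c \<notin> U" and leaf: "\<forall>u\<in>U. E c u \<longleftrightarrow> u = p"
    and adm: "admissible \<xi> \<zeta> (insert c U) H \<mu>"
    and Yc: "allows_above \<xi> Y c"
begin

text \<open>
  Strictness of \<open>j > \<xi>\<^sub>c + t\<omega>\<^sub>c\<close> leaves room to increase \<open>t\<close>, so that the arguments \<open>-y\<close> and \<open>-y - 1\<close>
  both lie in the affine range, where the first difference is \<open>1\<close>.
\<close>

lemma transfer_high:
  assumes "0 \<le> t" "of_int y \<le> \<xi> p + t * \<omega> p" "\<xi> c + t * \<omega> c < of_int j"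
  shows "transfer Y H c y j = 1"
proof -
  define t' where "t' = (of_int j - \<xi> c) / \<omega> c"
  have t': "t < t'" "\<xi> c + t' * \<omega> c \<le> of_int j"
    using assms \<omega>_pos[of c] by (auto simp: t'_def field_simps)
  have t0: "0 \<le> t'" using t' assms by simp
  have "t * \<omega> p < t' * \<omega> p" using t' \<omega>_pos by simp
  then have y: "of_int y < \<xi> p + t' * \<omega> p" using assms by simp
  have H: "H c j m = of_int m + \<mu> c j" if "- of_int m - 1 < \<xi> p + t' * \<omega> p" for m
    by (rule admissibleD(2)[OF adm _ t0 t'(2)])
       (use that in \<open>simp_all add: nbrs_leaf[OF vU pU cU leaf]\<close>)
  have "j \<in> Y c" using Yc assms \<omega>_pos[of c] unfolding allows_above_def
    by (smt (verit) mult_nonneg_nonneg)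
  moreover have "H c j (- y) = of_int (- y) + \<mu> c j" by (rule H) (use y in simp)
  moreover have "H c j (- y - 1) = of_int (- y - 1) + \<mu> c j" by (rule H) (use y in simp)
  ultimately show ?thesis by (simp add: transfer_def bdiff_def)
qed

lemma transfer_low:
  assumes "0 \<le> t" "\<zeta> p - t * \<omega> p \<le> of_int y" "of_int j < \<zeta> c - t * \<omega> c"
  shows "transfer Y H c y j = 0"
proof -
  define t' where "t' = (\<zeta> c - of_int j) / \<omega> c"
  have t': "t < t'" "of_int j \<le> \<zeta> c - t' * \<omega> c"
    using assms \<omega>_pos[of c] by (auto simp: t'_def field_simps)
  have t0: "0 \<le> t'" using t' assms by simp
  have "t * \<omega> p < t' * \<omega> p" using t' \<omega>_pos by simp
  then have y: "\<zeta> p - t' * \<omega> p < of_int y" using assms by simp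
  have H: "H c j m = 0" if "of_int m + (\<zeta> p - t' * \<omega> p) < 0" for m
    by (rule admissibleD(3)[OF adm _ t0 t'(2)])
       (use that in \<open>simp_all add: nbrs_leaf[OF vU pU cU leaf]\<close>)
  have "H c j (- y) = 0" "H c j (- y - 1) = 0" using y by (auto intro!: H)
  then show ?thesis by (simp add: transfer_def bdiff_def)
qed

lemma transfer_bounds:
  obtains lo hi where "lo \<le> hi" "\<And>j. j < lo \<Longrightarrow> transfer Y H c y j = 0"
    "\<And>j. hi \<le> j \<Longrightarrow> transfer Y H c y j = 1"
proof -
  obtain t where t: "t \<ge> 0" "of_int y \<le> \<xi> p + t * \<omega> p" using exists_shift by blast
  obtain s where s: "s \<ge> 0" "\<zeta> p - s * \<omega> p \<le> of_int y" using exists_shift by blast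
  define lo where "lo = \<lfloor>\<zeta> c - s * \<omega> c\<rfloor>"
  define hi where "hi = max lo (\<lfloor>\<xi> c + t * \<omega> c\<rfloor> + 1)"
  show ?thesis
  proof (rule that[of lo hi])
    show "lo \<le> hi" by (simp add: hi_def)
    show "transfer Y H c y j = 0" if "j < lo" for j
      by (rule transfer_low[OF s]) (use that in \<open>simp add: lo_def less_floor_iff\<close>)
    show "transfer Y H c y j = 1" if "hi \<le> j" for j
      by (rule transfer_high[OF t]) (use that in \<open>auto simp: hi_def floor_less_iff simp flip: floor_less_iff add1_zle_eq\<close>)
  qed
qed

lemma kernel_bounds:
  obtains lo hi where "lo \<le> hi"
    "\<And>j. j \<notin> {lo..hi} \<Longrightarrow> kernel Y H c y j = 0"
    "(\<Sum>j\<in>{lo..hi}. kernel Y H c y j) = 1"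
proof -
  obtain lo hi where *: "lo \<le> hi" "\<And>j. j < lo \<Longrightarrow> transfer Y H c y j = 0"
    "\<And>j. hi \<le> j \<Longrightarrow> transfer Y H c y j = 1" using transfer_bounds by blast
  show ?thesis
  proof (rule that[of lo hi])
    show "kernel Y H c y j = 0" if "j \<notin> {lo..hi}" for j
      using that *(2)[of j] *(2)[of "j - 1"] *(3)[of j] *(3)[of "j - 1"] by force
  qed (use * sum_first_differences in auto)
qed

lemma finite_convolution: "finite {j. transfer Y H c y j * H p y (m - j) \<noteq> 0}"
proof -
  obtain lo where lo: "\<And>j. j < lo \<Longrightarrow> transfer Y H c y j = 0" using transfer_bounds by metis
  obtain M where M: "\<And>m. m < M \<Longrightarrow> H p y m = 0"
    using admissibleD(1)[OF adm, of p y] pU by (auto simp: ramp_def)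
  have "{j. transfer Y H c y j * H p y (m - j) \<noteq> 0} \<subseteq> {lo..m - M}"
    using lo M by force
  then show ?thesis by (rule finite_subset) simp
qed

lemma finite_convolution_opposite:
  assumes "Y c = UNIV"
  shows "finite {j. transfer Y (opposite H \<mu>) c y j * opposite H \<mu> p y (m - j) \<noteq> 0}"
    and "transfer Y (opposite H \<mu>) c y j = transfer Y H c y j - 1"
proof -
  show *: "transfer Y (opposite H \<mu>) c y j = transfer Y H c y j - 1" for j
    using assms by (simp add: transfer_def opposite_def bdiff_def)
  obtain hi where hi: "\<And>j. hi \<le> j \<Longrightarrow> transfer Y H c y j = 1" using transfer_bounds by metis
  obtain M where M: "\<And>m. M \<le> m \<Longrightarrow> H p y m = of_int m + \<mu> p y"
    using admissibleD(1)[OF adm, of p y] pU by (auto simp: ramp_def)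
  have "{j. transfer Y (opposite H \<mu>) c y j * opposite H \<mu> p y (m - j) \<noteq> 0} \<subseteq> {m - M..hi}"
  proof
    fix j assume "j \<in> {j. transfer Y (opposite H \<mu>) c y j * opposite H \<mu> p y (m - j) \<noteq> 0}"
    then have "transfer Y H c y j \<noteq> 1" "H p y (m - j) \<noteq> of_int (m - j) + \<mu> p y"
      by (auto simp: * opposite_def)
    then have "\<not> hi \<le> j" "\<not> M \<le> m - j" using hi M by blast+
    then show "j \<in> {m - M..hi}" by simp
  qed
  then show "finite {j. transfer Y (opposite H \<mu>) c y j * opposite H \<mu> p y (m - j) \<noteq> 0}"
    by (rule finite_subset) simp
qed

text \<open>
  The first moment of the kernel; convolution subtracts it from the constant term of the affine part.
\<close>

definition mean_shift :: "int \<Rightarrow> real" where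
  "mean_shift y = (\<Sum>\<^sub>\<infinity>j. kernel Y H c y j * of_int j)"

abbreviation "\<mu>' \<equiv> \<mu>(p := \<lambda>y. \<mu> p y - mean_shift y)"

lemma finite_sum_kernel:
  assumes "\<And>j. j \<notin> {lo..hi} \<Longrightarrow> kernel Y H c y j = 0"
  shows "(\<Sum>\<^sub>\<infinity>j. kernel Y H c y j * f j)
       = (\<Sum>j\<in>{lo..hi}. kernel Y H c y j * f j)"
proof -
  have "(\<Sum>\<^sub>\<infinity>j. kernel Y H c y j * f j)
     = (\<Sum>\<^sub>\<infinity>j\<in>{lo..hi}. kernel Y H c y j * f j)"
    by (rule infsum_cong_neutral) (use assms in auto)
  then show ?thesis by simp
qed

lemma absorb_affine:
  assumes "\<And>j. transfer Y H c y j \<noteq> transfer Y H c y (j - 1) \<Longrightarrow>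
    H p y (m - j) = of_int (m - j) + \<mu> p y"
  shows "absorb Y H c p p y m = of_int m + \<mu>' p y"
proof -
  let ?g = "kernel Y H c y"
  obtain lo hi where k: "\<And>j. j \<notin> {lo..hi} \<Longrightarrow> ?g j = 0" "(\<Sum>j\<in>{lo..hi}. ?g j) = 1"
    using kernel_bounds by blast
  have "absorb Y H c p p y m = (\<Sum>j\<in>{lo..hi}. ?g j * H p y (m - j))"
    unfolding absorb_def fun_upd_same by (rule finite_sum_kernel[OF k(1)])
  also have "\<dots> = (\<Sum>j\<in>{lo..hi}. ?g j * (of_int m + \<mu> p y) - ?g j * of_int j)"
  proof (rule sum.cong)
    fix j show "?g j * H p y (m - j) = ?g j * (of_int m + \<mu> p y) - ?g j * of_int j"
    proof (cases "?g j = 0")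
      case False
      then have e: "H p y (m - j) = of_int m + \<mu> p y - of_int j" using assms[of j] by simp
      show ?thesis unfolding e by (simp add: algebra_simps)
    qed simp
  qed simp
  also have "\<dots> = (\<Sum>j\<in>{lo..hi}. ?g j) * (of_int m + \<mu> p y) - (\<Sum>j\<in>{lo..hi}. ?g j * of_int j)"
    by (subst sum_subtractf) (simp only: sum_distrib_right)
  also have "(\<Sum>j\<in>{lo..hi}. ?g j * of_int j) = mean_shift y"
    unfolding mean_shift_def by (rule finite_sum_kernel[OF k(1), symmetric])
  finally show ?thesis using k by simp
qed

text \<open>
  Both expansions undergo the same elimination: the two transfer functions differ by the constant
  \<open>1\<close>, so their first differences agree.
\<close>

lemma absorb_opposite:
  assumes "Y c = UNIV"
  shows "absorb Y (opposite H \<mu>) c p = opposite (absorb Y H c p) \<mu>'"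
proof (intro ext)
  fix w y m
  show "absorb Y (opposite H \<mu>) c p w y m = opposite (absorb Y H c p) \<mu>' w y m"
  proof (cases "w = p")
    case True
    let ?g = "kernel Y H c y"
    obtain lo hi where k: "\<And>j. j \<notin> {lo..hi} \<Longrightarrow> ?g j = 0" "(\<Sum>j\<in>{lo..hi}. ?g j) = 1"
      using kernel_bounds by blast
    have "absorb Y (opposite H \<mu>) c p p y m = (\<Sum>\<^sub>\<infinity>j. ?g j * opposite H \<mu> p y (m - j))"
      by (simp add: absorb_def finite_convolution_opposite(2)[OF assms])
    also have "\<dots> = (\<Sum>j\<in>{lo..hi}. ?g j * opposite H \<mu> p y (m - j))"
      by (rule finite_sum_kernel[OF k(1)])
    also have "\<dots> = (\<Sum>j\<in>{lo..hi}. ?g j * H p y (m - j)) - (\<Sum>j\<in>{lo..hi}. ?g j) * (of_int m + \<mu> p y)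
        + (\<Sum>j\<in>{lo..hi}. ?g j * of_int j)"
      by (simp add: opposite_def algebra_simps sum.distrib sum_subtractf sum_distrib_left sum_distrib_right)
    also have "(\<Sum>j\<in>{lo..hi}. ?g j * of_int j) = mean_shift y"
      unfolding mean_shift_def by (rule finite_sum_kernel[OF k(1), symmetric])
    also have "(\<Sum>j\<in>{lo..hi}. ?g j * H p y (m - j)) = absorb Y H c p p y m"
      unfolding absorb_def fun_upd_same by (rule finite_sum_kernel[OF k(1), symmetric])
    also have "absorb Y H c p p y m - (\<Sum>j\<in>{lo..hi}. ?g j) * (of_int m + \<mu> p y) + mean_shift y
        = opposite (absorb Y H c p) \<mu>' p y m"
      by (simp add: opposite_def k(2))
    finally show ?thesis using True by simp
  qed (simp add: absorb_def opposite_def)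
qed

text \<open>
  The kernel has mass one.  Its support ends at \<open>\<xi>\<^sub>c + t\<omega>\<^sub>c + 1\<close> if \<open>p\<close> has value at most \<open>\<xi>\<^sub>p + t\<omega>\<^sub>p\<close>, and
  begins at \<open>\<zeta>\<^sub>c - t\<omega>\<^sub>c\<close> if that value is at least \<open>\<zeta>\<^sub>p - t\<omega>\<^sub>p\<close>.  Convolution adds supports, and these are
  the terms that \<open>c\<close> contributed to the bounds at \<open>p\<close>; the summand \<open>1\<close> accounts for the drop of the
  valence.
\<close>

lemma admissible_absorb: "admissible \<xi> \<zeta> U (absorb Y H c p) \<mu>'"
proof -
  have other: "absorb Y H c p w = H w" "\<mu>' w = \<mu> w" if "w \<noteq> p" for w
    using that by (auto simp: absorb_def)
  have other_nbrs: "nbrs E (insert c U) w = nbrs E U w" if "w \<in> U" "w \<noteq> p" for w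
    using nbrs_other[OF vU pU cU leaf that] .
  note parent = nbrs_parent[OF vU pU cU leaf] leaf_notin_nbrs[OF vU pU cU leaf]
  have fin: "finite (nbrs E U p)" by simp
  have "ramp (absorb Y H c p w y) (\<mu>' w y)" if w: "w \<in> U" for w y
  proof (cases "w = p")
    case True
    let ?g = "kernel Y H c y"
    obtain lo hi where k: "\<And>j. j \<notin> {lo..hi} \<Longrightarrow> ?g j = 0" using kernel_bounds by metis
    obtain M N where M: "\<And>m. m < M \<Longrightarrow> H p y m = 0" and N: "\<And>m. N \<le> m \<Longrightarrow> H p y m = of_int m + \<mu> p y"
      using admissibleD(1)[OF adm, of p y] pU by (auto simp: ramp_def)
    have "absorb Y H c p p y m = 0" if "m < M + lo" for m
    proof -
      have "absorb Y H c p p y m = (\<Sum>j\<in>{lo..hi}. ?g j * H p y (m - j))"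
        unfolding absorb_def fun_upd_same by (rule finite_sum_kernel[OF k])
      also have "\<dots> = 0" by (rule sum.neutral) (use M that in auto)
      finally show ?thesis .
    qed
    moreover have "absorb Y H c p p y m = of_int m + \<mu>' p y" if "N + hi \<le> m" for m
    proof (rule absorb_affine)
      fix j assume "transfer Y H c y j \<noteq> transfer Y H c y (j - 1)"
      then have "j \<le> hi" using k[of j] by force
      then show "H p y (m - j) = of_int (m - j) + \<mu> p y" using N that by simp
    qed
    ultimately show ?thesis using True unfolding ramp_def by blast
  next
    case False
    with w show ?thesis using admissibleD(1)[OF adm, of w y] other by simp
  qed
  moreover have "absorb Y H c p w y m = of_int m + \<mu>' w y"
    if w: "w \<in> U" and t: "0 \<le> t" "\<xi> w + t * \<omega> w \<le> of_int y" and
      m: "0 < of_int m + (\<Sum>u\<in>nbrs E U w. \<xi> u + t * \<omega> u) + card (nbrs E U w)" for w y m t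
  proof (cases "w = p")
    case True
    \<comment> \<open>the largest parameter for which the bound at \<open>p\<close> applies to the value \<open>y\<close>\<close>
    define t' where "t' = (of_int y - \<xi> p) / \<omega> p"
    have t': "t \<le> t'" "of_int y = \<xi> p + t' * \<omega> p"
      using t True \<omega>_pos[of p] by (auto simp: t'_def field_simps)
    have mono: "(\<Sum>u\<in>nbrs E U p. \<xi> u + t * \<omega> u) \<le> (\<Sum>u\<in>nbrs E U p. \<xi> u + t' * \<omega> u)"
      by (rule sum_mono) (use t' \<omega>_pos less_imp_le in \<open>auto intro!: mult_right_mono\<close>)
    have "absorb Y H c p p y m = of_int m + \<mu>' p y"
    proof (rule absorb_affine)
      fix j assume j: "transfer Y H c y j \<noteq> transfer Y H c y (j - 1)"
      have "of_int j \<le> \<xi> c + t' * \<omega> c + 1"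
      proof (rule ccontr)
        assume "\<not> of_int j \<le> \<xi> c + t' * \<omega> c + 1"
        then have "transfer Y H c y j = 1" "transfer Y H c y (j - 1) = 1"
          using t t' by (auto intro!: transfer_high[of t'])
        with j show False by simp
      qed
      then show "H p y (m - j) = of_int (m - j) + \<mu> p y"
        using t t' mono m True parent
        by (intro admissibleD(2)[OF adm, of p t']) (auto simp: pU)
    qed
    then show ?thesis using True by simp
  next
    case False
    with w show ?thesis using admissibleD(2)[OF adm, of w t y m] t m other other_nbrs by simp
  qed
  moreover have "absorb Y H c p w y m = 0"
    if w: "w \<in> U" and t: "0 \<le> t" "of_int y \<le> \<zeta> w - t * \<omega> w" and
      m: "of_int m + (\<Sum>u\<in>nbrs E U w. \<zeta> u - t * \<omega> u) < 0" for w y m t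
  proof (cases "w = p")
    case True
    define t' where "t' = (\<zeta> p - of_int y) / \<omega> p"
    have t': "t \<le> t'" "of_int y = \<zeta> p - t' * \<omega> p"
      using t True \<omega>_pos[of p] by (auto simp: t'_def field_simps)
    have mono: "(\<Sum>u\<in>nbrs E U p. \<zeta> u - t' * \<omega> u) \<le> (\<Sum>u\<in>nbrs E U p. \<zeta> u - t * \<omega> u)"
      by (rule sum_mono) (use t' \<omega>_pos less_imp_le in \<open>auto intro!: mult_right_mono\<close>)
    have "absorb Y H c p p y m = 0"
      unfolding absorb_def fun_upd_same
    proof (rule infsum_0)
      fix j
      show "kernel Y H c y j * H p y (m - j) = 0"
      proof (cases "of_int j < \<zeta> c - t' * \<omega> c")
        case True
        then have "transfer Y H c y j = 0" "transfer Y H c y (j - 1) = 0"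
          using t t' by (auto intro!: transfer_low[of t'])
        then show ?thesis by simp
      next
        case F: False
        have "H p y (m - j) = 0"
          using t t' mono m True parent F
          by (intro admissibleD(3)[OF adm, of p t']) (auto simp: pU)
        then show ?thesis by simp
      qed
    qed
    then show ?thesis using True by simp
  next
    case False
    with w show ?thesis using admissibleD(3)[OF adm, of w t y m] t m other other_nbrs by simp
  qed
  ultimately show ?thesis unfolding admissible_def by blast
qed

text \<open>
  For \<open>y \<le> \<xi>\<^sub>p\<close> the constraint \<open>j \<ge> 0\<close> is stronger than the effectivity condition at \<open>c\<close>, so the
  transfer function is the unit step at \<open>0\<close> and its difference is the unit mass at \<open>0\<close>.
\<close>

lemma absorb_pinned:
  assumes "Y c = {0..}" "\<xi> c < 0" "of_int y \<le> \<xi> p"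
  shows "absorb Y H c p p y = H p y"
proof
  fix m
  have tr: "transfer Y H c y j = (if 0 \<le> j then 1 else 0)" for j
  proof (cases "0 \<le> j")
    case True
    then show ?thesis using transfer_high[of 0 y j] assms by simp
  next
    case False
    then show ?thesis using assms by (simp add: transfer_def)
  qed
  have "absorb Y H c p p y m = (\<Sum>\<^sub>\<infinity>j\<in>{0}. kernel Y H c y j * H p y (m - j))"
    unfolding absorb_def fun_upd_same by (rule infsum_cong_neutral) (auto simp: tr)
  then show "absorb Y H c p p y m = H p y m" by (simp add: tr)
qed

end

end

section \<open>Comparison of state sums\<close>

lemma grows_mono: "grows E W U \<Longrightarrow> W \<subseteq> U"
  by (induction rule: grows.induct) blast+

context tree_sum
begin

lemma absorb_other: "w \<noteq> p \<Longrightarrow> absorb Y H c p w = H w"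
  by (simp add: absorb_def)

text \<open>
  All branches outside \<open>W\<close> are summed out.  The branches start at constrained vertices, so below
  \<open>\<xi>\<close> the weights on \<open>W\<close> stay unchanged.
\<close>

lemma eliminate_beyond:
  assumes "grows E W U" "v \<in> W" "admissible \<xi> \<zeta> U H \<mu>" "finite_states Y U s H"
    and "\<And>w. w \<in> U - W \<Longrightarrow> allows_above \<xi> Y w"
    and "\<And>c w. c \<in> U - W \<Longrightarrow> w \<in> W \<Longrightarrow> E c w \<Longrightarrow> Y c = {0..} \<and> \<xi> c < 0"
  shows "\<exists>H' \<mu>'. admissible \<xi> \<zeta> W H' \<mu>' \<and> finite_states Y W s H' \<and>
    state_sum Y U s H = state_sum Y W s H' \<and> (\<forall>w\<in>W. \<forall>y. of_int y \<le> \<xi> w \<longrightarrow> H' w y = H w y)"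
  using assms
proof (induction arbitrary: H \<mu> rule: grows.induct)
  case refl
  then show ?case by blast
next
  case (attach U p c)
  have WU: "W \<subseteq> U" using grows_mono[OF attach.hyps(1)] .
  then have vU: "v \<in> U" using \<open>v \<in> W\<close> by auto
  note step = vU \<open>p \<in> U\<close> \<open>c \<notin> U\<close> attach.hyps(4)
  have cW: "c \<notin> W" using WU step by auto
  have Yc: "allows_above \<xi> Y c" using attach.prems(4)[of c] cW by auto
  note adm = \<open>admissible \<xi> \<zeta> (insert c U) H \<mu>\<close>
  note el = eliminate_leaf[OF step finite_convolution[OF step adm Yc] \<open>finite_states Y (insert c U) s H\<close>]
  from attach.IH[OF \<open>v \<in> W\<close> admissible_absorb[OF step adm Yc] el(2)] attach.prems(4,5) cW
  obtain H' \<mu>' where H': "admissible \<xi> \<zeta> W H' \<mu>'" "finite_states Y W s H'"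
    "state_sum Y U s (absorb Y H c p) = state_sum Y W s H'"
    "\<And>w y. w \<in> W \<Longrightarrow> of_int y \<le> \<xi> w \<Longrightarrow> H' w y = absorb Y H c p w y"
    by (metis Diff_iff insertCI)
  have "absorb Y H c p w y = H w y" if "w \<in> W" "of_int y \<le> \<xi> w" for w y
  proof (cases "w = p")
    case True
    have "E c p" using attach.hyps(4) \<open>p \<in> U\<close> by simp
    then have "Y c = {0..} \<and> \<xi> c < 0" using attach.prems(5)[of c p] True that cW by auto
    then show ?thesis using absorb_pinned[OF step adm Yc] that True by auto
  qed (simp add: absorb_other)
  with H' el(1) show ?case by metis
qed

lemma weight_root: "weight {v} s H l = H v (l v) s"
proof -
  have "nbrs E {v} v = {}" using E_irrefl by (auto simp: nbrs_def)
  then show ?thesis by (simp add: weight_def local_weight_def)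
qed

text \<open>
  If the neighbour of a leaf has value at most \<open>\<xi>\<close>, then values of the leaf above \<open>\<xi>\<close> have transfer
  function \<open>1\<close>, whatever the weight of the leaf is there.  The root has values at most \<open>\<xi>\<close>, so by
  induction only the weights at such values enter.
\<close>

lemma state_sum_determined_below:
  assumes "grows E {v} U" "admissible \<xi> \<zeta> U H1 \<mu>1" "admissible \<xi> \<zeta> U H2 \<mu>2"
    and "finite_states Y U s H1" "finite_states Y U s H2"
    and "\<And>w y. w \<in> U \<Longrightarrow> of_int y \<le> \<xi> w \<Longrightarrow> H1 w y = H2 w y"
    and "\<And>w. w \<in> U - {v} \<Longrightarrow> Y w = UNIV" and "\<And>y. y \<in> Y v \<Longrightarrow> of_int y \<le> \<xi> v"
  shows "state_sum Y U s H1 = state_sum Y U s H2"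
  using assms
proof (induction arbitrary: H1 H2 \<mu>1 \<mu>2 rule: grows.induct)
  case refl
  then show ?case unfolding state_sum_def
    by (intro infsum_cong) (auto simp: weight_root configs_def)
next
  case (attach U p c)
  have vU: "v \<in> U" using grows_mono[OF attach.hyps(1)] by auto
  note step = vU \<open>p \<in> U\<close> \<open>c \<notin> U\<close> attach.hyps(4)
  have Yc: "Y c = UNIV" using attach.prems(6)[of c] step by auto
  have Yc': "allows_above \<xi> Y c" using Yc by (simp add: allows_above_def)
  note adm = attach.prems(1,2) and fin = attach.prems(3,4)
  note el1 = eliminate_leaf[OF step finite_convolution[OF step adm(1) Yc'] fin(1)]
  note el2 = eliminate_leaf[OF step finite_convolution[OF step adm(2) Yc'] fin(2)]
  have tr: "transfer Y H1 c y j = transfer Y H2 c y j" if "of_int y \<le> \<xi> p" for y j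
  proof (cases "of_int j \<le> \<xi> c")
    case True
    then show ?thesis using attach.prems(5)[of c j] by (simp add: transfer_def)
  next
    case False
    then show ?thesis
      using transfer_high[OF step adm(1) Yc', of 0 y j] transfer_high[OF step adm(2) Yc', of 0 y j] that by simp
  qed
  have "absorb Y H1 c p w y = absorb Y H2 c p w y" if "w \<in> U" "of_int y \<le> \<xi> w" for w y
    using that attach.prems(5)[of w y] by (cases "w = p") (auto simp: absorb_def tr)
  then have "state_sum Y U s (absorb Y H1 c p) = state_sum Y U s (absorb Y H2 c p)"
    using attach.prems(6,7) step
    by (intro attach.IH[OF admissible_absorb[OF step adm(1) Yc'] admissible_absorb[OF step adm(2) Yc'] el1(2) el2(2)]) auto
  then show ?case using el1 el2 by simp
qed

text \<open>
  After eliminating everything but \<open>v\<close> the two state sums are two expansions of one rational function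
  with a double pole at \<open>1\<close>.  Their difference is affine in the exponent, with slope one.
\<close>

lemma expansion_difference:
  assumes "grows E {v} U" "admissible \<xi> \<zeta> U H \<mu>"
    and "\<And>s. finite_states Y U s H" "\<And>s. finite_states Y U s (opposite H \<mu>)"
    and "\<And>w. w \<in> U - {v} \<Longrightarrow> Y w = UNIV" and "Y v = {y0}"
  shows "\<exists>k. \<forall>s. state_sum Y U s H - state_sum Y U s (opposite H \<mu>) = of_int s + k"
  using assms
proof (induction arbitrary: H \<mu> rule: grows.induct)
  case refl
  have "configs Y {v} = {(\<lambda>w. 0)(v := y0)}"
    using refl.prems by (auto simp: configs_def)
  then show ?case by (auto simp: state_sum_def weight_root opposite_def)
next
  case (attach U p c)
  have vU: "v \<in> U" using grows_mono[OF attach.hyps(1)] by auto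
  note step = vU \<open>p \<in> U\<close> \<open>c \<notin> U\<close> attach.hyps(4)
  have Yc: "Y c = UNIV" using attach.prems(4)[of c] step by auto
  have Yc': "allows_above \<xi> Y c" using Yc by (simp add: allows_above_def)
  note adm = attach.prems(1) and fin = attach.prems(2,3)
  note el1 = eliminate_leaf[OF step finite_convolution[OF step adm Yc'] fin(1)]
  note el2 = eliminate_leaf[OF step finite_convolution_opposite(1)[OF step adm Yc' Yc] fin(2)]
  note el2' = el2[unfolded absorb_opposite[OF step adm Yc' Yc]]
  have "\<exists>k. \<forall>s. state_sum Y U s (absorb Y H c p) - state_sum Y U s (opposite (absorb Y H c p)
      (\<mu>(p := \<lambda>y. \<mu> p y - mean_shift c H Y y))) = of_int s + k"
    by (rule attach.IH[OF admissible_absorb[OF step adm Yc'] el1(2) el2'(2)])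
      (use attach.prems(4,5) in auto)
  then show ?case using el1(1) el2'(1) by simp
qed

end

section \<open>The intersection form of a plumbing tree\<close>

locale plumbing =
  fixes G :: "'v::finite resolution_graph"
  assumes QHS: "QHS_resolution_graph G"
begin

abbreviation "E \<equiv> adj G"

lemma E_sym: "E a b \<Longrightarrow> E b a"
  using QHS by (auto simp: QHS_resolution_graph_def is_tree_def dest: sympD)

lemma E_irrefl: "\<not> E a a"
  using QHS by (auto simp: QHS_resolution_graph_def is_tree_def dest: irreflpD)

lemma E_connected: "E\<^sup>*\<^sup>* a b"
  using QHS by (auto simp: QHS_resolution_graph_def is_tree_def)

lemma no_cycle: "\<not> is_cycle E c"
  using QHS by (auto simp: QHS_resolution_graph_def is_tree_def)

lemma negative_definite: "x \<noteq> 0 \<Longrightarrow> int_form G x x < 0"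
  using QHS by (auto simp: QHS_resolution_graph_def)

lemma grows_path:
  assumes "grows E {v} U" "p \<in> U" "q \<in> U"
  shows "\<exists>l. l \<noteq> [] \<and> distinct l \<and> successively E l \<and> set l \<subseteq> U \<and> hd l = p \<and> last l = q"
  using assms
proof (induction arbitrary: p q rule: grows.induct)
  case refl
  then show ?case by (intro exI[of _ "[v]"]) auto
next
  case (attach U r c)
  have cr: "E c r" "E r c" using attach.hyps E_sym by auto
  consider "p = c" "q = c" | "p = c" "q \<in> U" | "p \<in> U" "q = c" | "p \<in> U" "q \<in> U"
    using attach.prems by auto
  then show ?case
  proof cases
    case 1
    then show ?thesis by (intro exI[of _ "[c]"]) auto
  next
    case 2
    from attach.IH[OF attach.hyps(2) 2(2)] obtain l where
      l: "l \<noteq> []" "distinct l" "successively E l" "set l \<subseteq> U" "hd l = r" "last l = q" by blast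
    show ?thesis using l 2 cr attach.hyps(3)
      by (intro exI[of _ "c # l"]) (auto simp: successively_Cons)
  next
    case 3
    from attach.IH[OF 3(1) attach.hyps(2)] obtain l where
      l: "l \<noteq> []" "distinct l" "successively E l" "set l \<subseteq> U" "hd l = p" "last l = r" by blast
    show ?thesis using l 3 cr attach.hyps(3)
      by (intro exI[of _ "l @ [c]"]) (auto simp: successively_append_iff)
  next
    case 4
    from attach.IH[OF this] show ?thesis by blast
  qed
qed

text \<open>
  Two neighbours in \<open>U\<close> would close a cycle with a path joining them inside \<open>U\<close>.
\<close>

lemma unique_attachment:
  assumes "grows E {v} U" "c \<notin> U" "p \<in> U" "q \<in> U" "E c p" "E c q"
  shows "p = q"
proof (rule ccontr)
  assume pq: "p \<noteq> q"
  obtain l where l: "l \<noteq> []" "distinct l" "successively E l" "set l \<subseteq> U" "hd l = p" "last l = q"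
    using grows_path assms by meson
  have "length l \<ge> 2" using l pq by (cases l; cases "tl l") auto
  then have "is_cycle E (c # l)"
    unfolding is_cycle_def using l assms E_sym by (auto simp: successively_Cons)
  with no_cycle show False by blast
qed

lemma grows_insert:
  assumes "grows E {v} U" "grows E W U" "p \<in> U" "c \<notin> U" "E p c"
  shows "grows E W (insert c U)"
  using assms(2-4)
proof (rule grows.attach)
  show "\<forall>u\<in>U. E c u = (u = p)"
    using assms E_sym unique_attachment by blast
qed

lemma grows_trans:
  assumes "grows E W U" "grows E V W" shows "grows E V U"
  using assms(1)
proof (induction rule: grows.induct)
  case refl
  then show ?case using assms by simp
next
  case (attach U p c)
  then show ?case using grows.attach by metis
qed

text \<open>
  A maximal extension avoiding \<open>J\<close> is bordered by \<open>J\<close>; for \<open>W = {v}\<close> it is the component of \<open>v\<close> in the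
  complement of \<open>J\<close>.
\<close>

lemma grows_closed:
  assumes "grows E {v} W" "W \<inter> J = {}"
  obtains U where "grows E W U" "U \<inter> J = {}" "\<And>w c. w \<in> U \<Longrightarrow> E w c \<Longrightarrow> c \<in> U \<union> J"
proof -
  let ?P = "\<lambda>U. grows E W U \<and> U \<inter> J = {}"
  have P: "?P W" using assms by (auto intro: grows.refl)
  have bound: "\<forall>U. ?P U \<longrightarrow> card U < Suc (card (UNIV :: 'v set))"
    by (simp add: card_mono less_Suc_eq_le)
  from ex_has_greatest_nat[of ?P, OF P bound]
  obtain U where U: "?P U" "\<And>U'. ?P U' \<Longrightarrow> card U' \<le> card U" by (elim exE conjE) simp
  show ?thesis
  proof (rule that[of U])
    fix w c assume w: "w \<in> U" "E w c"
    show "c \<in> U \<union> J"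
    proof (rule ccontr)
      assume c: "c \<notin> U \<union> J"
      have "grows E {v} U" using U(1) assms(1) grows_trans by blast
      then have "grows E W (insert c U)" using grows_insert[of v U W w c] U(1) w c by simp
      then have "?P (insert c U)" using U(1) c by simp
      from U(2)[OF this] c show False by simp
    qed
  qed (use U in auto)
qed

lemma grows_UNIV:
  assumes "grows E {v} W" shows "grows E W UNIV"
proof -
  obtain U where U: "grows E W U" "\<And>w c. w \<in> U \<Longrightarrow> E w c \<Longrightarrow> c \<in> U"
    using grows_closed[OF assms, of "{}"] by auto
  have v: "v \<in> U" using grows_mono[OF assms] grows_mono[OF U(1)] by auto
  have "a \<in> U" for a
    using E_connected[of v a] by (induction rule: rtranclp_induct) (use v U(2) in auto)
  then have "U = UNIV" by auto
  with U show ?thesis by simp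
qed

text \<open>
  For a cycle \<open>f\<close> with support in \<open>U\<close> this is \<open>-(f, E\<^sub>w)\<close>.  It is polymorphic since lattice points are handled as
  integer-valued functions and the comparison vectors as real-valued ones.
\<close>

definition codeg :: "'v set \<Rightarrow> ('v \<Rightarrow> 'a::comm_ring_1) \<Rightarrow> 'v \<Rightarrow> 'a" where
  "codeg U f w = - of_int (self_int G w) * f w - (\<Sum>u\<in>nbrs E U w. f u)"

lemma codeg_of_int: "of_int (codeg U f w) = codeg U (\<lambda>u. of_int (f u)) w"
  by (simp add: codeg_def)

lemma codeg_add: "codeg U (\<lambda>u. f u + g u) w = codeg U f w + codeg U g w"
  by (simp add: codeg_def sum.distrib algebra_simps)

lemma codeg_diff: "codeg U (\<lambda>u. f u - g u) w = codeg U f w - codeg U g w"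
  by (simp add: codeg_def sum_subtractf algebra_simps)

lemma codeg_scale: "codeg U (\<lambda>u. a * f u) w = a * codeg U f w"
  by (simp add: codeg_def sum_distrib_left algebra_simps)

lemma codeg_minus: "codeg U (\<lambda>u. - f u) w = - codeg U f w"
  using codeg_scale[of U "-1" f w] by simp

lemma codeg_const: "codeg U (\<lambda>u. a) w = a * (- of_int (self_int G w) - of_nat (card (nbrs E U w)))"
  by (simp add: codeg_def algebra_simps)

lemma val_eq: "val G w = card (nbrs E UNIV w)"
  by (simp add: val_def nbrs_def)

lemma int_form_axis: "int_form G x (E_curve w) = - codeg UNIV (\<lambda>u. x $ u) w"
proof -
  have "int_form G x (E_curve w) = (\<Sum>u\<in>UNIV. of_int (int_number G u w) * x $ u)"
    unfolding int_form_def by (rule sum.cong) (auto simp: axis_def if_distrib cong: if_cong)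
  also have "\<dots> = (\<Sum>u\<in>UNIV. (if u = w then of_int (self_int G w) * x $ w else 0) + (if E w u then x $ u else 0))"
    by (rule sum.cong) (auto simp: int_number_def E_irrefl dest: E_sym)
  also have "\<dots> = of_int (self_int G w) * x $ w + (\<Sum>u\<in>nbrs E UNIV w. x $ u)"
    by (simp add: sum.distrib sum.If_cases nbrs_def)
  finally show ?thesis by (simp add: codeg_def)
qed

lemma int_form_sum: "int_form G x y = - (\<Sum>w\<in>UNIV. y $ w * codeg UNIV (\<lambda>u. x $ u) w)"
proof -
  have "int_form G x y = (\<Sum>w\<in>UNIV. y $ w * (\<Sum>u\<in>UNIV. of_int (int_number G u w) * x $ u))"
    unfolding int_form_def by (subst sum.swap) (simp add: sum_distrib_left algebra_simps)
  also have "\<dots> = (\<Sum>w\<in>UNIV. y $ w * int_form G x (E_curve w))"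
    unfolding int_form_def
    by (intro sum.cong arg_cong2[of _ _ _ _ "(*)"] refl) (auto simp: axis_def if_distrib cong: if_cong)
  finally show ?thesis by (simp add: int_form_axis sum_negf)
qed

lemma codeg_supported:
  assumes "\<And>u. u \<notin> U \<Longrightarrow> f u = 0"
  shows "codeg UNIV f w = codeg U f w"
proof -
  have "(\<Sum>u\<in>nbrs E UNIV w. f u) = (\<Sum>u\<in>nbrs E U w. f u)"
    by (rule sum.mono_neutral_right) (use assms in \<open>auto simp: nbrs_def\<close>)
  then show ?thesis by (simp add: codeg_def)
qed

lemma codeg_eq_0_imp:
  fixes f :: "'v \<Rightarrow> real"
  assumes "\<And>u. u \<notin> U \<Longrightarrow> f u = 0" "\<And>w. w \<in> U \<Longrightarrow> codeg U f w = 0"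
  shows "f w = 0"
proof (rule ccontr)
  assume "f w \<noteq> 0"
  then have "(\<chi> w. f w) \<noteq> 0" by (auto simp: vec_eq_iff)
  from negative_definite[OF this] have "(\<Sum>w\<in>UNIV. f w * codeg UNIV f w) > 0"
    by (simp add: int_form_sum)
  moreover have "(\<Sum>w\<in>UNIV. f w * codeg UNIV f w) = 0"
  proof (rule sum.neutral, rule ballI)
    fix w show "f w * codeg UNIV f w = 0"
      using assms codeg_supported[OF assms(1)] by (cases "w \<in> U") auto
  qed
  ultimately show False by simp
qed

text \<open>
  The intersection matrix of the subgraph on \<open>U\<close>, completed by the identity so that determinants of all subgraphs are
  determinants of matrices over the one index type.
\<close>

definition codeg_matrix :: "'v set \<Rightarrow> real ^ 'v ^ 'v" where
  "codeg_matrix U = (\<chi> w u. if w \<in> U then (if u \<in> U then - of_int (int_number G w u) else 0)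
                              else if w = u then 1 else 0)"

lemma codeg_matrix_mult:
  "(codeg_matrix U *v x) $ w = (if w \<in> U then codeg U (\<lambda>u. if u \<in> U then x $ u else 0) w else x $ w)"
proof (cases "w \<in> U")
  case True
  have "(codeg_matrix U *v x) $ w = (\<Sum>u\<in>UNIV. - (if u = w then of_int (self_int G w) * x $ w else 0) -
      (if u \<in> U \<and> E w u then x $ u else 0))"
    unfolding codeg_matrix_def matrix_vector_mult_def using True
    by (simp, intro sum.cong) (auto simp: int_number_def E_irrefl)
  also have "\<dots> = - of_int (self_int G w) * x $ w - (\<Sum>u\<in>nbrs E U w. x $ u)"
    by (simp add: sum_subtractf sum_negf sum.If_cases nbrs_def Collect_conj_eq)
  also have "(\<Sum>u\<in>nbrs E U w. x $ u) = (\<Sum>u\<in>nbrs E U w. if u \<in> U then x $ u else 0)"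
    by (rule sum.cong) (auto simp: nbrs_def)
  also have "- of_int (self_int G w) * x $ w - \<dots> = codeg U (\<lambda>u. if u \<in> U then x $ u else 0) w"
    using True by (simp add: codeg_def)
  finally show ?thesis using True by simp
next
  case False
  have "(codeg_matrix U *v x) $ w = (\<Sum>u\<in>UNIV. codeg_matrix U $ w $ u * x $ u)"
    by (simp add: matrix_vector_mult_def)
  also have "\<dots> = (\<Sum>u\<in>UNIV. if u = w then x $ w else 0)"
    by (rule sum.cong) (use False in \<open>auto simp: codeg_matrix_def\<close>)
  finally have "(codeg_matrix U *v x) $ w = (\<Sum>u\<in>UNIV. if u = w then x $ w else 0)" .
  then show ?thesis using False by simp
qed

lemma det_codeg_matrix: "det (codeg_matrix U) \<noteq> 0"
proof -
  have "inj ((*v) (codeg_matrix U))"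
  proof (rule linear_injective_0[THEN iffD2])
    show "linear ((*v) (codeg_matrix U))" by simp
    show "\<forall>x. codeg_matrix U *v x = 0 \<longrightarrow> x = 0"
    proof (intro allI impI)
      fix x assume x: "codeg_matrix U *v x = 0"
      have out: "x $ w = 0" if "w \<notin> U" for w
        using arg_cong[OF x, of "\<lambda>y. y $ w"] that by (simp add: codeg_matrix_mult)
      then have eq: "(\<lambda>u. if u \<in> U then x $ u else 0) = (\<lambda>u. x $ u)" by auto
      have "codeg U (\<lambda>u. x $ u) w = 0" if "w \<in> U" for w
      proof -
        have "codeg U (\<lambda>u. if u \<in> U then x $ u else 0) w = (codeg_matrix U *v x) $ w"
          using that by (simp only: codeg_matrix_mult if_True)
        then show ?thesis by (simp only: eq x zero_index)
      qed
      then have "x $ w = 0" for w using codeg_eq_0_imp[of U "\<lambda>u. x $ u", OF out] by blast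
      then show "x = 0" by (simp add: vec_eq_iff)
    qed
  qed
  then show ?thesis
    by (metis invertible_det_nz invertible_left_inverse matrix_left_invertible_injective)
qed

lemma det_in_Ints: "(\<And>i j. A $ i $ j \<in> \<int>) \<Longrightarrow> det (A :: real ^ 'v ^ 'v) \<in> \<int>"
  unfolding det_def by (intro Ints_sum Ints_mult Ints_prod) auto

lemma codeg_matrix_Ints: "codeg_matrix U $ i $ j \<in> \<int>"
  by (simp add: codeg_matrix_def)

text \<open>
  Cramer's rule, which also shows that the determinant is a common denominator for integral right-hand
  sides.
\<close>

lemma codeg_solution:
  fixes b :: "'v \<Rightarrow> real"
  obtains x where "\<And>w. w \<in> U \<Longrightarrow> codeg U x w = b w" "\<And>w. w \<notin> U \<Longrightarrow> x w = 0"
    "(\<And>w. w \<in> U \<Longrightarrow> b w \<in> \<int>) \<Longrightarrow> (\<And>w. det (codeg_matrix U) * x w \<in> \<int>)"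
proof -
  define b' where "b' = (\<chi> w. if w \<in> U then b w else 0)"
  define x where "x = (\<chi> k. det (\<chi> i j. if j = k then b' $ i else codeg_matrix U $ i $ j) / det (codeg_matrix U))"
  have sol: "codeg_matrix U *v x = b'"
    using cramer[OF det_codeg_matrix, of U x b'] by (simp add: x_def)
  have out: "x $ w = 0" if "w \<notin> U" for w
    using arg_cong[OF sol, of "\<lambda>y. y $ w"] that by (simp add: codeg_matrix_mult b'_def)
  then have eq: "(\<lambda>u. if u \<in> U then x $ u else 0) = (\<lambda>u. x $ u)" by auto
  show ?thesis
  proof (rule that[of "\<lambda>u. x $ u"])
    show "codeg U (\<lambda>u. x $ u) w = b w" if "w \<in> U" for w
    proof -
      have "codeg U (\<lambda>u. if u \<in> U then x $ u else 0) w = (codeg_matrix U *v x) $ w"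
        using that by (simp only: codeg_matrix_mult if_True)
      also have "\<dots> = b w" using that by (simp add: sol b'_def)
      finally show ?thesis by (simp only: eq)
    qed
    show "x $ w = 0" if "w \<notin> U" for w using out that .
    fix w assume "\<And>w. w \<in> U \<Longrightarrow> b w \<in> \<int>"
    then have "det (\<chi> i j. if j = w then b' $ i else codeg_matrix U $ i $ j) \<in> \<int>"
      by (intro det_in_Ints) (auto simp: b'_def codeg_matrix_Ints)
    then show "det (codeg_matrix U) * x $ w \<in> \<int>"
      using det_codeg_matrix[of U] by (simp add: x_def)
  qed
qed

lemma self_int_neg: "self_int G w < 0"
proof -
  have "E_curve w \<noteq> (0 :: real ^ 'v)" by (simp add: axis_eq_0_iff)
  from negative_definite[OF this] have "codeg UNIV (\<lambda>u. E_curve w $ u :: real) w > 0"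
    by (simp add: int_form_axis)
  moreover have "(\<Sum>u\<in>nbrs E UNIV w. E_curve w $ u :: real) = 0"
    by (rule sum.neutral) (auto simp: axis_def nbrs_def E_irrefl)
  ultimately have "0 < - real_of_int (self_int G w)" by (simp add: codeg_def axis_def)
  then show ?thesis by simp
qed

text \<open>
  The solution of \<open>codeg f = 1\<close> is positive: testing the equation against the negative part \<open>g\<close> of \<open>f\<close>
  gives \<open>(g, g) \<ge> 0\<close>, so \<open>g = 0\<close>, and a zero of \<open>f\<close> would contradict the equation there.
\<close>

lemma exists_positive_vector:
  "\<exists>f :: 'v \<Rightarrow> real. (\<forall>w. f w > 0) \<and> (\<forall>w. codeg UNIV f w > 0)"
proof -
  obtain f :: "'v \<Rightarrow> real" where f: "\<And>w. codeg UNIV f w = 1"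
    by (rule codeg_solution[of UNIV "\<lambda>_. 1"]) auto
  define g where "g = (\<lambda>w. max 0 (- f w))"
  define p where "p = (\<lambda>w. max 0 (f w))"
  have fpg: "f = (\<lambda>w. p w - g w)" by (auto simp: p_def g_def)
  have "(\<Sum>w\<in>UNIV. g w * codeg UNIV f w) \<ge> 0" by (intro sum_nonneg) (auto simp: f g_def)
  moreover have "g w * codeg UNIV p w \<le> 0" for w
  proof -
    have "g w * p w = 0" by (auto simp: g_def p_def max_def)
    then have "g w * (of_int (self_int G w) * p w) = 0" by auto
    then have "g w * codeg UNIV p w = - g w * (\<Sum>u\<in>nbrs E UNIV w. p u)"
      by (simp add: codeg_def right_diff_distrib del: mult_eq_0_iff)
    also have "\<dots> \<le> 0" by (auto simp: g_def p_def intro!: mult_nonneg_nonneg sum_nonneg)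
    finally show ?thesis .
  qed
  then have "(\<Sum>w\<in>UNIV. g w * codeg UNIV p w) \<le> 0" by (simp add: sum_nonpos)
  moreover have "(\<Sum>w\<in>UNIV. g w * codeg UNIV f w) =
      (\<Sum>w\<in>UNIV. g w * codeg UNIV p w) - (\<Sum>w\<in>UNIV. g w * codeg UNIV g w)"
    by (subst fpg) (simp add: codeg_diff algebra_simps sum_subtractf)
  ultimately have "(\<Sum>w\<in>UNIV. g w * codeg UNIV g w) \<le> 0" by linarith
  then have "int_form G (\<chi> w. g w) (\<chi> w. g w) \<ge> 0" by (simp add: int_form_sum)
  then have "(\<chi> w. g w) = 0" using negative_definite by force
  then have "g w = 0" for w by (auto simp: vec_eq_iff)
  then have nonneg: "f w \<ge> 0" for w unfolding g_def by (metis max.absorb_iff1 neg_le_0_iff_le)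
  have "f w > 0" for w
  proof -
    have "1 + (\<Sum>u\<in>nbrs E UNIV w. f u) = - of_int (self_int G w) * f w"
      using f[of w] by (simp add: codeg_def)
    moreover have "(\<Sum>u\<in>nbrs E UNIV w. f u) \<ge> 0" using nonneg by (simp add: sum_nonneg)
    ultimately have "f w \<noteq> 0" by auto
    with nonneg[of w] show ?thesis by simp
  qed
  with f show ?thesis by (metis zero_less_one)
qed

definition pos_vec :: "'v \<Rightarrow> real" where
  "pos_vec = (SOME f. (\<forall>w. f w > 0) \<and> (\<forall>w. codeg UNIV f w > 0))"

lemma pos_vec_pos: "pos_vec w > 0" and codeg_pv_UNIV: "codeg UNIV pos_vec w > 0"
  using someI_ex[OF exists_positive_vector] unfolding pos_vec_def by blast+

lemma codeg_mono_set: "W \<subseteq> U \<Longrightarrow> (\<And>u. u \<in> U - W \<Longrightarrow> 0 \<le> f u) \<Longrightarrow> codeg U f w \<le> codeg W (f :: 'v \<Rightarrow> real) w"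
  unfolding codeg_def by (intro diff_left_mono sum_mono2) (auto simp: nbrs_def)

lemma codeg_pos_vec: "codeg U pos_vec w > 0"
  using codeg_mono_set[of U UNIV pos_vec w] codeg_pv_UNIV[of w] pos_vec_pos less_imp_le
  by (meson order_less_le_trans subset_UNIV)

text \<open>
  Minimum principle: at a vertex where \<open>f / pos_vec\<close> is minimal, a negative minimum would make the
  codegree negative.
\<close>

lemma comparison_principle:
  fixes f :: "'v \<Rightarrow> real"
  assumes "\<And>w. w \<in> U \<Longrightarrow> 0 \<le> codeg U f w" and "w \<in> U"
  shows "0 \<le> f w"
proof -
  define r where "r = (\<lambda>u. f u / pos_vec u)"
  have "finite U" "U \<noteq> {}" using assms(2) by auto
  from arg_min_if_finite[OF this, of r]
  obtain z where z: "z \<in> U" "\<And>u. u \<in> U \<Longrightarrow> r z \<le> r u" by force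
  define t where "t = r z"
  have le: "t * pos_vec u \<le> f u" if "u \<in> U" for u
    using z(2)[OF that] pos_vec_pos[of u] by (simp add: t_def r_def pos_le_divide_eq)
  have "t \<ge> 0"
  proof (rule ccontr)
    assume "\<not> t \<ge> 0"
    have fz: "f z = t * pos_vec z" using pos_vec_pos[of z] by (simp add: t_def r_def)
    have "0 \<le> codeg U f z" using assms z by simp
    also have "\<dots> \<le> codeg U (\<lambda>u. t * pos_vec u) z"
      unfolding codeg_def fz by (intro diff_left_mono sum_mono le) (auto simp: nbrs_def)
    also have "\<dots> = t * codeg U pos_vec z" by (rule codeg_scale)
    also have "\<dots> < 0" using \<open>\<not> t \<ge> 0\<close> codeg_pos_vec[of U z] by (simp add: mult_neg_pos)
    finally show False by simp
  qed
  with le[OF assms(2)] pos_vec_pos[of w] show ?thesis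
    by (meson less_imp_le mult_nonneg_nonneg order_trans)
qed

lemma exists_scale: "\<exists>C\<ge>0. \<forall>w. \<kappa> w \<le> C * codeg U pos_vec w"
proof -
  define C where "C = (\<Sum>w\<in>UNIV. \<bar>\<kappa> w\<bar> / codeg U pos_vec w)"
  have "\<kappa> w \<le> C * codeg U pos_vec w" for w
  proof -
    have "\<bar>\<kappa> w\<bar> / codeg U pos_vec w \<le> C" unfolding C_def
      by (rule member_le_sum) (use codeg_pos_vec less_imp_le in \<open>auto intro!: divide_nonneg_nonneg\<close>)
    then show ?thesis using codeg_pos_vec[of U w] by (simp add: field_simps)
  qed
  moreover have "C \<ge> 0" unfolding C_def
    by (intro sum_nonneg divide_nonneg_nonneg) (use codeg_pos_vec less_imp_le in auto)
  ultimately show ?thesis by blast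
qed

lemma finite_int_functions:
  assumes "\<And>l u. l \<in> A \<Longrightarrow> K1 \<le> l u \<and> l u \<le> (K2::int)"
  shows "finite (A :: ('v \<Rightarrow> int) set)"
proof (rule finite_subset)
  show "A \<subseteq> PiE UNIV (\<lambda>_. {K1..K2})" using assms by (auto simp: PiE_def)
  show "finite (PiE UNIV (\<lambda>_. {K1..K2}) :: ('v \<Rightarrow> int) set)" by (intro finite_PiE) auto
qed

text \<open>
  The comparison principle bounds all values from below.  Effectivity at a vertex then bounds its
  neighbours from above, starting from the bound at \<open>v\<close>.
\<close>

lemma finite_effective:
  assumes "grows E {v} U"
  shows "finite {l :: 'v \<Rightarrow> int. (\<forall>w. w \<notin> U \<longrightarrow> l w = 0) \<and> l v \<le> y0 \<and> (\<forall>w\<in>U. 0 \<le> \<kappa> w + codeg U l w)}"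
    (is "finite ?S")
proof -
  obtain C where C: "C \<ge> 0" "\<And>w. of_int (\<kappa> w) \<le> C * codeg U pos_vec w" using exists_scale[of "\<lambda>w. of_int (\<kappa> w)"] by blast
  \<comment> \<open>a lower bound for all values, from the comparison with \<open>-C\<close> times the positive vector\<close>
  define K1 where "K1 = \<lfloor>- C * (\<Sum>u\<in>UNIV. pos_vec u)\<rfloor>"
  have "pos_vec u \<le> (\<Sum>u\<in>UNIV. pos_vec u)" for u by (rule member_le_sum) (auto intro: less_imp_le pos_vec_pos)
  then have pvsum: "C * pos_vec u \<le> C * (\<Sum>u\<in>UNIV. pos_vec u)" for u using C by (simp add: mult_left_mono)
  have "0 \<le> C * (\<Sum>u\<in>UNIV. pos_vec u)"
    using C(1) by (intro mult_nonneg_nonneg sum_nonneg) (auto intro: less_imp_le pos_vec_pos)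
  then have K1le: "K1 \<le> 0" unfolding K1_def by linarith
  have low: "K1 \<le> l u" if l: "l \<in> ?S" for l u
  proof (cases "u \<in> U")
    case True
    have "0 \<le> of_int (l u) + C * pos_vec u"
    proof (rule comparison_principle[of U "\<lambda>u. of_int (l u) + C * pos_vec u", OF _ True])
      fix w assume "w \<in> U"
      then have "0 \<le> \<kappa> w + codeg U l w" using l by auto
      then have "0 \<le> real_of_int (\<kappa> w + codeg U l w)" by (simp only: of_int_0_le_iff)
      then have "0 \<le> of_int (\<kappa> w) + codeg U (\<lambda>u. real_of_int (l u)) w"
        by (simp add: codeg_of_int)
      then show "0 \<le> codeg U (\<lambda>u. real_of_int (l u) + C * pos_vec u) w"
        using C(2)[of w] by (simp add: codeg_add codeg_scale)
    qed
    then have "- C * (\<Sum>u\<in>UNIV. pos_vec u) \<le> of_int (l u)" using pvsum[of u] by simp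
    then show ?thesis unfolding K1_def by linarith
  qed (use l K1le in auto)
  have up: "\<exists>K. \<forall>l\<in>?S. l u \<le> K" if "grows E {v} U'" "U' \<subseteq> U" "u \<in> U'" for U' u
    using that
  proof (induction arbitrary: u rule: grows.induct)
    case refl
    then show ?case by auto
  next
    case (attach U' p c)
    show ?case
    proof (cases "u = c")
      case False
      then show ?thesis using attach.IH[of u] attach.prems by auto
    next
      case True
      obtain K where K: "\<And>l. l \<in> ?S \<Longrightarrow> l p \<le> K" using attach.IH[of p] attach.prems attach.hyps by auto
      have cp: "c \<in> nbrs E U p" using attach.prems attach.hyps E_sym by (auto simp: nbrs_def)
      have "l c \<le> \<kappa> p + - self_int G p * K - K1 * card (nbrs E U p - {c})" if l: "l \<in> ?S" for l
      proof -
        have "p \<in> U" using attach.prems attach.hyps by auto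
        then have "0 \<le> \<kappa> p + codeg U l p" using l by auto
        moreover have "codeg U l p = - self_int G p * l p - (l c + (\<Sum>u\<in>nbrs E U p - {c}. l u))"
          using sum.remove[OF finite_class.finite cp, of l] by (simp add: codeg_def)
        moreover have "(\<Sum>u\<in>nbrs E U p - {c}. l u) \<ge> (\<Sum>u\<in>nbrs E U p - {c}. K1)"
          by (intro sum_mono low l)
        moreover have "- self_int G p * l p \<le> - self_int G p * K"
          using K[OF l] self_int_neg[of p] by (intro mult_left_mono) auto
        ultimately show ?thesis by (simp add: mult.commute)
      qed
      then show ?thesis using True by blast
    qed
  qed
  have "\<exists>K. \<forall>l\<in>?S. l u \<le> K" for u
  proof (cases "u \<in> U")
    case True
    then show ?thesis using up[OF assms, of u] by simp
  next
    case False
    then show ?thesis by (intro exI[of _ 0]) auto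
  qed
  then have "\<forall>u. \<exists>K. \<forall>l\<in>?S. l u \<le> K" by (rule allI)
  from choice[OF this] obtain K where K: "\<forall>u. \<forall>l\<in>?S. l u \<le> K u" by (rule exE)
  define K2 where "K2 = Max (range K)"
  have up2: "l u \<le> K2" if "l \<in> ?S" for l u
  proof -
    have "l u \<le> K u" using spec[OF K, of u] that by (rule bspec)
    also have "\<dots> \<le> K2" unfolding K2_def by (rule Max_ge) auto
    finally show ?thesis .
  qed
  show ?thesis by (rule finite_int_functions[of ?S K1 K2]) (rule conjI[OF low up2])
qed

end

section \<open>Sums over a subtree and their two expansions\<close>

lemma int_affine:
  fixes f :: "int \<Rightarrow> real"
  assumes "\<And>y. f (y + 1) - f y = c"
  shows "f y = f 0 + c * of_int y"
proof (induction y rule: int_induct[of _ 0])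
  case (step1 i)
  then show ?case using assms[of i] by (simp add: algebra_simps)
next
  case (step2 i)
  then show ?case using assms[of "i - 1"] by (simp add: algebra_simps)
qed simp

lemma int_quadratic:
  fixes f :: "int \<Rightarrow> real"
  assumes "\<And>k. f (k + 1) - f k = a + c * of_int k"
  shows "f k = f 0 + a * of_int k + c * (of_int k * (of_int k - 1) / 2)"
proof (induction k rule: int_induct[of _ 0])
  case (step1 i)
  then show ?case using assms[of i] by (simp add: field_simps)
next
  case (step2 i)
  then show ?case using assms[of "i - 1"] by (simp add: field_simps)
qed simp

text \<open>
  The coefficients of \<open>(1 - X)\<close> to the power \<open>d - 2\<close>, see \<open>one_minus_X_power_nth\<close>.
\<close>

definition factor_coeff :: "nat \<Rightarrow> int \<Rightarrow> real" where
  "factor_coeff d = (bdiff ^^ d) (\<lambda>m. of_int (max 0 (m + 1)))"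

lemma factor_coeff_neg: "n < 0 \<Longrightarrow> factor_coeff d n = 0"
  by (induction d arbitrary: n) (auto simp: factor_coeff_def bdiff_def)

context plumbing
begin

sublocale tree: tree_sum "adj G" v pos_vec for v
  by unfold_locales (use E_sym E_irrefl pos_vec_pos in auto)

definition vertex_ramp :: "('v \<Rightarrow> int) \<Rightarrow> 'v \<Rightarrow> int \<Rightarrow> int \<Rightarrow> real" where
  "vertex_ramp \<kappa> w y m = of_int (max 0 (\<kappa> w - self_int G w * y + m + 1))"

definition vertex_offset :: "('v \<Rightarrow> int) \<Rightarrow> 'v \<Rightarrow> int \<Rightarrow> real" where
  "vertex_offset \<kappa> w y = of_int (\<kappa> w - self_int G w * y + 1)"

lemma weight_vertex_ramp:
  "tree.weight v U s (vertex_ramp \<kappa>) l =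
     (\<Prod>w\<in>U. factor_coeff (card (nbrs E U w)) (\<kappa> w + codeg U l w + (if w = v then s else 0)))"
proof -
  have "vertex_ramp \<kappa> w y = (\<lambda>m. of_int (max 0 ((\<kappa> w - self_int G w * y + m) + 1)))" for w y
    by (auto simp: vertex_ramp_def)
  then have e: "(bdiff ^^ d) (vertex_ramp \<kappa> w y) m = factor_coeff d (\<kappa> w - self_int G w * y + m)" for d w y m
    using bdiff_pow_shift[of d "\<lambda>m. of_int (max 0 (m + 1))" "\<kappa> w - self_int G w * y"]
    by (simp add: factor_coeff_def)
  then show ?thesis
    unfolding tree.weight_def tree.local_weight_def e
    by (intro prod.cong refl arg_cong2[of _ _ _ _ factor_coeff]) (simp_all add: codeg_def)
qed

lemma weight_opposite_vertex_ramp: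
  "tree.weight v U s (tree.opposite (vertex_ramp \<kappa>) (vertex_offset \<kappa>)) l =
     (\<Prod>w\<in>U. (-1) ^ card (nbrs E U w)) * (\<Prod>w\<in>U. factor_coeff (card (nbrs E U w))
        (int (card (nbrs E U w)) - 2 - (\<kappa> w + codeg U l w + (if w = v then s else 0))))"
proof -
  have "tree.opposite (vertex_ramp \<kappa>) (vertex_offset \<kappa>) w y =
      (\<lambda>m. of_int (max 0 ((- 2 - (\<kappa> w - self_int G w * y + m)) + 1)))" for w y
    by (auto simp: vertex_ramp_def vertex_offset_def tree.opposite_def max_def)
  then have e: "(bdiff ^^ d) (tree.opposite (vertex_ramp \<kappa>) (vertex_offset \<kappa>) w y) m =
      (-1) ^ d * factor_coeff d (int d - 2 - (\<kappa> w - self_int G w * y + m))" for d w y m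
    using bdiff_pow_reflect[of d "\<lambda>m. of_int (max 0 (m + 1))" "- 2 - (\<kappa> w - self_int G w * y)"]
    by (simp add: factor_coeff_def algebra_simps)
  then show ?thesis
    unfolding tree.weight_def tree.local_weight_def prod.distrib[symmetric] e
    by (intro prod.cong refl arg_cong2[of _ _ _ _ factor_coeff] arg_cong2[of _ _ _ _ "(*)"]) (simp_all add: codeg_def)
qed

text \<open>
  The valences of a finite graph have an even sum, so the signs produced by reflecting all factors cancel.
\<close>

lemma degree_parity:
  assumes "grows E {v} U"
  shows "(\<Prod>w\<in>U. (-1) ^ card (nbrs E U w)) = (1 :: real)"
  using assms
proof (induction rule: grows.induct)
  case refl
  have "nbrs E {v} v = {}" using E_irrefl by (auto simp: nbrs_def)
  then show ?case by simp
next
  case (attach U p c)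
  have vU: "v \<in> U" using grows_mono[OF attach.hyps(1)] by auto
  note step = vU \<open>p \<in> U\<close> \<open>c \<notin> U\<close> attach.hyps(4)
  have "(\<Prod>w\<in>insert c U. (-1) ^ card (nbrs E (insert c U) w)) =
     (-1) ^ card (nbrs E (insert c U) c) * ((-1) ^ card (nbrs E (insert c U) p) *
       (\<Prod>w\<in>U - {p}. (-1) ^ card (nbrs E (insert c U) w)) :: real)"
    using step by (simp add: prod.remove[of U p])
  also have "(\<Prod>w\<in>U - {p}. (-1) ^ card (nbrs E (insert c U) w)) = (\<Prod>w\<in>U - {p}. (-1) ^ card (nbrs E U w) :: real)"
    by (rule prod.cong) (auto simp: tree.nbrs_other[OF step])
  also have "(-1) ^ card (nbrs E (insert c U) p) = (- 1) * (-1) ^ card (nbrs E U p :: 'v set) * (1 :: real)"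
    using tree.leaf_notin_nbrs[OF step] by (simp add: tree.nbrs_parent[OF step])
  also have "(-1) ^ card (nbrs E (insert c U) c) = (- 1 :: real)"
    by (simp add: tree.nbrs_leaf[OF step])
  also have "- 1 * (- 1 * (- 1) ^ card (nbrs E U p) * 1 * (\<Prod>w\<in>U - {p}. (- 1) ^ card (nbrs E U w)))
      = (\<Prod>w\<in>U. (-1) ^ card (nbrs E U w) :: real)"
    using step by (simp add: prod.remove[of U p])
  finally show ?case using attach.IH by simp
qed

text \<open>
  The codegrees of \<open>Z\<^sub>K - x\<close> in terms of those of \<open>x\<close>.
\<close>

definition dual_codeg :: "('v \<Rightarrow> int) \<Rightarrow> 'v \<Rightarrow> int" where
  "dual_codeg \<kappa> w = - self_int G w - 2 - \<kappa> w"

definition reflect :: "'v set \<Rightarrow> ('v \<Rightarrow> int) \<Rightarrow> 'v \<Rightarrow> int" where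
  "reflect U l w = (if w \<in> U then - 1 - l w else 0)"

lemma codeg_reflect:
  assumes "w \<in> U"
  shows "codeg U (reflect U l) w = self_int G w + int (card (nbrs E U w)) - codeg U l w"
proof -
  have "codeg U (reflect U l) w = codeg U (\<lambda>u. - 1 - l u) w"
    using assms by (auto simp: codeg_def reflect_def nbrs_def intro!: sum.cong)
  then show ?thesis by (simp add: codeg_diff codeg_const[of U "- 1"])
qed

text \<open>
  The functional equation of the rational function: its expansion at infinity is its expansion at
  \<open>0\<close>, reflected.
\<close>

lemma weight_opposite_eq_dual_codeg:
  assumes "grows E {v} U"
  shows "tree.weight v U s (tree.opposite (vertex_ramp \<kappa>) (vertex_offset \<kappa>)) l =
    tree.weight v U (- s) (vertex_ramp (dual_codeg \<kappa>)) (reflect U l)"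
  unfolding weight_opposite_vertex_ramp degree_parity[OF assms] weight_vertex_ramp
  by (simp, intro prod.cong refl arg_cong2[of _ _ _ _ factor_coeff]) (auto simp: codeg_reflect dual_codeg_def)

definition root_in :: "'v \<Rightarrow> int set \<Rightarrow> 'v \<Rightarrow> int set" where
  "root_in v S w = (if w = v then S else UNIV)"

lemma configs_root_in:
  "v \<in> U \<Longrightarrow> configs (root_in v S) U = {l. l v \<in> S \<and> (\<forall>w. w \<notin> U \<longrightarrow> l w = 0)}"
  by (auto simp: configs_def root_in_def)

lemma reflect_bij:
  assumes "v \<in> U"
  shows "bij_betw (reflect U) (configs (root_in v S) U) (configs (root_in v ((\<lambda>j. - 1 - j) ` S)) U)"
  using assms
  by (intro bij_betwI[of _ _ _ "reflect U"]) (auto simp: configs_root_in reflect_def fun_eq_iff)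

text \<open>
  The counting function of the subtree \<open>W\<close> alone.  The remaining curves enter only through the
  codegrees \<open>\<kappa>\<close>, as boundary values.
\<close>

definition subtree_sum :: "'v \<Rightarrow> 'v set \<Rightarrow> ('v \<Rightarrow> int) \<Rightarrow> int set \<Rightarrow> real" where
  "subtree_sum v W \<kappa> S = tree.state_sum v (root_in v S) W 0 (vertex_ramp \<kappa>)"

lemma subtree_sum_cong:
  assumes "\<And>w. w \<in> W \<Longrightarrow> \<kappa> w = \<kappa>' w"
  shows "subtree_sum v W \<kappa> S = subtree_sum v W \<kappa>' S"
  unfolding subtree_sum_def tree.state_sum_def weight_vertex_ramp
  by (intro infsum_cong prod.cong refl arg_cong2[of _ _ _ _ factor_coeff]) (use assms in simp_all)

lemma weight_offset:
  "tree.weight v U s (vertex_ramp \<kappa>) l = tree.weight v U 0 (vertex_ramp (\<kappa>(v := \<kappa> v + s))) l"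
  unfolding weight_vertex_ramp by (intro prod.cong refl arg_cong2[of _ _ _ _ factor_coeff]) auto

lemma state_sum_vertex_ramp: "tree.state_sum v (root_in v S) W s (vertex_ramp \<kappa>) = subtree_sum v W (\<kappa>(v := \<kappa> v + s)) S"
  unfolding subtree_sum_def tree.state_sum_def weight_offset[of v W s \<kappa>] ..

context
  fixes v W
  assumes W: "grows E {v} W"
begin

lemma root_mem: "v \<in> W"
  using grows_mono[OF W] by auto

lemma finite_states_vertex_ramp:
  assumes "\<And>j. j \<in> Y v \<Longrightarrow> j \<le> y0"
  shows "tree.finite_states v Y W s (vertex_ramp \<kappa>)"
proof -
  let ?k = "\<kappa>(v := \<kappa> v + s)"
  have "{l \<in> configs Y W. tree.weight v W s (vertex_ramp \<kappa>) l \<noteq> 0} \<subseteq>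
    {l. (\<forall>w. w \<notin> W \<longrightarrow> l w = 0) \<and> l v \<le> y0 \<and> (\<forall>w\<in>W. 0 \<le> ?k w + codeg W l w)}"
  proof
    fix l assume l: "l \<in> {l \<in> configs Y W. tree.weight v W s (vertex_ramp \<kappa>) l \<noteq> 0}"
    have "0 \<le> ?k w + codeg W l w" if "w \<in> W" for w
    proof (rule ccontr)
      assume "\<not> 0 \<le> ?k w + codeg W l w"
      then have "factor_coeff (card (nbrs E W w)) (?k w + codeg W l w + 0) = 0" by (intro factor_coeff_neg) simp
      then have "tree.weight v W 0 (vertex_ramp ?k) l = 0"
        unfolding weight_vertex_ramp using that by (intro prod_zero) (auto intro!: bexI[of _ w])
      with l show False by (simp add: weight_offset[of v W s])
    qed
    then show "l \<in> {l. (\<forall>w. w \<notin> W \<longrightarrow> l w = 0) \<and> l v \<le> y0 \<and> (\<forall>w\<in>W. 0 \<le> ?k w + codeg W l w)}"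
      using l assms root_mem by (auto simp: configs_def)
  qed
  then show ?thesis
    unfolding tree.finite_states_def using finite_effective[OF W, of y0 ?k] by (rule finite_subset)
qed

lemma state_sum_opposite:
  "tree.state_sum v (root_in v S) W s (tree.opposite (vertex_ramp \<kappa>) (vertex_offset \<kappa>)) =
    subtree_sum v W (dual_codeg (\<kappa>(v := \<kappa> v + s))) ((\<lambda>j. - 1 - j) ` S)"
proof -
  have "tree.state_sum v (root_in v S) W s (tree.opposite (vertex_ramp \<kappa>) (vertex_offset \<kappa>)) =
     (\<Sum>\<^sub>\<infinity>l\<in>configs (root_in v S) W. tree.weight v W (- s) (vertex_ramp (dual_codeg \<kappa>)) (reflect W l))"
    unfolding tree.state_sum_def weight_opposite_eq_dual_codeg[OF W] ..
  also have "\<dots> = tree.state_sum v (root_in v ((\<lambda>j. - 1 - j) ` S)) W (- s) (vertex_ramp (dual_codeg \<kappa>))"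
    unfolding tree.state_sum_def by (rule infsum_reindex_bij_betw[OF reflect_bij[OF root_mem]])
  also have "\<dots> = subtree_sum v W ((dual_codeg \<kappa>)(v := dual_codeg \<kappa> v + - s)) ((\<lambda>j. - 1 - j) ` S)"
    by (rule state_sum_vertex_ramp)
  also have "\<dots> = subtree_sum v W (dual_codeg (\<kappa>(v := \<kappa> v + s))) ((\<lambda>j. - 1 - j) ` S)"
    by (rule subtree_sum_cong) (simp add: dual_codeg_def)
  finally show ?thesis .
qed

lemma finite_states_opposite:
  assumes "\<And>j. j \<in> S \<Longrightarrow> y0 \<le> j"
  shows "tree.finite_states v (root_in v S) W s (tree.opposite (vertex_ramp \<kappa>) (vertex_offset \<kappa>))"
proof -
  let ?S = "(\<lambda>j. - 1 - j) ` S"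
  have fin: "tree.finite_states v (root_in v ?S) W (- s) (vertex_ramp (dual_codeg \<kappa>))"
    by (rule finite_states_vertex_ramp[of _ "- 1 - y0"]) (use assms in \<open>auto simp: root_in_def\<close>)
  show ?thesis unfolding tree.finite_states_def
  proof (rule inj_on_finite[OF _ _ fin[unfolded tree.finite_states_def]])
    show "inj_on (reflect W) {l \<in> configs (root_in v S) W. tree.weight v W s (tree.opposite (vertex_ramp \<kappa>) (vertex_offset \<kappa>)) l \<noteq> 0}"
      using reflect_bij[OF root_mem, of S] by (auto simp: bij_betw_def intro: inj_on_subset)
    show "reflect W ` {l \<in> configs (root_in v S) W. tree.weight v W s (tree.opposite (vertex_ramp \<kappa>) (vertex_offset \<kappa>)) l \<noteq> 0}
      \<subseteq> {l \<in> configs (root_in v ?S) W. tree.weight v W (- s) (vertex_ramp (dual_codeg \<kappa>)) l \<noteq> 0}"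
      using reflect_bij[OF root_mem, of S] by (auto simp: bij_betw_def weight_opposite_eq_dual_codeg[OF W])
  qed
qed

lemma subtree_sum_insert:
  assumes "\<And>j. j \<in> S \<Longrightarrow> j \<le> y" "y \<notin> S"
  shows "subtree_sum v W \<kappa> (insert y S) = subtree_sum v W \<kappa> S + subtree_sum v W \<kappa> {y}"
proof -
  have "configs (root_in v (insert y S)) W = configs (root_in v S) W \<union> configs (root_in v {y}) W"
    using root_mem by (auto simp: configs_root_in)
  moreover have "configs (root_in v S) W \<inter> configs (root_in v {y}) W = {}"
    using root_mem assms(2) by (auto simp: configs_root_in)
  moreover have "tree.weight v W 0 (vertex_ramp \<kappa>) summable_on configs (root_in v S) W"
    "tree.weight v W 0 (vertex_ramp \<kappa>) summable_on configs (root_in v {y}) W"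
    using finite_states_vertex_ramp[of "root_in v S" y 0 \<kappa>] finite_states_vertex_ramp[of "root_in v {y}" y 0 \<kappa>] assms
    by (auto simp: tree.finite_states_def root_in_def intro!: summable_on_finite_support)
  ultimately show ?thesis
    unfolding subtree_sum_def tree.state_sum_def by (simp add: infsum_Un_disjoint)
qed

lemma subtree_sum_translate:
  assumes p: "\<And>w. w \<notin> W \<Longrightarrow> p w = 0"
  shows "subtree_sum v W (\<lambda>w. \<kappa> w + codeg W p w) S = subtree_sum v W \<kappa> ((\<lambda>j. j + p v) ` S)"
proof -
  have "bij_betw (\<lambda>l w. l w + p w) (configs (root_in v S) W) (configs (root_in v ((\<lambda>j. j + p v) ` S)) W)"
    using root_mem p by (intro bij_betwI[of _ _ _ "\<lambda>l w. l w - p w"]) (auto simp: configs_root_in)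
  from infsum_reindex_bij_betw[OF this, of "tree.weight v W 0 (vertex_ramp \<kappa>)"]
  show ?thesis
    unfolding subtree_sum_def tree.state_sum_def weight_vertex_ramp by (simp add: codeg_add algebra_simps)
qed

text \<open>
  The second summand sums the expansion at infinity over \<open>l\<^sub>v \<ge> y\<close>, by \<open>state_sum_opposite\<close>.
\<close>

definition balanced_sum :: "('v \<Rightarrow> int) \<Rightarrow> int \<Rightarrow> real" where
  "balanced_sum \<kappa> y = subtree_sum v W \<kappa> {..<y} + subtree_sum v W (dual_codeg \<kappa>) {..<- y}"

lemma balanced_sum_cong: "(\<And>w. w \<in> W \<Longrightarrow> \<kappa> w = \<kappa>' w) \<Longrightarrow> balanced_sum \<kappa> y = balanced_sum \<kappa>' y"
  unfolding balanced_sum_def by (auto intro!: arg_cong2[of _ _ _ _ "(+)"] subtree_sum_cong simp: dual_codeg_def)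

lemma balanced_sum_dual_codeg: "balanced_sum (dual_codeg \<kappa>) 0 = balanced_sum \<kappa> 0"
proof -
  have "dual_codeg (dual_codeg \<kappa>) = \<kappa>" by (auto simp: dual_codeg_def)
  then show ?thesis by (simp add: balanced_sum_def)
qed

lemma balanced_sum_translate:
  assumes p: "\<And>w. w \<notin> W \<Longrightarrow> p w = 0"
  shows "balanced_sum (\<lambda>w. \<kappa> w + codeg W p w) y = balanced_sum \<kappa> (y + p v)"
proof -
  have im: "(\<lambda>j. j + a) ` {..<b} = {..<b + a}" for a b :: int
    by (auto simp: image_iff) (metis add_diff_cancel_right' diff_add_cancel diff_less_eq lessThan_iff)
  have "dual_codeg (\<lambda>w. \<kappa> w + codeg W p w) = (\<lambda>w. dual_codeg \<kappa> w + codeg W (\<lambda>u. - p u) w)"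
    by (auto simp: dual_codeg_def codeg_minus)
  then show ?thesis
    unfolding balanced_sum_def using subtree_sum_translate[of p \<kappa>, OF p] subtree_sum_translate[of "\<lambda>u. - p u" "dual_codeg \<kappa>"] p
    by (simp add: im im[of "- p v", simplified])
qed

definition jump :: "('v \<Rightarrow> int) \<Rightarrow> int \<Rightarrow> real" where
  "jump \<kappa> y = balanced_sum \<kappa> (y + 1) - balanced_sum \<kappa> y"

lemma jump_eq: "jump \<kappa> y = subtree_sum v W \<kappa> {y} - subtree_sum v W (dual_codeg \<kappa>) {- 1 - y}"
proof -
  have 1: "{..<y + 1} = insert y {..<y}" and 2: "{..<- y} = insert (- 1 - y) {..<- (y + 1)}" by auto
  show ?thesis
    unfolding jump_def balanced_sum_def 1 2 by (subst (1 2) subtree_sum_insert) auto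
qed

lemma admissible_vertex_ramp:
  assumes "\<And>w. w \<in> W \<Longrightarrow> real (card (nbrs E W w)) - 2 \<le> of_int (\<kappa> w) + codeg W (\<xi> :: 'v \<Rightarrow> real) w"
    and "\<And>w. w \<in> W \<Longrightarrow> of_int (\<kappa> w) + codeg W (\<zeta> :: 'v \<Rightarrow> real) w \<le> 0"
  shows "tree.admissible \<xi> \<zeta> W (vertex_ramp \<kappa>) (vertex_offset \<kappa>)"
proof -
  have b: "of_int (- self_int G w) * x \<le> of_int (- self_int G w) * y" if "x \<le> (y :: real)" for x y w
    using that self_int_neg[of w] by (intro mult_left_mono) auto
  have pos_vec: "t * (\<Sum>u\<in>nbrs E W w. pos_vec u) \<le> of_int (- self_int G w) * (t * pos_vec w)" if "0 \<le> t" for t w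
    using mult_left_mono[OF less_imp_le[OF codeg_pos_vec[of W w]] that]
    by (simp add: codeg_def algebra_simps)
  have "tree.ramp (vertex_ramp \<kappa> w y) (vertex_offset \<kappa> w y)" for w y
    unfolding tree.ramp_def vertex_ramp_def vertex_offset_def
    by (intro conjI exI[of _ "- (\<kappa> w - self_int G w * y + 1)"]) (auto simp: max_def)
  moreover have "vertex_ramp \<kappa> w y m = of_int m + vertex_offset \<kappa> w y"
    if "w \<in> W" "0 \<le> t" "\<xi> w + t * pos_vec w \<le> of_int y"
      "0 < of_int m + (\<Sum>u\<in>nbrs E W w. \<xi> u + t * pos_vec u) + card (nbrs E W w)" for w y m t
  proof -
    have "of_int (- self_int G w) * (\<xi> w + t * pos_vec w) \<le> of_int (- self_int G w) * of_int y"
      by (rule b) (rule that)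
    then have "- 2 < of_int (\<kappa> w) - of_int (self_int G w) * of_int y + (of_int m :: real)"
      using assms(1)[OF that(1)] pos_vec[OF that(2), of w] that(4)
      by (simp add: codeg_def algebra_simps sum.distrib sum_distrib_left)
    then have "- 2 < \<kappa> w - self_int G w * y + m" by (simp flip: of_int_mult of_int_diff of_int_add)
    then show ?thesis by (simp add: vertex_ramp_def vertex_offset_def)
  qed
  moreover have "vertex_ramp \<kappa> w y m = 0"
    if "w \<in> W" "0 \<le> t" "of_int y \<le> \<zeta> w - t * pos_vec w"
      "of_int m + (\<Sum>u\<in>nbrs E W w. \<zeta> u - t * pos_vec u) < 0" for w y m t
  proof -
    have "of_int (- self_int G w) * of_int y \<le> of_int (- self_int G w) * (\<zeta> w - t * pos_vec w)"
      by (rule b) (rule that)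
    then have "of_int (\<kappa> w) - of_int (self_int G w) * of_int y + (of_int m :: real) < 0"
      using assms(2)[OF that(1)] pos_vec[OF that(2), of w] that(4)
      by (simp add: codeg_def algebra_simps sum_subtractf sum_distrib_left)
    then have "\<kappa> w - self_int G w * y + m < 0" by (simp flip: of_int_mult of_int_diff of_int_add)
    then show ?thesis by (simp add: vertex_ramp_def)
  qed
  ultimately show ?thesis unfolding tree.admissible_def by blast
qed

lemma exists_bounding_vectors:
  obtains \<xi> \<zeta> :: "'v \<Rightarrow> real"
  where "\<And>w. real (card (nbrs E W w)) - 2 \<le> of_int (\<kappa> w) + codeg W \<xi> w" "\<And>w. of_int (\<kappa> w) + codeg W \<zeta> w \<le> 0"
proof -
  obtain C where C: "\<And>w. real (card (nbrs E W w)) - 2 - of_int (\<kappa> w) \<le> C * codeg W pos_vec w"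
    using exists_scale[of "\<lambda>w. real (card (nbrs E W w)) - 2 - of_int (\<kappa> w)" W] by blast
  obtain D where D: "\<And>w. of_int (\<kappa> w) \<le> D * codeg W pos_vec w"
    using exists_scale[of "\<lambda>w. of_int (\<kappa> w)" W] by blast
  show ?thesis
  proof (rule that[of "\<lambda>u. C * pos_vec u" "\<lambda>u. - D * pos_vec u"])
    show "real (card (nbrs E W w)) - 2 \<le> of_int (\<kappa> w) + codeg W (\<lambda>u. C * pos_vec u) w" for w
      using C[of w] by (simp add: codeg_scale)
    show "of_int (\<kappa> w) + codeg W (\<lambda>u. - D * pos_vec u) w \<le> 0" for w
      using D[of w] by (simp add: codeg_scale codeg_minus)
  qed
qed

text \<open>
  By \<open>jump_eq\<close> and \<open>state_sum_opposite\<close> a jump is the difference of the two expansions on the slice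
  \<open>l\<^sub>v = y\<close>, so \<open>expansion_difference\<close> applies.
\<close>

lemma jump_offset: "jump (\<kappa>(v := \<kappa> v + s)) y = jump \<kappa> y + of_int s"
proof -
  obtain \<xi> \<zeta> :: "'v \<Rightarrow> real" where
    "\<And>w. real (card (nbrs E W w)) - 2 \<le> of_int (\<kappa> w) + codeg W \<xi> w" "\<And>w. of_int (\<kappa> w) + codeg W \<zeta> w \<le> 0"
    using exists_bounding_vectors by blast
  then have adm: "tree.admissible \<xi> \<zeta> W (vertex_ramp \<kappa>) (vertex_offset \<kappa>)" by (intro admissible_vertex_ramp)
  obtain k where k: "\<And>s. tree.state_sum v (root_in v {y}) W s (vertex_ramp \<kappa>) -
      tree.state_sum v (root_in v {y}) W s (tree.opposite (vertex_ramp \<kappa>) (vertex_offset \<kappa>)) = of_int s + k"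
    using tree.expansion_difference[OF W adm, of "root_in v {y}" y]
      finite_states_vertex_ramp[of "root_in v {y}" y] finite_states_opposite[of "{y}" y]
    by (auto simp: root_in_def)
  have "jump (\<kappa>(v := \<kappa> v + s)) y = of_int s + k" for s
    using k[of s] by (simp add: jump_eq state_sum_vertex_ramp state_sum_opposite)
  from this[of s] this[of 0] show ?thesis by simp
qed

end

end

section \<open>Quasi-polynomials and reciprocity\<close>

context plumbing
begin

lemma codeg_sum: "codeg U (\<lambda>w. \<Sum>a\<in>A. f a w) w = (\<Sum>a\<in>A. codeg U (f a) w)"
  by (induction A rule: infinite_finite_induct) (simp_all add: codeg_add, simp_all add: codeg_def)

lemma integral_multiple_solution:
  obtains R :: int where "R > 0"
    "\<And>b :: 'v \<Rightarrow> int. \<exists>p :: 'v \<Rightarrow> int. (\<forall>w. w \<notin> U \<longrightarrow> p w = 0) \<and> (\<forall>w\<in>U. codeg U p w = R * b w)"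
proof -
  obtain d where d: "det (codeg_matrix U) = of_int d"
    using det_in_Ints[of "codeg_matrix U"] codeg_matrix_Ints by (metis Ints_cases)
  have "d \<noteq> 0" using det_codeg_matrix[of U] d by auto
  show ?thesis
  proof (rule that[of "\<bar>d\<bar>"])
    show "\<bar>d\<bar> > 0" using \<open>d \<noteq> 0\<close> by simp
    fix b :: "'v \<Rightarrow> int"
    obtain x :: "'v \<Rightarrow> real" where x: "\<And>w. w \<in> U \<Longrightarrow> codeg U x w = of_int (b w)"
      "\<And>w. w \<notin> U \<Longrightarrow> x w = 0" "\<And>w. of_int d * x w \<in> \<int>"
      by (rule codeg_solution[of U "\<lambda>w. of_int (b w)"]) (auto simp: d)
    have Rx: "of_int \<bar>d\<bar> * x w \<in> \<int>" for w
      using x(3)[of w] Ints_minus[OF x(3)[of w]] by (cases "d \<ge> 0") auto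
    define p where "p = (\<lambda>w. \<lfloor>of_int \<bar>d\<bar> * x w\<rfloor>)"
    have p: "of_int (p w) = of_int \<bar>d\<bar> * x w" for w
      using Rx[of w] unfolding p_def by (auto elim: Ints_cases)
    have "codeg U p w = \<bar>d\<bar> * b w" if "w \<in> U" for w
    proof -
      have "of_int (codeg U p w) = (of_int (\<bar>d\<bar> * b w) :: real)"
        unfolding codeg_of_int p codeg_scale x(1)[OF that] by simp
      then show ?thesis by (simp only: of_int_eq_iff)
    qed
    moreover have "p w = 0" if "w \<notin> U" for w using x(2)[OF that] by (simp add: p_def)
    ultimately show "\<exists>p. (\<forall>w. w \<notin> U \<longrightarrow> p w = 0) \<and> (\<forall>w\<in>U. codeg U p w = \<bar>d\<bar> * b w)" by blast
  qed
qed

definition quasi_poly :: "(('v \<Rightarrow> int) \<Rightarrow> real) \<Rightarrow> bool" where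
  "quasi_poly P \<longleftrightarrow> (\<exists>k>0. \<forall>\<kappa>. \<exists>p :: real ^ 'v \<Rightarrow> real. real_polynomial_function p \<and>
     (\<forall>e. P (\<lambda>w. \<kappa> w + k * codeg UNIV e w) = p (\<chi> u. of_int (e u))))"

text \<open>
  Along vectors whose codegrees on \<open>W\<close> vanish except at \<open>v\<close>, the jump grows linearly; hence
  the sum is quadratic in \<open>y\<close> along an arithmetic progression.  Translations by
  a multiple of the lattice change the codegrees on \<open>W\<close> by those of an integral vector
  supported on \<open>W\<close>, and so only shift \<open>y\<close>, by a linear form.
\<close>

lemma quasi_poly_balanced_sum:
  assumes W: "grows E {v} W"
  shows "quasi_poly (\<lambda>\<kappa>. balanced_sum v W \<kappa> 0)"
proof -
  obtain R :: int where R: "R > 0"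
    "\<And>b :: 'v \<Rightarrow> int. \<exists>p :: 'v \<Rightarrow> int. (\<forall>w. w \<notin> W \<longrightarrow> p w = 0) \<and> (\<forall>w\<in>W. codeg W p w = R * b w)"
    using integral_multiple_solution by blast
  obtain q :: "'v \<Rightarrow> int" where q: "\<And>w. w \<notin> W \<Longrightarrow> q w = 0"
      "\<And>w. w \<in> W \<Longrightarrow> codeg W q w = R * (if w = v then 1 else 0)"
    using R(2)[of "\<lambda>w. if w = v then 1 else 0"] by blast
  have "\<forall>u. \<exists>p :: 'v \<Rightarrow> int. (\<forall>w. w \<notin> W \<longrightarrow> p w = 0) \<and>
      (\<forall>w\<in>W. codeg W p w = R * codeg UNIV (\<lambda>a. if a = u then 1 else 0) w)"
    using R(2) by blast
  from choice[OF this] obtain p where p: "\<And>u w. w \<notin> W \<Longrightarrow> p u w = 0"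
     "\<And>u w. w \<in> W \<Longrightarrow> codeg W (p u) w = R * codeg UNIV (\<lambda>a. if a = u then 1 else 0) w" by blast
  \<comment> \<open>the period: moving along \<open>q\<close> raises the value at \<open>v\<close> by \<open>\<tau>\<close> and the codegree at \<open>v\<close> by \<open>R\<close>\<close>
  define \<tau> where "\<tau> = q v"
  have root_mem: "v \<in> W" using grows_mono[OF W] by auto
  have "\<tau> > 0"
  proof -
    have nonneg: "0 \<le> real_of_int (q w)" for w
    proof (cases "w \<in> W")
      case True
      show ?thesis
      proof (rule comparison_principle[OF _ True])
        fix w assume "w \<in> W"
        then have "0 \<le> codeg W q w" using q(2)[of w] R(1) by simp
        then show "0 \<le> codeg W (\<lambda>u. real_of_int (q u)) w"
          by (simp flip: codeg_of_int)
      qed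
    qed (simp add: q)
    have "R = - self_int G v * q v - (\<Sum>u\<in>nbrs E W v. q u)" using q(2)[OF root_mem] by (simp add: codeg_def)
    moreover have "(\<Sum>u\<in>nbrs E W v. q u) \<ge> 0" using nonneg by (intro sum_nonneg) auto
    ultimately have "q v \<noteq> 0" using R(1) by auto
    with nonneg[of v] show ?thesis by (simp add: \<tau>_def)
  qed
  define A :: "real ^ 'v \<Rightarrow> real" where "A = (\<lambda>x. \<Sum>u\<in>UNIV. of_int (p u v) * x $ u)"
  have A: "real_polynomial_function A" unfolding A_def
    by (intro real_polynomial_function.intros(1) bounded_linear_sum bounded_linear_const_mult bounded_linear_vec_nth)
  show ?thesis unfolding quasi_poly_def
  proof (intro exI[of _ "R * \<tau>"] conjI allI)
    show "R * \<tau> > 0" using R \<open>\<tau> > 0\<close> by simp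
    fix \<kappa>
    let ?f = "\<lambda>k. balanced_sum v W \<kappa> (\<tau> * k)"
    let ?C = "\<lambda>y. balanced_sum v W \<kappa> (y + \<tau>) - balanced_sum v W \<kappa> y"
    have jump: "jump v W \<kappa> (y + \<tau>) = jump v W \<kappa> y + of_int R" for y
    proof -
      have tr: "balanced_sum v W (\<kappa>(v := \<kappa> v + R)) y = balanced_sum v W \<kappa> (y + \<tau>)" for y
      proof -
        have "balanced_sum v W (\<kappa>(v := \<kappa> v + R)) y = balanced_sum v W (\<lambda>w. \<kappa> w + codeg W q w) y"
          by (rule balanced_sum_cong[OF W]) (simp add: q)
        then show ?thesis using balanced_sum_translate[OF W q(1)] by (simp add: \<tau>_def)
      qed
      have "jump v W \<kappa> (y + \<tau>) = jump v W (\<kappa>(v := \<kappa> v + R)) y"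
        unfolding jump_def[OF W] tr by (simp add: algebra_simps)
      then show ?thesis using jump_offset[OF W] by simp
    qed
    have C: "?C y = ?C 0 + of_int R * of_int y" for y
    proof (rule int_affine)
      fix y show "?C (y + 1) - ?C y = of_int R"
        using jump[of y] by (simp add: jump_def[OF W] algebra_simps)
    qed
    have quad: "?f k = ?f 0 + ?C 0 * of_int k + of_int (R * \<tau>) * (of_int k * (of_int k - 1) / 2)" for k
    proof (rule int_quadratic)
      fix k show "?f (k + 1) - ?f k = ?C 0 + of_int (R * \<tau>) * of_int k"
        using C[of "\<tau> * k"] by (simp add: algebra_simps)
    qed
    let ?P = "\<lambda>x. ?f 0 + ?C 0 * A x + of_int (R * \<tau>) * (A x * (A x - 1) * (1 / 2))"
    have "real_polynomial_function ?P"
      by (intro real_polynomial_function.intros(3) real_polynomial_function.intros(4) real_polynomial_function.intros(2) A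
          real_polynomial_function_diff)
    moreover have "balanced_sum v W (\<lambda>w. \<kappa> w + R * \<tau> * codeg UNIV e w) 0 = ?P (\<chi> u. of_int (e u))" for e
    proof -
      define a where "a = (\<Sum>u\<in>UNIV. e u * p u v)"
      define pe where "pe = (\<lambda>w. \<Sum>u\<in>UNIV. (\<tau> * e u) * p u w)"
      have e: "e = (\<lambda>w. \<Sum>u\<in>UNIV. e u * (if w = u then 1 else 0))"
        by (rule ext) (simp add: if_distrib cong: if_cong)
      have "codeg W pe w = R * \<tau> * codeg UNIV e w" if "w \<in> W" for w
      proof -
        have "codeg W pe w = (\<Sum>u\<in>UNIV. (\<tau> * e u) * (R * codeg UNIV (\<lambda>a. if a = u then 1 else 0) w))"
          unfolding pe_def codeg_sum codeg_scale by (simp add: p(2)[OF that])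
        also have "\<dots> = R * \<tau> * (\<Sum>u\<in>UNIV. codeg UNIV (\<lambda>a. e u * (if a = u then 1 else 0)) w)"
          by (simp only: codeg_scale sum_distrib_left mult_ac)
        also have "(\<Sum>u\<in>UNIV. codeg UNIV (\<lambda>a. e u * (if a = u then 1 else 0)) w) = codeg UNIV e w"
          by (subst (2) e) (simp only: codeg_sum)
        finally show ?thesis .
      qed
      then have "balanced_sum v W (\<lambda>w. \<kappa> w + R * \<tau> * codeg UNIV e w) 0 = balanced_sum v W (\<lambda>w. \<kappa> w + codeg W pe w) 0"
        by (intro balanced_sum_cong[OF W]) simp
      also have "\<dots> = balanced_sum v W \<kappa> (0 + pe v)"
        by (rule balanced_sum_translate[OF W]) (simp add: pe_def p)
      also have "0 + pe v = \<tau> * a" by (simp add: pe_def a_def sum_distrib_left mult_ac)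
      also have "balanced_sum v W \<kappa> (\<tau> * a) = ?f 0 + ?C 0 * of_int a + of_int (R * \<tau>) * (of_int a * (of_int a - 1) / 2)"
        by (rule quad)
      also have "of_int a = A (\<chi> u. of_int (e u))" by (simp add: A_def a_def mult.commute)
      finally show ?thesis by simp
    qed
    ultimately show "\<exists>p :: real ^ 'v \<Rightarrow> real. real_polynomial_function p \<and>
        (\<forall>e. balanced_sum v W (\<lambda>w. \<kappa> w + R * \<tau> * codeg UNIV e w) 0 = p (\<chi> u. of_int (e u)))" by blast
  qed
qed

text \<open>
  A lattice point in the sum has nonnegative codegrees while \<open>\<zeta>\<close> has nonpositive ones, and \<open>\<zeta> \<le> 0\<close> on the
  boundary \<open>J\<close>.  The comparison principle gives \<open>l\<^sub>v \<ge> \<zeta>\<^sub>v > -1\<close>, contrary to \<open>l\<^sub>v < 0\<close>.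
\<close>

lemma subtree_sum_eq_0:
  assumes W: "grows E {v} W" and closed: "\<And>w c. w \<in> W \<Longrightarrow> E w c \<Longrightarrow> c \<in> W \<union> J"
    and \<zeta>: "\<And>w. of_int (\<kappa> w) + codeg UNIV (\<zeta> :: 'v \<Rightarrow> real) w \<le> 0" "\<And>u. u \<in> J \<Longrightarrow> \<zeta> u \<le> 0" "- 1 < \<zeta> v"
  shows "subtree_sum v W \<kappa> {..<0} = 0"
  unfolding subtree_sum_def tree.state_sum_def
proof (rule infsum_0)
  fix l assume l: "l \<in> configs (root_in v {..<0}) W"
  have root_mem: "v \<in> W" using grows_mono[OF W] by auto
  show "tree.weight v W 0 (vertex_ramp \<kappa>) l = 0"
  proof (rule ccontr)
    assume nz: "tree.weight v W 0 (vertex_ramp \<kappa>) l \<noteq> 0"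
    have "0 \<le> of_int (l v) - \<zeta> v"
    proof (rule comparison_principle[of W "\<lambda>u. of_int (l u) - \<zeta> u", OF _ root_mem])
      fix w assume w: "w \<in> W"
      have "0 \<le> \<kappa> w + codeg W l w"
        using nz w factor_coeff_neg[of "\<kappa> w + codeg W l w"] unfolding weight_vertex_ramp by (force simp: not_le[symmetric])
      then have "0 \<le> real_of_int (\<kappa> w + codeg W l w)" by (simp only: of_int_0_le_iff)
      moreover have "codeg W \<zeta> w \<le> codeg UNIV \<zeta> w"
      proof -
        have "(\<Sum>u\<in>nbrs E UNIV w. \<zeta> u) = (\<Sum>u\<in>nbrs E W w. \<zeta> u) + (\<Sum>u\<in>nbrs E UNIV w - nbrs E W w. \<zeta> u)"
          by (subst sum.subset_diff[of "nbrs E W w"]) (auto simp: nbrs_def)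
        moreover have "(\<Sum>u\<in>nbrs E UNIV w - nbrs E W w. \<zeta> u) \<le> 0"
          by (rule sum_nonpos) (use closed[OF w] \<zeta>(2) in \<open>auto simp: nbrs_def\<close>)
        ultimately show ?thesis by (simp add: codeg_def)
      qed
      ultimately show "0 \<le> codeg W (\<lambda>u. of_int (l u) - \<zeta> u) w"
        using \<zeta>(1)[of w] by (simp add: codeg_diff codeg_of_int)
    qed
    then have "- 1 < l v" using \<zeta>(3) by linarith
    with l root_mem show False by (simp add: configs_root_in)
  qed
qed

text \<open>
  For the codegrees \<open>\<kappa>\<close> of \<open>x\<close> and with \<open>\<xi>\<close> measured from \<open>x\<close>: the real point \<open>x + \<xi>\<close> has codegrees at
  least \<open>val - 2\<close>, and each \<open>I\<close>-coordinate of \<open>x\<close> is the smallest in its class modulo \<open>1\<close> strictly above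
  that of \<open>x + \<xi>\<close>.
\<close>

definition effective_below :: "('v \<Rightarrow> int) \<Rightarrow> 'v set \<Rightarrow> ('v \<Rightarrow> real) \<Rightarrow> bool" where
  "effective_below \<kappa> I \<xi> \<longleftrightarrow> (\<forall>w. real (val G w) - 2 \<le> of_int (\<kappa> w) + codeg UNIV \<xi> w) \<and>
     (\<forall>u\<in>I. - 1 \<le> \<xi> u \<and> \<xi> u < 0)"

definition pinned :: "'v \<Rightarrow> 'v set \<Rightarrow> 'v \<Rightarrow> int set" where
  "pinned v J w = (if w = v then {..<0} else if w \<in> J then {0..} else UNIV)"

text \<open>
  First the vertices outside \<open>W\<close> are summed out.  The resulting weights agree below \<open>\<xi>\<close> with the
  original ones, and these alone determine the sum.  Passing from the whole tree to \<open>W\<close> preserves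
  the upper bound, since each deleted neighbour lowers the valence by one and has \<open>\<xi> \<ge> -1\<close>.
\<close>

lemma state_sum_pinned:
  assumes W: "grows E {v} W" "W \<inter> J = {}" and closed: "\<And>w c. w \<in> W \<Longrightarrow> E w c \<Longrightarrow> c \<in> W \<union> J"
    and \<xi>: "effective_below \<kappa> (insert v J) \<xi>"
  shows "tree.state_sum v (pinned v J) UNIV 0 (vertex_ramp \<kappa>) = subtree_sum v W \<kappa> {..<0}"
proof -
  have root_mem: "v \<in> W" using grows_mono[OF W(1)] by auto
  note WU = grows_UNIV[OF W(1)]
  note vU = grows_trans[OF WU W(1)]
  obtain D where D: "D \<ge> 0" "\<And>w. of_int (\<kappa> w) \<le> D * codeg UNIV pos_vec w"
    using exists_scale[of "\<lambda>w. of_int (\<kappa> w)" UNIV] by blast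
  define \<zeta> where "\<zeta> = (\<lambda>u. - (D * pos_vec u))"
  have \<zeta>: "of_int (\<kappa> w) + codeg U \<zeta> w \<le> 0" for U w
  proof -
    have "codeg UNIV pos_vec w \<le> codeg U pos_vec w"
      by (rule codeg_mono_set) (auto intro: less_imp_le pos_vec_pos)
    then have "D * codeg UNIV pos_vec w \<le> D * codeg U pos_vec w" using D(1) by (rule mult_left_mono)
    then show ?thesis using D(2)[of w] by (simp add: \<zeta>_def codeg_minus codeg_scale)
  qed
  have \<xi>U: "real (card (nbrs E UNIV w)) - 2 \<le> of_int (\<kappa> w) + codeg UNIV \<xi> w" for w
    using \<xi> by (simp add: effective_below_def val_eq)
  have \<xi>W: "real (card (nbrs E W w)) - 2 \<le> of_int (\<kappa> w) + codeg W \<xi> w" if "w \<in> W" for w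
  proof -
    have sub: "nbrs E W w \<subseteq> nbrs E UNIV w" by (auto simp: nbrs_def)
    have "(\<Sum>u\<in>nbrs E UNIV w. \<xi> u) = (\<Sum>u\<in>nbrs E W w. \<xi> u) + (\<Sum>u\<in>nbrs E UNIV w - nbrs E W w. \<xi> u)"
      by (subst sum.subset_diff[OF sub]) auto
    moreover have "(\<Sum>u\<in>nbrs E UNIV w - nbrs E W w. - 1) \<le> (\<Sum>u\<in>nbrs E UNIV w - nbrs E W w. \<xi> u)"
      by (rule sum_mono) (use closed[OF that] \<xi> in \<open>auto simp: nbrs_def effective_below_def\<close>)
    moreover have "card (nbrs E UNIV w) = card (nbrs E W w) + card (nbrs E UNIV w - nbrs E W w)"
      using sub by (simp add: card_Diff_subset card_mono)
    ultimately show ?thesis using \<xi>U[of w] by (simp add: codeg_def)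
  qed
  have admU: "tree.admissible \<xi> \<zeta> UNIV (vertex_ramp \<kappa>) (vertex_offset \<kappa>)"
    by (rule admissible_vertex_ramp[OF vU]) (rule \<xi>U, rule \<zeta>)
  have admW: "tree.admissible \<xi> \<zeta> W (vertex_ramp \<kappa>) (vertex_offset \<kappa>)"
    by (rule admissible_vertex_ramp[OF W(1)]) (erule \<xi>W, rule \<zeta>)
  have fin: "tree.finite_states v (pinned v J) U 0 (vertex_ramp \<kappa>)" if "grows E {v} U" for U
    by (rule finite_states_vertex_ramp[OF that, of _ 0]) (auto simp: pinned_def)
  have above: "tree.allows_above \<xi> (pinned v J) w" if "w \<in> UNIV - W" for w
  proof -
    have "0 \<le> j" if "w \<in> J" "\<xi> w < of_int j" for j
    proof -
      have "- 1 \<le> \<xi> w" using \<xi> that by (simp add: effective_below_def)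
      with that have "- 1 < real_of_int j" by simp
      then show ?thesis by linarith
    qed
    then show ?thesis using that root_mem by (auto simp: tree.allows_above_def pinned_def)
  qed
  have pin: "pinned v J c = {0..} \<and> \<xi> c < 0" if "c \<in> UNIV - W" "w \<in> W" "E c w" for c w
    using that closed[of w c] E_sym[of c w] root_mem \<xi> by (auto simp: pinned_def effective_below_def)
  have "\<exists>H' \<mu>'. tree.admissible \<xi> \<zeta> W H' \<mu>' \<and> tree.finite_states v (pinned v J) W 0 H' \<and>
      tree.state_sum v (pinned v J) UNIV 0 (vertex_ramp \<kappa>) = tree.state_sum v (pinned v J) W 0 H' \<and>
      (\<forall>w\<in>W. \<forall>y. of_int y \<le> \<xi> w \<longrightarrow> H' w y = vertex_ramp \<kappa> w y)"
    by (rule tree.eliminate_beyond[OF WU root_mem admU fin[OF vU]]; (rule above | rule pin); assumption)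
  then obtain H' \<mu>' where H': "tree.admissible \<xi> \<zeta> W H' \<mu>'" "tree.finite_states v (pinned v J) W 0 H'"
    "tree.state_sum v (pinned v J) UNIV 0 (vertex_ramp \<kappa>) = tree.state_sum v (pinned v J) W 0 H'"
    "\<And>w y. w \<in> W \<Longrightarrow> of_int y \<le> \<xi> w \<Longrightarrow> H' w y = vertex_ramp \<kappa> w y"
    by blast
  have "tree.state_sum v (pinned v J) W 0 H' = tree.state_sum v (pinned v J) W 0 (vertex_ramp \<kappa>)"
  proof (rule tree.state_sum_determined_below[OF W(1) H'(1) admW H'(2) fin[OF W(1)] H'(4)])
    show "pinned v J w = UNIV" if "w \<in> W - {v}" for w using that W(2) by (auto simp: pinned_def)
    show "of_int y \<le> \<xi> v" if "y \<in> pinned v J v" for y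
    proof -
      have "real_of_int y \<le> - 1" using that by (simp add: pinned_def)
      also have "- 1 \<le> \<xi> v" using \<xi> by (simp add: effective_below_def)
      finally show ?thesis .
    qed
  qed
  moreover have "configs (pinned v J) W = configs (root_in v {..<0}) W"
    using W(2) by (auto simp: configs_def pinned_def root_in_def)
  ultimately show ?thesis using H'(3) by (simp add: subtree_sum_def tree.state_sum_def)
qed

definition total_weight :: "('v \<Rightarrow> int) \<Rightarrow> ('v \<Rightarrow> int) \<Rightarrow> real" where
  "total_weight \<kappa> l = (\<Prod>w\<in>UNIV. factor_coeff (val G w) (\<kappa> w + codeg UNIV l w))"

lemma total_weight_eq: "total_weight \<kappa> l = tree.weight v UNIV 0 (vertex_ramp \<kappa>) l"
  unfolding total_weight_def weight_vertex_ramp by (simp add: val_eq)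

lemma finite_total_weight: "finite {l. l v \<le> y0 \<and> total_weight \<kappa> l \<noteq> 0}"
proof -
  have "grows E {v} UNIV" using grows_UNIV grows.refl by blast
  from finite_states_vertex_ramp[OF this, of "root_in v {..y0}" y0 0 \<kappa>]
  show ?thesis
    by (simp add: tree.finite_states_def configs_root_in total_weight_eq[of _ _ v])
      (simp add: root_in_def)
qed

text \<open>
  The form in which duality is proved: a symmetric quasi-polynomial that gives the values at all points
  bounded below as in \<open>effective_below\<close>.
\<close>

definition reciprocal :: "'v set \<Rightarrow> (('v \<Rightarrow> int) \<Rightarrow> real) \<Rightarrow> bool" where
  "reciprocal I F \<longleftrightarrow> (\<exists>P. (\<forall>\<kappa> \<xi>. effective_below \<kappa> I \<xi> \<longrightarrow> F \<kappa> = P \<kappa>) \<and>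
     (\<forall>\<kappa>. P (dual_codeg \<kappa>) = P \<kappa>) \<and> quasi_poly P)"

lemma quasi_poly_combine:
  assumes "quasi_poly P" "quasi_poly Q"
  shows "quasi_poly (\<lambda>\<kappa>. P \<kappa> + a * Q \<kappa>)"
proof -
  obtain k where k: "k > 0" "\<And>\<kappa>. \<exists>p :: real ^ 'v \<Rightarrow> real. real_polynomial_function p \<and>
     (\<forall>e. P (\<lambda>w. \<kappa> w + k * codeg UNIV e w) = p (\<chi> u. of_int (e u)))"
    using assms(1) unfolding quasi_poly_def by blast
  obtain m where m: "m > 0" "\<And>\<kappa>. \<exists>p :: real ^ 'v \<Rightarrow> real. real_polynomial_function p \<and>
     (\<forall>e. Q (\<lambda>w. \<kappa> w + m * codeg UNIV e w) = p (\<chi> u. of_int (e u)))"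
    using assms(2) unfolding quasi_poly_def by blast
  show ?thesis unfolding quasi_poly_def
  proof (intro exI[of _ "k * m"] conjI allI)
    show "k * m > 0" using k m by simp
    fix \<kappa>
    obtain p :: "real ^ 'v \<Rightarrow> real" where p: "real_polynomial_function p"
      "\<And>e. P (\<lambda>w. \<kappa> w + k * codeg UNIV e w) = p (\<chi> u. of_int (e u))" using k(2) by blast
    obtain q :: "real ^ 'v \<Rightarrow> real" where q: "real_polynomial_function q"
      "\<And>e. Q (\<lambda>w. \<kappa> w + m * codeg UNIV e w) = q (\<chi> u. of_int (e u))" using m(2) by blast
    have comp: "real_polynomial_function (\<lambda>x. f (c *\<^sub>R x))"
      if "real_polynomial_function f" for f :: "real ^ 'v \<Rightarrow> real" and c
    proof -
      have "polynomial_function (\<lambda>x :: real ^ 'v. c *\<^sub>R x)" by (intro polynomial_function_bounded_linear bounded_linear_scaleR_right)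
      from real_polynomial_function_compose[OF this that] show ?thesis by (simp add: o_def)
    qed
    have P: "P (\<lambda>w. \<kappa> w + k * m * codeg UNIV e w) = p (of_int m *\<^sub>R (\<chi> u. of_int (e u)))" for e
      using p(2)[of "\<lambda>u. m * e u"] by (simp add: codeg_scale mult.assoc scaleR_vec_def)
    have Q: "Q (\<lambda>w. \<kappa> w + k * m * codeg UNIV e w) = q (of_int k *\<^sub>R (\<chi> u. of_int (e u)))" for e
      using q(2)[of "\<lambda>u. k * e u"] by (simp add: codeg_scale mult_ac scaleR_vec_def)
    show "\<exists>p :: real ^ 'v \<Rightarrow> real. real_polynomial_function p \<and>
      (\<forall>e. P (\<lambda>w. \<kappa> w + k * m * codeg UNIV e w) + a * Q (\<lambda>w. \<kappa> w + k * m * codeg UNIV e w) = p (\<chi> u. of_int (e u)))"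
    proof (intro exI[of _ "\<lambda>x. p (of_int m *\<^sub>R x) + a * q (of_int k *\<^sub>R x)"] conjI allI)
      show "real_polynomial_function (\<lambda>x. p (of_int m *\<^sub>R x) + a * q (of_int k *\<^sub>R x))"
        by (rule real_polynomial_function.intros(3)[OF comp[OF p(1)]
              real_polynomial_function.intros(4)[OF real_polynomial_function.intros(2) comp[OF q(1)]]])
    qed (simp only: P Q)
  qed
qed

lemma reciprocal_combine:
  assumes "reciprocal I F" "reciprocal J F'" "I \<subseteq> K" "J \<subseteq> K"
  shows "reciprocal K (\<lambda>\<kappa>. F \<kappa> + a * F' \<kappa>)"
proof -
  have mono: "effective_below \<kappa> I' \<xi>" if "effective_below \<kappa> K \<xi>" "I' \<subseteq> K" for \<kappa> \<xi> I'
    using that by (auto simp: effective_below_def)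
  obtain P where P: "\<And>\<kappa> \<xi>. effective_below \<kappa> I \<xi> \<Longrightarrow> F \<kappa> = P \<kappa>" "\<And>\<kappa>. P (dual_codeg \<kappa>) = P \<kappa>" "quasi_poly P"
    using assms(1) unfolding reciprocal_def by blast
  obtain Q where Q: "\<And>\<kappa> \<xi>. effective_below \<kappa> J \<xi> \<Longrightarrow> F' \<kappa> = Q \<kappa>" "\<And>\<kappa>. Q (dual_codeg \<kappa>) = Q \<kappa>" "quasi_poly Q"
    using assms(2) unfolding reciprocal_def by blast
  have "F \<kappa> + a * F' \<kappa> = P \<kappa> + a * Q \<kappa>" if "effective_below \<kappa> K \<xi>" for \<kappa> \<xi>
    using P(1)[OF mono[OF that assms(3)]] Q(1)[OF mono[OF that assms(4)]] by simp
  then show ?thesis unfolding reciprocal_def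
    using quasi_poly_combine[OF P(3) Q(3), of a] P(2) Q(2)
    by (intro exI[of _ "\<lambda>\<kappa>. P \<kappa> + a * Q \<kappa>"]) auto
qed

lemma reciprocal_0: "reciprocal I (\<lambda>_. 0)"
  unfolding reciprocal_def quasi_poly_def
  by (auto intro!: exI[of _ "\<lambda>_. 0"] exI[of _ 1] real_polynomial_function.intros(2))

text \<open>
  Replacing \<open>x\<close> by \<open>Z\<^sub>K - x\<close> and \<open>\<xi>\<close> by \<open>-1 - \<xi>\<close> in each coordinate turns the lower bound for \<open>x\<close> into the
  hypotheses of \<open>subtree_sum_eq_0\<close>, because \<open>Z\<^sub>K\<close> minus the sum of all curves has codegrees
  \<open>val w - 2\<close>.
\<close>

lemma effective_below_dual_codeg:
  assumes "effective_below \<kappa> I \<xi>"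
  shows "of_int (dual_codeg \<kappa> w) + codeg UNIV (\<lambda>u. - 1 - \<xi> u) w \<le> 0"
    and "u \<in> I \<Longrightarrow> - 1 - \<xi> u \<le> 0" and "u \<in> I \<Longrightarrow> - 1 < - 1 - \<xi> u"
proof -
  have "real (val G w) - 2 \<le> of_int (\<kappa> w) + codeg UNIV \<xi> w" using assms by (simp add: effective_below_def)
  then show "of_int (dual_codeg \<kappa> w) + codeg UNIV (\<lambda>u. - 1 - \<xi> u) w \<le> 0"
    by (simp add: codeg_diff codeg_const[of UNIV "- 1"] dual_codeg_def val_eq)
qed (use assms in \<open>auto simp: effective_below_def\<close>)

text \<open>
  At such points the dual half of the balanced sum vanishes, so adding it symmetrises the sum
  without changing the values.
\<close>

lemma reciprocal_pinned:
  assumes "v \<notin> J"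
  shows "reciprocal (insert v J) (\<lambda>\<kappa>. tree.state_sum v (pinned v J) UNIV 0 (vertex_ramp \<kappa>))"
proof -
  have "{v} \<inter> J = {}" using assms by auto
  from grows_closed[OF grows.refl this]
  obtain W where W: "grows E {v} W" "W \<inter> J = {}" "\<And>w c. w \<in> W \<Longrightarrow> E w c \<Longrightarrow> c \<in> W \<union> J" by blast
  have "tree.state_sum v (pinned v J) UNIV 0 (vertex_ramp \<kappa>) = balanced_sum v W \<kappa> 0"
    if "effective_below \<kappa> (insert v J) \<xi>" for \<kappa> \<xi>
  proof -
    have "subtree_sum v W (dual_codeg \<kappa>) {..<0} = 0"
      by (rule subtree_sum_eq_0[OF W(1,3) effective_below_dual_codeg(1)[OF that]])
         (use effective_below_dual_codeg(2,3)[OF that] in auto)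
    then show ?thesis using state_sum_pinned[OF W that] by (simp add: balanced_sum_def[OF W(1)])
  qed
  then show ?thesis unfolding reciprocal_def
    using balanced_sum_dual_codeg[OF W(1)] quasi_poly_balanced_sum[OF W(1)]
    by (intro exI[of _ "\<lambda>\<kappa>. balanced_sum v W \<kappa> 0"]) blast
qed

definition region_sum :: "('v \<Rightarrow> int) set \<Rightarrow> ('v \<Rightarrow> int) \<Rightarrow> real" where
  "region_sum A \<kappa> = (\<Sum>\<^sub>\<infinity>l\<in>A. total_weight \<kappa> l)"

lemma summable_total_weight:
  assumes "A \<subseteq> {l. \<exists>v\<in>I. l v < 0}"
  shows "total_weight \<kappa> summable_on A"
proof (rule summable_on_finite_support)
  have "{l \<in> A. total_weight \<kappa> l \<noteq> 0} \<subseteq> (\<Union>v. {l. l v \<le> 0 \<and> total_weight \<kappa> l \<noteq> 0})"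
    using assms by (force intro: less_imp_le)
  then show "finite {l \<in> A. total_weight \<kappa> l \<noteq> 0}"
    by (rule finite_subset) (simp add: finite_total_weight)
qed

lemma region_sum_Un:
  assumes "A \<subseteq> {l. \<exists>v. l v < 0}" "B \<subseteq> {l. \<exists>v. l v < 0}"
  shows "region_sum (A \<union> B) \<kappa> = region_sum A \<kappa> + region_sum B \<kappa> - region_sum (A \<inter> B) \<kappa>"
  unfolding region_sum_def
  by (rule infsum_Un_Int) (use assms in \<open>auto intro!: summable_total_weight[of _ UNIV]\<close>)

definition somewhere_neg :: "'v set \<Rightarrow> ('v \<Rightarrow> int) set" where
  "somewhere_neg I = {l. \<exists>v\<in>I. l v < 0}"

definition everywhere_neg :: "'v set \<Rightarrow> ('v \<Rightarrow> int) set" where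
  "everywhere_neg I = {l. \<forall>v\<in>I. l v < 0}"

lemma reciprocal_somewhere_neg: "reciprocal I (region_sum (somewhere_neg I))"
proof -
  have "finite I" by simp
  then show ?thesis
  proof (induction I rule: finite_induct)
    case empty
    have "region_sum (somewhere_neg {}) = (\<lambda>_. 0)" by (auto simp: region_sum_def somewhere_neg_def)
    then show ?case using reciprocal_0 by simp
  next
    case (insert v J)
    have "region_sum (somewhere_neg (insert v J)) \<kappa> = region_sum (somewhere_neg J) \<kappa> +
        1 * tree.state_sum v (pinned v J) UNIV 0 (vertex_ramp \<kappa>)" for \<kappa>
    proof -
      have c: "configs (pinned v J) UNIV = {l. l v < 0 \<and> (\<forall>u\<in>J. 0 \<le> l u)}"
        using insert(2) by (auto simp: configs_def pinned_def)
      have "somewhere_neg (insert v J) = somewhere_neg J \<union> configs (pinned v J) UNIV"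
        and "somewhere_neg J \<inter> configs (pinned v J) UNIV = {}"
        unfolding c somewhere_neg_def by (auto simp: not_less[symmetric])
      then have "region_sum (somewhere_neg (insert v J)) \<kappa> =
          region_sum (somewhere_neg J) \<kappa> + region_sum (configs (pinned v J) UNIV) \<kappa> - region_sum {} \<kappa>"
        using region_sum_Un[of "somewhere_neg J" "configs (pinned v J) UNIV" \<kappa>]
        by (auto simp: somewhere_neg_def c)
      then show ?thesis by (simp add: region_sum_def tree.state_sum_def total_weight_eq[of _ _ v])
    qed
    then have "region_sum (somewhere_neg (insert v J)) = (\<lambda>\<kappa>. region_sum (somewhere_neg J) \<kappa> +
        1 * tree.state_sum v (pinned v J) UNIV 0 (vertex_ramp \<kappa>))" by blast
    then show ?case
      using reciprocal_combine[OF insert.IH reciprocal_pinned[OF insert(2)], of "insert v J" 1] by auto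
  qed
qed

text \<open>
  Inclusion-exclusion in inductive form: intersecting with \<open>l\<^sub>v < 0\<close> is expressed through unions.
\<close>

lemma reciprocal_mixed: "reciprocal (I \<union> J) (region_sum (everywhere_neg I \<inter> somewhere_neg J))"
proof -
  have "finite I" by simp
  then show ?thesis
  proof (induction I arbitrary: J rule: finite_induct)
    case empty
    have "everywhere_neg {} \<inter> somewhere_neg J = somewhere_neg J" by (auto simp: everywhere_neg_def)
    then show ?case using reciprocal_somewhere_neg by simp
  next
    case (insert v I)
    let ?T = "\<lambda>J. everywhere_neg I \<inter> somewhere_neg J"
    have "region_sum (everywhere_neg (insert v I) \<inter> somewhere_neg J) \<kappa> =
       (region_sum (?T {v}) \<kappa> + 1 * region_sum (?T J) \<kappa>) + (- 1) * region_sum (?T (insert v J)) \<kappa>" for \<kappa>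
    proof -
      have "?T {v} \<inter> ?T J = everywhere_neg (insert v I) \<inter> somewhere_neg J"
        and "?T {v} \<union> ?T J = ?T (insert v J)"
        by (auto simp: everywhere_neg_def somewhere_neg_def)
      moreover have "?T K \<subseteq> {l. \<exists>v. l v < 0}" for K by (auto simp: somewhere_neg_def)
      ultimately show ?thesis using region_sum_Un[of "?T {v}" "?T J" \<kappa>] by simp
    qed
    then have e: "region_sum (everywhere_neg (insert v I) \<inter> somewhere_neg J) = (\<lambda>\<kappa>.
       (region_sum (?T {v}) \<kappa> + 1 * region_sum (?T J) \<kappa>) + (- 1) * region_sum (?T (insert v J)) \<kappa>)" by blast
    have "reciprocal (insert v I \<union> J) (\<lambda>\<kappa>. region_sum (?T {v}) \<kappa> + 1 * region_sum (?T J) \<kappa>)"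
      by (rule reciprocal_combine[OF insert.IH insert.IH]) auto
    then show ?case unfolding e
      by (rule reciprocal_combine[OF _ insert.IH]) auto
  qed
qed

lemma reciprocal_everywhere_neg:
  assumes "I \<noteq> {}" shows "reciprocal I (region_sum (everywhere_neg I))"
proof -
  obtain v where "v \<in> I" using assms by blast
  then have "everywhere_neg I \<inter> somewhere_neg {v} = everywhere_neg I" and "I \<union> {v} = I"
    by (auto simp: everywhere_neg_def somewhere_neg_def)
  with reciprocal_mixed[of I "{v}"] show ?thesis by simp
qed

end

section \<open>Series coefficients and the discriminant group\<close>

lemma fps_nth_times_one_minus_X:
  "fps_nth (f * (1 - fps_X)) n = fps_nth f n - (if n = 0 then 0 else fps_nth (f :: real fps) (n - 1))"
  by (simp add: right_diff_distrib)

lemma one_minus_X_power_nth: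
  "fps_nth ((1 - fps_X :: real fps) powi (int d - 2)) n = factor_coeff d (int n)"
proof -
  let ?u = "1 - fps_X :: real fps"
  have inv: "inverse ?u * ?u = 1" by (rule inverse_mult_eq_1) simp
  have step: "?u powi (int (Suc d) - 2) = ?u powi (int d - 2) * ?u" for d
  proof -
    consider "d = 0" | "d = 1" | k where "d = Suc (Suc k)" by (metis One_nat_def not0_implies_Suc)
    then show ?thesis
    proof cases
      case 1
      have "inverse ?u ^ 2 * ?u = inverse ?u" using inv by (simp add: power2_eq_square mult.assoc)
      with 1 show ?thesis by (simp add: power_int_def)
    next
      case 2
      with inv show ?thesis by (simp add: power_int_def)
    next
      case 3
      then show ?thesis by (simp add: power_int_def nat_add_distrib mult.commute)
    qed
  qed
  have base: "inverse ?u ^ 2 = Abs_fps (\<lambda>n. real n + 1)"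
  proof -
    have "Abs_fps (\<lambda>n. real n + 1) * ?u = Abs_fps (\<lambda>n. 1)"
      by (rule fps_ext) (auto simp: fps_nth_times_one_minus_X)
    moreover have "Abs_fps (\<lambda>n. 1) * ?u = 1"
      by (rule fps_ext) (auto simp: fps_nth_times_one_minus_X)
    ultimately have "Abs_fps (\<lambda>n. real n + 1) * ?u * ?u = 1" by simp
    then have "Abs_fps (\<lambda>n. real n + 1) * ?u * ?u * inverse ?u * inverse ?u = inverse ?u ^ 2"
      by (simp add: power2_eq_square)
    moreover have "Abs_fps (\<lambda>n. real n + 1) * ?u * ?u * inverse ?u * inverse ?u =
        Abs_fps (\<lambda>n. real n + 1) * (inverse ?u * ?u) * (inverse ?u * ?u)"
      by (simp only: mult_ac)
    ultimately show ?thesis unfolding inv by simp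
  qed
  show ?thesis
  proof (induction d arbitrary: n)
    case 0
    then show ?case by (simp add: power_int_def base factor_coeff_def)
  next
    case (Suc d)
    have "factor_coeff (Suc d) (int n) = factor_coeff d (int n) - factor_coeff d (int n - 1)"
      by (simp add: factor_coeff_def bdiff_def)
    then show ?case
      unfolding step fps_nth_times_one_minus_X Suc
      by (cases n) (auto simp: factor_coeff_neg)
  qed
qed

text \<open>
  Two multiples of \<open>d\<close> lie in the same coset.
\<close>

lemma finite_index_multiple:
  fixes d :: "'a :: real_normed_vector"
  assumes MN: "finite_index_sublattice M N" and N: "\<And>i::nat. of_nat i *\<^sub>R d \<in> N"
  shows "\<exists>m>0. of_nat m *\<^sub>R d \<in> M"
proof -
  interpret subgroup M "add_group N" using MN by (simp add: finite_index_sublattice_def)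
  have "range (\<lambda>i::nat. M #>\<^bsub>add_group N\<^esub> (of_nat i *\<^sub>R d)) \<subseteq> rcosets\<^bsub>add_group N\<^esub> M"
    using N by (auto simp: RCOSETS_def add_group_def)
  then have "finite (range (\<lambda>i::nat. M #>\<^bsub>add_group N\<^esub> (of_nat i *\<^sub>R d)))"
    using MN by (auto simp: finite_index_sublattice_def intro: finite_subset)
  then have "\<not> inj (\<lambda>i::nat. M #>\<^bsub>add_group N\<^esub> (of_nat i *\<^sub>R d))"
    using finite_imageD infinite_UNIV_nat by blast
  then obtain i j :: nat where ij: "i < j" "M #>\<^bsub>add_group N\<^esub> (of_nat i *\<^sub>R d) = M #>\<^bsub>add_group N\<^esub> (of_nat j *\<^sub>R d)"
    unfolding inj_def by (metis linorder_neqE_nat)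
  have "0 \<in> M" using one_closed by (simp add: add_group_def)
  then have "of_nat j *\<^sub>R d \<in> M #>\<^bsub>add_group N\<^esub> (of_nat j *\<^sub>R d)"
    by (force simp: r_coset_def add_group_def)
  then have "of_nat j *\<^sub>R d \<in> M #>\<^bsub>add_group N\<^esub> (of_nat i *\<^sub>R d)" using ij by simp
  then obtain m where m: "m \<in> M" "of_nat j *\<^sub>R d = m + of_nat i *\<^sub>R d"
    by (auto simp: r_coset_def add_group_def)
  then have "of_nat (j - i) *\<^sub>R d = m" using ij by (simp add: of_nat_diff scaleR_diff_left)
  with m ij show ?thesis by (intro exI[of _ "j - i"]) auto
qed

lemma add_group_simps: "carrier (add_group A) = A" "x \<otimes>\<^bsub>add_group A\<^esub> y = x + y" "\<one>\<^bsub>add_group A\<^esub> = 0"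
  by (simp_all add: add_group_def)

lemma comm_group_add_group:
  assumes "0 \<in> A" "\<And>x y. x \<in> A \<Longrightarrow> y \<in> A \<Longrightarrow> x - y \<in> A"
  shows "comm_group (add_group A)"
proof (rule comm_groupI)
  fix x y assume "x \<in> carrier (add_group A)" "y \<in> carrier (add_group A)"
  then show "x \<otimes>\<^bsub>add_group A\<^esub> y \<in> carrier (add_group A)"
    using assms(2)[of x "0 - y"] assms(2)[OF assms(1), of y] by (simp add: add_group_simps)
next
  fix x assume "x \<in> carrier (add_group A)"
  then show "\<exists>y\<in>carrier (add_group A). y \<otimes>\<^bsub>add_group A\<^esub> x = \<one>\<^bsub>add_group A\<^esub>"
    using assms(2)[OF assms(1), of x] by (intro bexI[of _ "- x"]) (auto simp: add_group_simps)
qed (auto simp: add_group_simps assms(1) add.assoc add.commute)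

lemma inv_add_group:
  assumes "0 \<in> A" "\<And>x y. x \<in> A \<Longrightarrow> y \<in> A \<Longrightarrow> x - y \<in> A" "x \<in> A"
  shows "inv\<^bsub>add_group A\<^esub> x = - x"
  using assms(2)[OF assms(1,3)] assms(3)
  by (intro group.inv_equality[OF comm_group.axioms(2)[OF comm_group_add_group[OF assms(1,2)]]])
    (auto simp: add_group_simps)

lemma subgroup_add_group:
  assumes A: "0 \<in> A" "\<And>x y. x \<in> A \<Longrightarrow> y \<in> A \<Longrightarrow> x - y \<in> A"
    and M: "M \<subseteq> A" "0 \<in> M" "\<And>x y. x \<in> M \<Longrightarrow> y \<in> M \<Longrightarrow> x - y \<in> M"
  shows "subgroup M (add_group A)"
proof (rule group.subgroupI[OF comm_group.axioms(2)[OF comm_group_add_group[OF A]]])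
  fix x y assume xy: "x \<in> M"
  show "inv\<^bsub>add_group A\<^esub> x \<in> M"
    using M(3)[OF M(2) xy] subsetD[OF M(1) xy] inv_add_group[OF A] by simp
  assume "y \<in> M"
  then show "x \<otimes>\<^bsub>add_group A\<^esub> y \<in> M"
    using M(3)[OF xy, of "0 - y"] M(3)[OF M(2), of y] by (simp add: add_group_simps)
qed (use M in \<open>auto simp: add_group_simps\<close>)

lemma subgroup_add_groupD:
  assumes "subgroup M (add_group N)"
  shows "M \<subseteq> N" "0 \<in> M" "a \<in> M \<Longrightarrow> b \<in> M \<Longrightarrow> a + b \<in> M"
  using subgroup.subset[OF assms] subgroup.one_closed[OF assms] subgroup.m_closed[OF assms, of a b]
  by (auto simp: add_group_def)

lemma subgroup_nat_multiple:
  fixes a :: "'a :: real_normed_vector"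
  assumes "subgroup M (add_group N)" "a \<in> M" shows "of_nat n *\<^sub>R a \<in> M"
  by (induction n) (use assms subgroup_add_groupD in \<open>auto simp: scaleR_add_left\<close>)

lemma real_polynomial_eq_0:
  fixes f :: "real \<Rightarrow> real"
  assumes "real_polynomial_function f" "\<And>t::nat. T \<le> t \<Longrightarrow> f (of_nat t) = 0"
  shows "f x = 0"
proof -
  obtain a n where f: "f = (\<lambda>x. \<Sum>i\<le>n. a i * x ^ i)"
    using assms(1) by (auto simp: real_polynomial_function_iff_sum)
  have "infinite {x. (\<Sum>i\<le>n. a i * x ^ i) = 0}"
  proof
    assume "finite {x. (\<Sum>i\<le>n. a i * x ^ i) = 0}"
    moreover have "of_nat ` {T..} \<subseteq> {x. (\<Sum>i\<le>n. a i * x ^ i) = 0}"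
      using assms(2) f by (auto simp: fun_eq_iff)
    ultimately have "finite (of_nat ` {T..} :: real set)" by (rule finite_subset[rotated])
    then have "finite {T..}" by (rule finite_imageD) (simp add: inj_on_def)
    then show False by (simp add: infinite_Ici)
  qed
  then have "\<forall>i\<le>n. a i = 0" unfolding polyfun_finite_roots by simp
  then show ?thesis by (simp add: f)
qed

context plumbing
begin

definition ivec :: "('v \<Rightarrow> int) \<Rightarrow> real ^ 'v" where
  "ivec e = (\<chi> u. of_int (e u))"

definition vcodeg :: "real ^ 'v \<Rightarrow> 'v \<Rightarrow> real" where
  "vcodeg x = codeg UNIV (\<lambda>u. x $ u)"

lemma int_form_E_curve: "int_form G x (E_curve w) = - vcodeg x w"
  by (simp add: int_form_axis vcodeg_def)

lemma vcodeg_simps [simp]: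
  "vcodeg (x + y) w = vcodeg x w + vcodeg y w" "vcodeg (x - y) w = vcodeg x w - vcodeg y w"
  "vcodeg (c *\<^sub>R x) w = c * vcodeg x w" "vcodeg 0 w = 0"
  by (simp_all add: vcodeg_def codeg_add codeg_diff codeg_scale) (simp add: codeg_def)

lemma vcodeg_sum: "vcodeg (\<Sum>a\<in>A. f a) w = (\<Sum>a\<in>A. vcodeg (f a) w)"
  by (simp add: vcodeg_def codeg_sum)

lemma vcodeg_ivec: "vcodeg (ivec e) w = of_int (codeg UNIV e w)"
  by (simp add: ivec_def vcodeg_def codeg_of_int)

lemma vcodeg_inject: "(\<And>w. vcodeg x w = vcodeg y w) \<Longrightarrow> x = y"
proof -
  assume "\<And>w. vcodeg x w = vcodeg y w"
  then have "codeg UNIV (\<lambda>u. x $ u - y $ u) w = 0" for w by (simp add: vcodeg_def codeg_diff)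
  then have "x $ u - y $ u = 0" for u using codeg_eq_0_imp[of UNIV "\<lambda>u. x $ u - y $ u"] by blast
  then show ?thesis by (simp add: vec_eq_iff)
qed

lemma lat_eq_range: "lat = range ivec"
proof
  show "lat \<subseteq> range ivec"
  proof
    fix x :: "real ^ 'v" assume "x \<in> lat"
    then have "x = ivec (\<lambda>u. \<lfloor>x $ u\<rfloor>)" by (auto simp: lat_def ivec_def vec_eq_iff elim!: Ints_cases)
    then show "x \<in> range ivec" by blast
  qed
qed (auto simp: lat_def ivec_def)

text \<open>
  Rationality of the coordinates is a consequence of integral codegrees, by Cramer's rule.
\<close>

lemma dual_lat_iff: "x \<in> dual_lat G \<longleftrightarrow> (\<forall>w. vcodeg x w \<in> \<int>)"
proof
  assume x: "x \<in> dual_lat G"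
  show "\<forall>w. vcodeg x w \<in> \<int>"
  proof
    fix w
    have "E_curve w \<in> (lat :: (real ^ 'v) set)" by (simp add: lat_def axis_def)
    then have "int_form G x (E_curve w) \<in> \<int>" using x by (auto simp: dual_lat_def)
    then have "- (- vcodeg x w) \<in> \<int>" unfolding int_form_E_curve by (rule Ints_minus)
    then show "vcodeg x w \<in> \<int>" by simp
  qed
next
  assume x: "\<forall>w. vcodeg x w \<in> \<int>"
  obtain z :: "'v \<Rightarrow> real" where z: "\<And>w. codeg UNIV z w = vcodeg x w"
    "\<And>w. det (codeg_matrix UNIV) * z w \<in> \<int>"
    by (rule codeg_solution[of UNIV "vcodeg x"]) (use x in auto)
  have "(\<chi> u. z u) = x" by (rule vcodeg_inject) (simp add: vcodeg_def z(1)[unfolded vcodeg_def])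
  then have z': "z w = x $ w" for w by (auto simp: vec_eq_iff)
  have "x $ w \<in> \<rat>" for w
  proof -
    have "det (codeg_matrix UNIV) \<in> \<rat>"
      using det_in_Ints[OF codeg_matrix_Ints] Ints_subset_Rats by blast
    moreover have "det (codeg_matrix UNIV) * x $ w \<in> \<rat>"
      using z(2)[of w] Ints_subset_Rats by (auto simp: z')
    ultimately have "det (codeg_matrix UNIV) * x $ w / det (codeg_matrix UNIV) \<in> \<rat>" by (rule Rats_divide[rotated])
    then show ?thesis using det_codeg_matrix by simp
  qed
  moreover have "int_form G x y \<in> \<int>" if "y \<in> lat" for y
    unfolding int_form_sum using that x by (intro Ints_minus Ints_sum Ints_mult) (auto simp: lat_def vcodeg_def)
  ultimately show "x \<in> dual_lat G" by (auto simp: dual_lat_def)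
qed

lemma exists_dual_element:
  "\<exists>!x. x \<in> dual_lat G \<and> (\<forall>w. vcodeg x w = of_int (b w))"
proof -
  obtain z :: "'v \<Rightarrow> real" where z: "\<And>w. codeg UNIV z w = of_int (b w)"
    by (rule codeg_solution[of UNIV "\<lambda>w. of_int (b w)"]) auto
  show ?thesis
  proof (rule ex1I[of _ "\<chi> u. z u"])
    show "(\<chi> u. z u) \<in> dual_lat G \<and> (\<forall>w. vcodeg (\<chi> u. z u) w = of_int (b w))"
      by (simp add: dual_lat_iff vcodeg_def z)
    show "x = (\<chi> u. z u)" if "x \<in> dual_lat G \<and> (\<forall>w. vcodeg x w = of_int (b w))" for x
      by (rule vcodeg_inject) (use that z in \<open>simp add: vcodeg_def\<close>)
  qed
qed

lemma dual_vec: "dual_vec G u \<in> dual_lat G" "vcodeg (dual_vec G u) w = (if u = w then 1 else 0)"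
proof -
  have "dual_vec G u = (THE x. x \<in> dual_lat G \<and> (\<forall>w. vcodeg x w = of_int (if u = w then 1 else 0)))"
    unfolding dual_vec_def int_form_E_curve
    by (rule arg_cong[of _ _ The]) (auto simp: fun_eq_iff split: if_splits)
  with theI'[OF exists_dual_element, of "\<lambda>w. if u = w then 1 else 0"]
  show "dual_vec G u \<in> dual_lat G" "vcodeg (dual_vec G u) w = (if u = w then 1 else 0)" by auto
qed

lemma vcodeg_E_curve: "vcodeg (E_curve w) w = - of_int (self_int G w)"
proof -
  have "(\<Sum>u\<in>nbrs E UNIV w. E_curve w $ u :: real) = 0"
    by (rule sum.neutral) (auto simp: axis_def nbrs_def E_irrefl)
  then show ?thesis by (simp add: vcodeg_def codeg_def axis_def)
qed

lemma Z_K: "Z_K G \<in> dual_lat G" "vcodeg (Z_K G) w = - of_int (self_int G w) - 2"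
proof -
  have "Z_K G = (THE x. x \<in> dual_lat G \<and> (\<forall>w. vcodeg x w = of_int (- self_int G w - 2)))"
    unfolding Z_K_def int_form_E_curve vcodeg_E_curve
  proof (rule arg_cong[of _ _ The], rule ext)
    fix x
    have "- vcodeg x v = - (- of_int (self_int G v)) + 2 \<longleftrightarrow> vcodeg x v = of_int (- self_int G v - 2)" for v
      by auto
    then show "(x \<in> dual_lat G \<and> (\<forall>v. - vcodeg x v = - (- of_int (self_int G v)) + 2)) =
      (x \<in> dual_lat G \<and> (\<forall>w. vcodeg x w = of_int (- self_int G w - 2)))" by simp
  qed
  with theI'[OF exists_dual_element, of "\<lambda>w. - self_int G w - 2"]
  show "Z_K G \<in> dual_lat G" "vcodeg (Z_K G) w = - of_int (self_int G w) - 2" by auto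
qed

lemma dual_lat_closed:
  "x \<in> dual_lat G \<Longrightarrow> y \<in> dual_lat G \<Longrightarrow> x + y \<in> dual_lat G"
  "x \<in> dual_lat G \<Longrightarrow> y \<in> dual_lat G \<Longrightarrow> x - y \<in> dual_lat G"
  "x \<in> lat \<Longrightarrow> x \<in> dual_lat G"
  by (auto simp: dual_lat_iff lat_eq_range vcodeg_ivec)

lemma lat_closed: "x \<in> lat \<Longrightarrow> y \<in> lat \<Longrightarrow> x + y \<in> (lat :: (real ^ 'v) set)"
  "x \<in> lat \<Longrightarrow> y \<in> lat \<Longrightarrow> x - y \<in> (lat :: (real ^ 'v) set)" "0 \<in> (lat :: (real ^ 'v) set)"
  by (auto simp: lat_def)

text \<open>
  On \<open>L'\<close> the codegrees are integers, and the floor only changes their type.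
\<close>

definition int_codeg :: "real ^ 'v \<Rightarrow> 'v \<Rightarrow> int" where
  "int_codeg x w = \<lfloor>vcodeg x w\<rfloor>"

lemma of_int_int_codeg: "x \<in> dual_lat G \<Longrightarrow> of_int (int_codeg x w) = vcodeg x w"
  by (auto simp: dual_lat_iff int_codeg_def elim!: Ints_cases dest!: spec[of _ w])

lemma int_codeg_add_ivec: "int_codeg (x + ivec e) = (\<lambda>w. int_codeg x w + codeg UNIV e w)"
  by (auto simp: int_codeg_def vcodeg_ivec)

lemma int_codeg_dual_codeg:
  assumes "x \<in> dual_lat G" shows "int_codeg (Z_K G - x) = dual_codeg (int_codeg x)"
proof
  fix w
  have "real_of_int (int_codeg (Z_K G - x) w) = of_int (dual_codeg (int_codeg x) w)"
    using assms by (simp add: of_int_int_codeg dual_lat_closed Z_K dual_codeg_def)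
  then show "int_codeg (Z_K G - x) w = dual_codeg (int_codeg x) w" by (simp only: of_int_eq_iff)
qed

lemma dual_basis_expansion: "(\<Sum>u\<in>UNIV. c u *\<^sub>R dual_vec G u) = x \<longleftrightarrow> (\<forall>w. c w = vcodeg x w)"
proof -
  have "vcodeg (\<Sum>u\<in>UNIV. c u *\<^sub>R dual_vec G u) w = c w" for w
    by (simp add: vcodeg_sum dual_vec if_distrib cong: if_cong del: sum_component)
  then show ?thesis using vcodeg_inject[of "\<Sum>u\<in>UNIV. c u *\<^sub>R dual_vec G u" x] by metis
qed

lemma zcoeff_eq:
  assumes x: "x \<in> dual_lat G"
  shows "zcoeff G x = (\<Prod>w\<in>UNIV. factor_coeff (val G w) (int_codeg x w))"
proof -
  have S: "(\<Sum>v\<in>UNIV. real (n v) *\<^sub>R dual_vec G v) = x \<longleftrightarrow> (\<forall>w. int (n w) = int_codeg x w)" for n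
    unfolding dual_basis_expansion of_int_int_codeg[OF x, symmetric] by (metis of_int_eq_iff of_int_of_nat_eq)
  show ?thesis
  proof (cases "\<forall>w. 0 \<le> int_codeg x w")
    case True
    then have "{n. (\<Sum>v\<in>UNIV. real (n v) *\<^sub>R dual_vec G v) = x} = {\<lambda>w. nat (int_codeg x w)}"
      unfolding S by (auto simp: fun_eq_iff) (metis nat_int)
    with True show ?thesis by (simp add: zcoeff_def one_minus_X_power_nth)
  next
    case False
    then obtain w where w: "int_codeg x w < 0" by (auto simp: not_le)
    then have "{n. (\<Sum>v\<in>UNIV. real (n v) *\<^sub>R dual_vec G v) = x} = {}"
      unfolding S by (auto intro!: exI[of _ w])
    moreover have "(\<Prod>w\<in>UNIV. factor_coeff (val G w) (int_codeg x w)) = 0"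
      by (rule prod_zero) (use factor_coeff_neg[OF w] in auto)
    ultimately show ?thesis by (simp only: zcoeff_def sum.empty)
  qed
qed

lemma zcoeff_translate:
  "x \<in> dual_lat G \<Longrightarrow> zcoeff G (x + ivec e) = total_weight (int_codeg x) e"
  by (subst zcoeff_eq) (auto simp: dual_lat_closed lat_eq_range int_codeg_add_ivec total_weight_def)

lemma cls_eq: "cls G x = {y. y - x \<in> lat}"
proof -
  have "cls G x = {a + x | a. a \<in> lat}" by (auto simp: cls_def r_coset_def add_group_def)
  also have "\<dots> = {y. y - x \<in> lat}" by force
  finally show ?thesis .
qed

lemma cls_eq_iff: "cls G x = cls G y \<longleftrightarrow> x - y \<in> lat"
proof
  assume "cls G x = cls G y"
  moreover have "x \<in> cls G x" by (simp add: cls_eq lat_closed)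
  ultimately show "x - y \<in> lat" by (simp add: cls_eq)
next
  assume xy: "x - y \<in> lat"
  have "z - x \<in> lat \<longleftrightarrow> z - y \<in> lat" for z
    using lat_closed(1)[OF _ xy, of "z - x"] lat_closed(2)[OF _ xy, of "z - y"] by auto
  then show "cls G x = cls G y" by (simp add: cls_eq)
qed

lemma inv_dual_lat: "x \<in> dual_lat G \<Longrightarrow> inv\<^bsub>add_group (dual_lat G)\<^esub> x = - x"
  by (rule inv_add_group[OF dual_lat_closed(3)[OF lat_closed(3)] dual_lat_closed(2)])

lemma normal_lat: "lat \<lhd> add_group (dual_lat G)"
proof (rule comm_group.subgroup_imp_normal)
  note closed = dual_lat_closed(3)[OF lat_closed(3)] dual_lat_closed(2)
  show "comm_group (add_group (dual_lat G))" by (rule comm_group_add_group[OF closed])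
  show "subgroup lat (add_group (dual_lat G))"
    by (rule subgroup_add_group[OF closed]) (use dual_lat_closed(3) lat_closed(2,3) in auto)
qed

lemma disc_carrier: "h \<in> carrier (disc_group G) \<longleftrightarrow> (\<exists>x\<in>dual_lat G. h = cls G x)"
  by (auto simp: disc_group_def FactGroup_def RCOSETS_def cls_def add_group_def)

lemma disc_mult:
  assumes "x \<in> dual_lat G" "y \<in> dual_lat G"
  shows "cls G x \<otimes>\<^bsub>disc_group G\<^esub> cls G y = cls G (x + y)"
  using normal.rcos_sum[OF normal_lat, of x y] assms
  by (simp add: disc_group_def FactGroup_def cls_def add_group_def)

lemma disc_inv:
  assumes "x \<in> dual_lat G" shows "inv\<^bsub>disc_group G\<^esub> (cls G x) = cls G (- x)"
proof -
  have "cls G x \<in> carrier (add_group (dual_lat G) Mod lat)" using disc_carrier[of "cls G x"] assms by (auto simp: disc_group_def)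
  then have "inv\<^bsub>disc_group G\<^esub> (cls G x) = set_inv\<^bsub>add_group (dual_lat G)\<^esub> (cls G x)"
    unfolding disc_group_def by (rule normal.inv_FactGroup[OF normal_lat])
  also have "\<dots> = lat #>\<^bsub>add_group (dual_lat G)\<^esub> (inv\<^bsub>add_group (dual_lat G)\<^esub> x)"
    unfolding cls_def by (rule normal.rcos_inv[OF normal_lat]) (use assms in \<open>simp add: add_group_def\<close>)
  finally show ?thesis unfolding inv_dual_lat[OF assms] cls_def .
qed

lemma disc_diff_cls:
  assumes "x \<in> dual_lat G" "y \<in> dual_lat G"
  shows "disc_diff G (cls G x) (cls G y) = cls G (x - y)"
proof -
  have "- y \<in> dual_lat G" using dual_lat_closed(2)[of 0 y] dual_lat_closed(3)[OF lat_closed(3)] assms by simp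
  then show ?thesis using assms by (simp add: disc_inv disc_mult)
qed

lemma repr_cls:
  assumes "x \<in> dual_lat G"
  shows "repr G (cls G x) \<in> dual_lat G" "cls G (repr G (cls G x)) = cls G x"
    "0 \<le> repr G (cls G x) $ v" "repr G (cls G x) $ v < 1"
proof -
  have "\<exists>!r. r \<in> dual_lat G \<and> cls G r = cls G x \<and> (\<forall>v. 0 \<le> r $ v \<and> r $ v < 1)"
  proof (rule ex1I[of _ "x - ivec (\<lambda>v. \<lfloor>x $ v\<rfloor>)"])
    have "ivec (\<lambda>v. \<lfloor>x $ v\<rfloor>) \<in> lat" by (simp add: lat_eq_range)
    moreover from this have "- ivec (\<lambda>v. \<lfloor>x $ v\<rfloor>) \<in> lat" using lat_closed(2)[OF lat_closed(3)] by force
    ultimately show "x - ivec (\<lambda>v. \<lfloor>x $ v\<rfloor>) \<in> dual_lat G \<and> cls G (x - ivec (\<lambda>v. \<lfloor>x $ v\<rfloor>)) = cls G x \<and>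
       (\<forall>v. 0 \<le> (x - ivec (\<lambda>v. \<lfloor>x $ v\<rfloor>)) $ v \<and> (x - ivec (\<lambda>v. \<lfloor>x $ v\<rfloor>)) $ v < 1)"
      using assms by (auto simp: dual_lat_closed cls_eq_iff) (auto simp: ivec_def; linarith)+
    fix r assume r: "r \<in> dual_lat G \<and> cls G r = cls G x \<and> (\<forall>v. 0 \<le> r $ v \<and> r $ v < 1)"
    then obtain e where e: "r - x = ivec e" by (auto simp: cls_eq_iff lat_eq_range)
    have "r $ v = x $ v - of_int \<lfloor>x $ v\<rfloor>" for v
    proof -
      have "r $ v = x $ v + of_int (e v)" using arg_cong[OF e, of "\<lambda>z. z $ v"] by (simp add: ivec_def)
      moreover have "0 \<le> r $ v" "r $ v < 1" using r by auto
      ultimately have "\<lfloor>x $ v\<rfloor> = - e v" by linarith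
      with \<open>r $ v = x $ v + of_int (e v)\<close> show ?thesis by simp
    qed
    then show "r = x - ivec (\<lambda>v. \<lfloor>x $ v\<rfloor>)" by (simp add: vec_eq_iff ivec_def)
  qed
  from theI'[OF this]
  show "repr G (cls G x) \<in> dual_lat G" "cls G (repr G (cls G x)) = cls G x"
    "0 \<le> repr G (cls G x) $ v" "repr G (cls G x) $ v < 1"
    unfolding repr_def by auto
qed

end

section \<open>Uniqueness of quasi-polynomials and the counting functions\<close>

context plumbing
begin

lemma lat_on_iff: "l \<in> lat_on I \<longleftrightarrow> l \<in> lat \<and> (\<forall>v. v \<notin> I \<longrightarrow> l $ v = 0)" for l :: "real ^ 'v"
proof
  assume "l \<in> lat_on I"
  then show "l \<in> lat \<and> (\<forall>v. v \<notin> I \<longrightarrow> l $ v = 0)" by (auto simp: lat_on_def lat_def proj_def)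
next
  assume l: "l \<in> lat \<and> (\<forall>v. v \<notin> I \<longrightarrow> l $ v = 0)"
  then have "l = proj I l" by (simp add: proj_def vec_eq_iff)
  with l show "l \<in> lat_on I" unfolding lat_on_def by blast
qed

lemma proj_nth [simp]: "proj I x $ v = (if v \<in> I then x $ v else 0)" for x :: "real ^ 'v"
  by (simp add: proj_def)

lemma proj_lat: "x \<in> lat \<Longrightarrow> proj I x \<in> lat_on I" for x :: "real ^ 'v"
  by (simp add: lat_on_def)

lemma lat_on_lat: "l \<in> lat_on I \<Longrightarrow> l \<in> lat" for l :: "real ^ 'v"
  by (simp add: lat_on_iff)

lemma subgroup_scaled_lat_on:
  "subgroup ((\<lambda>l :: real ^ 'v. of_int k *\<^sub>R l) ` lat_on I) (add_group (lat_on I))"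
proof (rule subgroup_add_group)
  let ?M = "(\<lambda>l :: real ^ 'v. of_int k *\<^sub>R l) ` lat_on I"
  show diff: "x - y \<in> lat_on I" if "x \<in> lat_on I" "y \<in> lat_on I" for x y :: "real ^ 'v"
    using that by (auto simp: lat_on_iff lat_def)
  show zero: "0 \<in> (lat_on I :: (real ^ 'v) set)" by (auto simp: lat_on_iff lat_def)
  then show "0 \<in> ?M" by (intro image_eqI[of _ _ 0]) auto
  show "?M \<subseteq> lat_on I" by (auto simp: lat_on_iff lat_def)
  show "x - y \<in> ?M" if "x \<in> ?M" "y \<in> ?M" for x y
    using that diff by (auto simp flip: scaleR_diff_right)
qed

lemma finite_index_scaled:
  assumes "k > 0"
  shows "finite_index_sublattice ((\<lambda>l :: real ^ 'v. of_int k *\<^sub>R l) ` lat_on I) (lat_on I)"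
proof -
  let ?M = "(\<lambda>l :: real ^ 'v. of_int k *\<^sub>R l) ` lat_on I"
  let ?c = "\<lambda>a. ?M #>\<^bsub>add_group (lat_on I)\<^esub> a"
  have c: "?c a = {m + a | m. m \<in> ?M}" for a by (auto simp: r_coset_def add_group_def)
  let ?R = "{e :: 'v \<Rightarrow> int. \<forall>v. e v \<in> {0..<k}}"
  have "rcosets\<^bsub>add_group (lat_on I)\<^esub> ?M \<subseteq> (\<lambda>e. ?c (ivec e)) ` ?R"
  proof
    fix C assume "C \<in> rcosets\<^bsub>add_group (lat_on I)\<^esub> ?M"
    then obtain a where a: "a \<in> lat_on I" "C = ?c a" by (auto simp: RCOSETS_def add_group_def)
    then obtain e where e: "a = ivec e" using lat_on_lat lat_eq_range by blast
    define r where "r = (\<lambda>v. e v mod k)"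
    define q where "q = ivec (\<lambda>v. e v div k)"
    have e0: "e v = 0" if "v \<notin> I" for v using a(1) that e by (simp add: lat_on_iff ivec_def)
    have q: "q \<in> lat_on I" using e0 by (auto simp: lat_on_iff lat_eq_range q_def) (simp add: ivec_def)
    have split: "a = of_int k *\<^sub>R q + ivec r"
      unfolding e q_def r_def ivec_def vec_eq_iff
      by (simp flip: of_int_mult of_int_add)
    have "m + of_int k *\<^sub>R q \<in> ?M" "m - of_int k *\<^sub>R q \<in> ?M" if "m \<in> ?M" for m
    proof -
      obtain b where b: "b \<in> lat_on I" "m = of_int k *\<^sub>R b" using \<open>m \<in> ?M\<close> by blast
      have "b + q \<in> lat_on I" "b - q \<in> lat_on I" using b q by (auto simp: lat_on_iff lat_def)
      moreover have "m + of_int k *\<^sub>R q = of_int k *\<^sub>R (b + q)" "m - of_int k *\<^sub>R q = of_int k *\<^sub>R (b - q)"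
        using b by (simp_all add: scaleR_add_right scaleR_diff_right)
      ultimately show "m + of_int k *\<^sub>R q \<in> ?M" "m - of_int k *\<^sub>R q \<in> ?M" by blast+
    qed note shift = this
    have "?c a = ?c (ivec r)"
    proof
      show "?c a \<subseteq> ?c (ivec r)"
        unfolding c split using shift(1) by (force simp: add.assoc[symmetric])
      show "?c (ivec r) \<subseteq> ?c a"
      proof
        fix x assume "x \<in> ?c (ivec r)"
        then obtain m where m: "m \<in> ?M" "x = m + ivec r" unfolding c by blast
        then have "x = (m - of_int k *\<^sub>R q) + a" by (simp add: split)
        with shift(2)[OF m(1)] show "x \<in> ?c a" unfolding c by blast
      qed
    qed
    moreover have "r \<in> ?R" using assms by (simp add: r_def)
    ultimately show "C \<in> (\<lambda>e. ?c (ivec e)) ` ?R" using a by blast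
  qed
  moreover have "finite ?R" by (rule finite_int_functions[of ?R 0 k]) (auto intro: less_imp_le)
  ultimately have "finite (rcosets\<^bsub>add_group (lat_on I)\<^esub> ?M)"
    by (meson finite_imageI finite_subset)
  then show ?thesis using subgroup_scaled_lat_on by (simp add: finite_index_sublattice_def)
qed

lemma real_lipman_cone_iff: "z \<in> real_lipman_cone G \<longleftrightarrow> (\<forall>w. 0 \<le> vcodeg z w)"
proof -
  have "z \<in> real_lipman_cone G \<longleftrightarrow> (\<exists>c. (\<Sum>v\<in>UNIV. c v *\<^sub>R dual_vec G v) = z \<and> (\<forall>v. 0 \<le> c v))"
    by (auto simp: real_lipman_cone_def)
  then show ?thesis unfolding dual_basis_expansion by metis
qed

text \<open>
  Restricted to a line through \<open>l\<close> in a direction \<open>d\<close> interior to the cone, with step a common multiple of all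
  periods, both functions are polynomials in one variable.  They agree with \<open>F\<close>, hence with each other, far out on
  the line, so they agree at \<open>l\<close>.
\<close>

lemma quasi_polynomial_unique:
  fixes g g0 F :: "real ^ 'v \<Rightarrow> real"
  assumes N: "finite_index_sublattice N (lat_on I)"
    and g: "quasi_polynomial_in_cone (lipman_proj G I) N F g"
    and g0: "quasi_polynomial_in_cone (lipman_proj G I) (lat_on I) F g0"
    and l: "l \<in> N"
  shows "g l = g0 l"
proof -
  let ?K = "lipman_proj G I"
  obtain M s where M: "finite_index_sublattice M N"
      "\<And>b. b \<in> N \<Longrightarrow> \<exists>p. real_polynomial_function p \<and> (\<forall>x\<in>M. g (b + x) = p (b + x))"
    and s: "s \<in> ?K" "\<And>x. x \<in> (\<lambda>k. s + k) ` ?K \<inter> N \<Longrightarrow> g x = F x"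
    using g unfolding quasi_polynomial_in_cone_def quasi_polynomial_on_def by blast
  obtain M0 s0 where M0: "finite_index_sublattice M0 (lat_on I)"
      "\<And>b. b \<in> lat_on I \<Longrightarrow> \<exists>p. real_polynomial_function p \<and> (\<forall>x\<in>M0. g0 (b + x) = p (b + x))"
    and s0: "s0 \<in> ?K" "\<And>x. x \<in> (\<lambda>k. s0 + k) ` ?K \<inter> lat_on I \<Longrightarrow> g0 x = F x"
    using g0 unfolding quasi_polynomial_in_cone_def quasi_polynomial_on_def by blast
  note sub = N[unfolded finite_index_sublattice_def, THEN conjunct1]
    M(1)[unfolded finite_index_sublattice_def, THEN conjunct1]
    M0(1)[unfolded finite_index_sublattice_def, THEN conjunct1]
  have NL: "N \<subseteq> lat_on I" using subgroup_add_groupD(1)[OF sub(1)] .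
  obtain R :: int and e :: "'v \<Rightarrow> int" where R: "R > 0" "\<And>w. codeg UNIV e w = R"
  proof -
    obtain R :: int where "R > 0"
      and "\<And>b :: 'v \<Rightarrow> int. \<exists>p :: 'v \<Rightarrow> int. (\<forall>w. w \<notin> UNIV \<longrightarrow> p w = 0) \<and> (\<forall>w\<in>UNIV. codeg UNIV p w = R * b w)"
      using integral_multiple_solution[of UNIV] by blast
    from this(2)[of "\<lambda>_. 1"] \<open>R > 0\<close> that show ?thesis by auto
  qed
  define d where "d = proj I (ivec e)"
  have ivec_mult: "of_nat i *\<^sub>R ivec e \<in> lat" for i by (auto simp: lat_def ivec_def)
  have d_mult: "of_nat i *\<^sub>R d \<in> lat_on I" for i
  proof -
    have "of_nat i *\<^sub>R d = proj I (of_nat i *\<^sub>R ivec e)" by (simp add: d_def vec_eq_iff)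
    then show ?thesis using proj_lat[OF ivec_mult] by simp
  qed
  obtain m1 where m1: "m1 > 0" "of_nat m1 *\<^sub>R d \<in> N" using finite_index_multiple[OF N d_mult] by blast
  have "of_nat i *\<^sub>R (of_nat m1 *\<^sub>R d) \<in> N" for i by (rule subgroup_nat_multiple[OF sub(1) m1(2)])
  from finite_index_multiple[OF M(1) this]
  obtain m2 where m2: "m2 > 0" "of_nat m2 *\<^sub>R (of_nat m1 *\<^sub>R d) \<in> M" by blast
  obtain m3 where m3: "m3 > 0" "of_nat m3 *\<^sub>R d \<in> M0" using finite_index_multiple[OF M0(1) d_mult] by blast
  define m where "m = m1 * m2 * m3"
  have "m > 0" using m1 m2 m3 by (simp add: m_def)
  have mM: "of_nat t *\<^sub>R (of_nat m *\<^sub>R d) \<in> M" for t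
    using subgroup_nat_multiple[OF sub(2) m2(2), of "t * m3"] by (simp add: m_def mult_ac)
  have mM0: "of_nat t *\<^sub>R (of_nat m *\<^sub>R d) \<in> M0" for t
    using subgroup_nat_multiple[OF sub(3) m3(2), of "t * m1 * m2"] by (simp add: m_def mult_ac)
  have deep: "\<exists>T. \<forall>t\<ge>T. l + of_nat t *\<^sub>R (of_nat m *\<^sub>R d) \<in> (\<lambda>k. s + k) ` ?K" if s: "s \<in> ?K" for s
  proof -
    obtain s1 where s1: "s = proj I s1" using s by blast
    define T where "T = nat \<lceil>\<Sum>w\<in>UNIV. \<bar>vcodeg (l - s1) w\<bar>\<rceil>"
    have "l + of_nat t *\<^sub>R (of_nat m *\<^sub>R d) \<in> (\<lambda>k. s + k) ` ?K" if t: "T \<le> t" for t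
    proof -
      let ?z = "l - s1 + of_nat t *\<^sub>R (of_nat m *\<^sub>R ivec e)"
      have "0 \<le> vcodeg ?z w" for w
      proof -
        have "\<bar>vcodeg (l - s1) w\<bar> \<le> (\<Sum>w\<in>UNIV. \<bar>vcodeg (l - s1) w\<bar>)" by (rule member_le_sum) auto
        also have "\<dots> \<le> of_nat T" unfolding T_def by (rule real_nat_ceiling_ge)
        also have "\<dots> \<le> of_nat t" using t by simp
        also have "\<dots> \<le> of_nat t * (of_nat m * of_int R)"
        proof -
          have "1 \<le> real m * of_int R" using \<open>m > 0\<close> R(1)
            using mult_mono[of 1 "real m" 1 "real_of_int R"] by simp
          then show ?thesis using mult_left_mono[of 1 "real m * of_int R" "real t"] by simp
        qed
        finally show ?thesis by (simp add: vcodeg_ivec R(2))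
      qed
      then have "?z \<in> real_lipman_cone G" by (simp add: real_lipman_cone_iff)
      moreover have "l + of_nat t *\<^sub>R (of_nat m *\<^sub>R d) = s + proj I ?z"
      proof -
        have "l $ v = 0" if "v \<notin> I" for v
          using NL l that lat_on_iff[of l I] by blast
        then show ?thesis by (simp add: s1 d_def vec_eq_iff)
      qed
      ultimately show ?thesis by blast
    qed
    then show ?thesis by blast
  qed
  obtain T where T: "\<And>t. T \<le> t \<Longrightarrow> l + of_nat t *\<^sub>R (of_nat m *\<^sub>R d) \<in> (\<lambda>k. s + k) ` ?K" using deep[OF s(1)] by blast
  obtain T0 where T0: "\<And>t. T0 \<le> t \<Longrightarrow> l + of_nat t *\<^sub>R (of_nat m *\<^sub>R d) \<in> (\<lambda>k. s0 + k) ` ?K" using deep[OF s0(1)] by blast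
  obtain p where p: "real_polynomial_function p" "\<And>x. x \<in> M \<Longrightarrow> g (l + x) = p (l + x)" using M(2)[OF l] by blast
  have lL: "l \<in> lat_on I" using NL l by (rule subsetD)
  obtain p0 where p0: "real_polynomial_function p0" "\<And>x. x \<in> M0 \<Longrightarrow> g0 (l + x) = p0 (l + x)" using M0(2)[OF lL] by blast
  have lN: "l + of_nat t *\<^sub>R (of_nat m *\<^sub>R d) \<in> N" for t
    by (rule subgroup_add_groupD(3)[OF sub(1) l subsetD[OF subgroup_add_groupD(1)[OF sub(2)] mM]])
  define f where "f = (\<lambda>t :: real. p (l + t *\<^sub>R (of_nat m *\<^sub>R d)) - p0 (l + t *\<^sub>R (of_nat m *\<^sub>R d)))"
  have line: "polynomial_function (\<lambda>t :: real. l + t *\<^sub>R (of_nat m *\<^sub>R d))"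
    by (intro polynomial_function_add polynomial_function_const polynomial_function_bounded_linear
        bounded_linear_scaleR_left)
  have "real_polynomial_function f" unfolding f_def
    using real_polynomial_function_diff[OF real_polynomial_function_compose[OF line p(1)]
        real_polynomial_function_compose[OF line p0(1)]] by (simp add: o_def)
  moreover have "f (of_nat t) = 0" if "max T T0 \<le> t" for t
  proof -
    let ?x = "l + of_nat t *\<^sub>R (of_nat m *\<^sub>R d)"
    have "g ?x = F ?x" using s(2) T lN that by simp
    moreover have "g0 ?x = F ?x" using s0(2) T0 subsetD[OF NL lN[of t]] that by simp
    ultimately show ?thesis using p(2)[OF mM[of t]] p0(2)[OF mM0[of t]] by (simp add: f_def)
  qed
  ultimately have "f 0 = 0" by (rule real_polynomial_eq_0)
  then show ?thesis using p(2)[OF mM[of 0]] p0(2)[OF mM0[of 0]] by (simp add: f_def)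
qed

text \<open>
  Both kinds of counting functions: \<open>\<Phi>\<close> is a condition on the set of vertices of \<open>I\<close> where \<open>l\<close> lies
  strictly below \<open>x\<close>.
\<close>

definition count :: "('v set \<Rightarrow> bool) \<Rightarrow> 'v set \<Rightarrow> (real ^ 'v \<Rightarrow> real) \<Rightarrow> (real ^ 'v) set \<Rightarrow> real ^ 'v \<Rightarrow> real" where
  "count \<Phi> I a h x = (\<Sum>l | l \<in> dual_lat G \<and> cls G l = h \<and> \<Phi> {v \<in> I. l $ v < x $ v} \<and> a l \<noteq> 0. a l)"

definition region :: "('v set \<Rightarrow> bool) \<Rightarrow> 'v set \<Rightarrow> ('v \<Rightarrow> int) set" where
  "region \<Phi> I = {e. \<Phi> {v \<in> I. e v < 0}}"

lemma Q_count_eq_count: "Q_count G a h I x = count (\<lambda>B. B \<noteq> {}) I a h x"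
  unfolding Q_count_def count_def by (rule sum.cong) (auto simp: not_le)

lemma q_count_eq_count: "q_count G a h I x = count (\<lambda>B. B = I) I a h x"
  unfolding q_count_def count_def by (rule sum.cong) auto

lemma count_cong:
  assumes "\<And>v. v \<in> I \<Longrightarrow> x $ v = x' $ v"
  shows "count \<Phi> I a h x = count \<Phi> I a h x'"
proof -
  have "{v \<in> I. l $ v < x $ v} = {v \<in> I. l $ v < x' $ v}" for l :: "real ^ 'v" using assms by auto
  then show ?thesis by (simp add: count_def)
qed

lemma count_twisted:
  assumes "l0 \<in> dual_lat G"
  shows "count \<Phi> I (twisted_zcoeff G l0) (cls G r) x = count \<Phi> I (zcoeff G) (cls G (r - l0)) (x - l0)"
proof -
  have "{v \<in> I. l $ v < x $ v} = {v \<in> I. (l - l0) $ v < (x - l0) $ v}" for l by auto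
  moreover have "{v \<in> I. l $ v < (x - l0) $ v} = {v \<in> I. (l + l0) $ v < x $ v}" for l by (auto simp: algebra_simps)
  ultimately show ?thesis
    unfolding count_def twisted_zcoeff_def using assms
    by (intro sum.reindex_bij_witness[of _ "\<lambda>l. l + l0" "\<lambda>l. l - l0"])
      (auto simp: dual_lat_closed cls_eq_iff algebra_simps)
qed

lemma count_eq_region_sum:
  assumes x: "x \<in> dual_lat G" and "\<not> \<Phi> {}"
  shows "count \<Phi> I (zcoeff G) (cls G x) x = region_sum (region \<Phi> I) (int_codeg x)"
proof -
  let ?S = "{e \<in> region \<Phi> I. total_weight (int_codeg x) e \<noteq> 0}"
  have "?S \<subseteq> (\<Union>v. {l. l v \<le> 0 \<and> total_weight (int_codeg x) l \<noteq> 0})"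
  proof
    fix e assume e: "e \<in> ?S"
    then have "\<Phi> {v \<in> I. e v < 0}" by (simp add: region_def)
    then have "{v \<in> I. e v < 0} \<noteq> {}" using assms(2) by metis
    with e show "e \<in> (\<Union>v. {l. l v \<le> 0 \<and> total_weight (int_codeg x) l \<noteq> 0})" by (auto intro: less_imp_le)
  qed
  then have fin: "finite ?S" by (rule finite_subset) (simp add: finite_total_weight)
  have "region_sum (region \<Phi> I) (int_codeg x) = sum (total_weight (int_codeg x)) ?S"
    unfolding region_sum_def by (rule infsum_finite_support[OF fin])
  also have "\<dots> = (\<Sum>e\<in>?S. zcoeff G (x + ivec e))"
    by (rule sum.cong) (simp_all add: zcoeff_translate[OF x])
  also have "\<dots> = count \<Phi> I (zcoeff G) (cls G x) x"
    unfolding count_def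
  proof (rule sum.reindex_bij_betw)
    have nth: "ivec e $ v = of_int (e v)" for e v by (simp add: ivec_def)
    have pos: "{v \<in> I. (x + ivec e) $ v < x $ v} = {v \<in> I. e v < 0}" for e by (auto simp: ivec_def)
    show "bij_betw (\<lambda>e. x + ivec e) ?S
      {l \<in> dual_lat G. cls G l = cls G x \<and> \<Phi> {v \<in> I. l $ v < x $ v} \<and> zcoeff G l \<noteq> 0}"
    proof (rule bij_betwI')
      fix e e' show "(x + ivec e = x + ivec e') = (e = e')" by (auto simp: ivec_def vec_eq_iff)
    next
      fix e assume "e \<in> ?S"
      then show "x + ivec e \<in> {l \<in> dual_lat G. cls G l = cls G x \<and> \<Phi> {v \<in> I. l $ v < x $ v} \<and> zcoeff G l \<noteq> 0}"
        using x by (auto simp: nth region_def zcoeff_translate cls_eq_iff dual_lat_closed lat_eq_range)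
    next
      fix l assume l: "l \<in> {l \<in> dual_lat G. cls G l = cls G x \<and> \<Phi> {v \<in> I. l $ v < x $ v} \<and> zcoeff G l \<noteq> 0}"
      then obtain e where "l - x = ivec e" by (auto simp: cls_eq_iff lat_eq_range)
      then have e: "l = x + ivec e" by (simp add: algebra_simps)
      with l pos[of e] show "\<exists>e\<in>?S. l = x + ivec e"
        using zcoeff_translate[OF x, of e] by (auto simp: region_def)
    qed
  qed
  finally show ?thesis ..
qed

end

section \<open>Duality of the counting functions\<close>

context plumbing
begin

lemma vcodeg_minus_one: "vcodeg (\<chi> u. - 1) w = of_int (self_int G w) + real (val G w)"
  by (simp add: vcodeg_def codeg_const[of UNIV "- 1"] val_eq)

lemma effective_below_relative:
  assumes x: "x \<in> dual_lat G" and "\<And>w. real (val G w) - 2 \<le> vcodeg z w"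
    and "\<And>u. u \<in> I \<Longrightarrow> z $ u < x $ u \<and> x $ u \<le> z $ u + 1"
  shows "effective_below (int_codeg x) I (\<lambda>u. (z - x) $ u)"
proof -
  have "of_int (int_codeg x w) + codeg UNIV (\<lambda>u. (z - x) $ u) w = vcodeg z w" for w
    unfolding of_int_int_codeg[OF x] vcodeg_def[of "z - x", symmetric] by simp
  then show ?thesis unfolding effective_below_def using assms by fastforce
qed

text \<open>
  A point \<open>y + l\<close> with \<open>l\<close> deep in the cone is bounded below by \<open>y + s + c\<close> minus the sum of all curves,
  where \<open>s + c\<close> is a lift of \<open>l\<close> to the Lipman cone and \<open>s\<close> has codegrees large enough to absorb
  those of \<open>y\<close> and of the curves.
\<close>

lemma quasi_polynomial_in_cone_translate:
  assumes y: "y \<in> dual_lat G" and P: "quasi_poly P"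
    and FP: "\<And>\<kappa> \<xi>. effective_below \<kappa> I \<xi> \<Longrightarrow> F \<kappa> = P \<kappa>"
  shows "quasi_polynomial_in_cone (lipman_proj G I) (lat_on I)
     (\<lambda>l. F (int_codeg (y + l))) (\<lambda>l. P (int_codeg (y + l)))"
  unfolding quasi_polynomial_in_cone_def
proof
  obtain k where k: "k > 0" "\<And>\<kappa>. \<exists>p :: real ^ 'v \<Rightarrow> real. real_polynomial_function p \<and>
     (\<forall>e. P (\<lambda>w. \<kappa> w + k * codeg UNIV e w) = p (\<chi> u. of_int (e u)))"
    using P unfolding quasi_poly_def by blast
  show "quasi_polynomial_on (lat_on I) (\<lambda>l. P (int_codeg (y + l)))"
    unfolding quasi_polynomial_on_def
  proof (intro exI[of _ "(\<lambda>l. of_int k *\<^sub>R l) ` lat_on I"] conjI ballI)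
    show "finite_index_sublattice ((\<lambda>l :: real ^ 'v. of_int k *\<^sub>R l) ` lat_on I) (lat_on I)"
      by (rule finite_index_scaled[OF k(1)])
    fix b :: "real ^ 'v" assume b: "b \<in> lat_on I"
    obtain p :: "real ^ 'v \<Rightarrow> real" where p: "real_polynomial_function p"
      "\<And>e. P (\<lambda>w. int_codeg (y + b) w + k * codeg UNIV e w) = p (ivec e)"
      using k(2)[of "int_codeg (y + b)"] unfolding ivec_def by blast
    let ?q = "\<lambda>x. p ((1 / of_int k) *\<^sub>R (x - b))"
    have "polynomial_function (\<lambda>x :: real ^ 'v. (1 / of_int k) *\<^sub>R (x - b))"
      by (intro polynomial_function_cmul polynomial_function_diff polynomial_function_id[unfolded id_def]
          polynomial_function_const)
    from real_polynomial_function_compose[OF this p(1)] have "real_polynomial_function ?q"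
      by (simp add: o_def)
    moreover have "P (int_codeg (y + (b + l))) = ?q (b + l)" if l: "l \<in> (\<lambda>l. of_int k *\<^sub>R l) ` lat_on I" for l
    proof -
      obtain e where e: "l = of_int k *\<^sub>R ivec e"
      proof -
        obtain a where a: "a \<in> lat_on I" "l = of_int k *\<^sub>R a" using l by blast
        then have "a \<in> range ivec" using lat_on_lat[OF a(1)] by (simp add: lat_eq_range)
        then obtain e where "a = ivec e" by blast
        with a(2) that show ?thesis by blast
      qed
      then have "l = ivec (\<lambda>u. k * e u)" by (simp add: ivec_def vec_eq_iff)
      then have "int_codeg (y + (b + l)) = (\<lambda>w. int_codeg (y + b) w + k * codeg UNIV e w)"
        using int_codeg_add_ivec[of "y + b" "\<lambda>u. k * e u"] by (simp add: codeg_scale add.assoc)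
      then show ?thesis using p(2) e k(1) by simp
    qed
    ultimately show "\<exists>p. real_polynomial_function p \<and>
      (\<forall>l\<in>(\<lambda>l. of_int k *\<^sub>R l) ` lat_on I. P (int_codeg (y + (b + l))) = p (b + l))" by blast
  qed
  define C where "C = (\<Sum>w\<in>UNIV. \<bar>- of_int (self_int G w) - 2 - vcodeg y w\<bar>)"
  define s where "s = (\<Sum>v\<in>UNIV. C *\<^sub>R dual_vec G v)"
  have s: "vcodeg s w = C" for w using dual_basis_expansion[of "\<lambda>_. C" s] by (simp add: s_def)
  have C: "- of_int (self_int G w) - 2 - vcodeg y w \<le> C" for w
  proof -
    have "\<bar>- of_int (self_int G w) - 2 - vcodeg y w\<bar> \<le> C" unfolding C_def by (rule member_le_sum) auto
    then show ?thesis by linarith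
  qed
  have "C \<ge> 0" by (simp add: C_def sum_nonneg)
  show "\<exists>s\<in>lipman_proj G I. \<forall>l\<in>(\<lambda>k. s + k) ` lipman_proj G I \<inter> lat_on I. P (int_codeg (y + l)) = F (int_codeg (y + l))"
  proof (intro bexI[of _ "proj I s"] ballI)
    show "proj I s \<in> lipman_proj G I" using s \<open>C \<ge> 0\<close> by (simp add: real_lipman_cone_iff)
    fix l assume "l \<in> (\<lambda>k. proj I s + k) ` lipman_proj G I \<inter> lat_on I"
    then obtain c where c: "c \<in> real_lipman_cone G" "l = proj I s + proj I c" "l \<in> lat_on I" by blast
    have yl: "y + l \<in> dual_lat G" 
      by (rule dual_lat_closed(1)[OF y dual_lat_closed(3)[OF lat_on_lat[OF c(3)]]])
    have "effective_below (int_codeg (y + l)) I (\<lambda>u. (y + s + c + (\<chi> u. - 1) - (y + l)) $ u)"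
    proof (rule effective_below_relative[OF yl])
      show "real (val G w) - 2 \<le> vcodeg (y + s + c + (\<chi> u. - 1)) w" for w
        using C[of w] c(1) by (simp add: s vcodeg_minus_one real_lipman_cone_iff) (smt (verit))
      show "(y + s + c + (\<chi> u. - 1)) $ u < (y + l) $ u \<and> (y + l) $ u \<le> (y + s + c + (\<chi> u. - 1)) $ u + 1"
        if "u \<in> I" for u using that by (simp add: c(2))
    qed
    then show "P (int_codeg (y + l)) = F (int_codeg (y + l))" using FP by metis
  qed
qed

text \<open>
  The first two numbers are values of one symmetric quasi-polynomial \<open>P\<close>, at \<open>r\<^sub>h - l\<^sub>0\<close> and at a point of
  the same class with the same coordinates in \<open>I\<close>.  By the symmetry of \<open>P\<close> and the lower bound
  \<open>Z\<^sub>K - E + l\<^sub>0\<close>, with \<open>E\<close> the sum of all curves, at all such points \<open>P\<close> equals the counting function at \<open>Z\<^sub>K - r\<^sub>h + l\<^sub>0\<close>.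
\<close>

lemma duality:
  fixes \<Phi> :: "'v set \<Rightarrow> bool" and l0 y :: "real ^ 'v"
  assumes rec: "reciprocal I (region_sum (region \<Phi> I))" and \<Phi>: "\<not> \<Phi> {}"
    and l0: "l0 \<in> lipman_cone G" and h: "h \<in> carrier (disc_group G)"
  defines "g \<equiv> disc_diff G h (cls G l0)"
    and "h' \<equiv> disc_diff G (cls G (Z_K G)) h \<otimes>\<^bsub>disc_group G\<^esub> cls G l0"
  defines "V \<equiv> count \<Phi> I (zcoeff G) h' (Z_K G - repr G h + l0)"
  shows "(THE c. \<exists>N f. finite_index_sublattice N (lat_on I) \<and> quasi_polynomial_in_cone (lipman_proj G I) N
      (\<lambda>l. count \<Phi> I (twisted_zcoeff G l0) h (proj I (repr G h) + l)) f \<and> c = f 0) = V" (is "?mpc = V")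
    and "(THE c. \<exists>f. quasi_polynomial_in_cone (lipman_proj G I) (lat_on I)
      (\<lambda>l. count \<Phi> I (zcoeff G) g (proj I (repr G g) + l)) f \<and>
      c = f (proj I (repr G h - ell_check G l0 h))) = V" (is "?tilde = V")
proof -
  obtain P where P: "\<And>\<kappa> \<xi>. effective_below \<kappa> I \<xi> \<Longrightarrow> region_sum (region \<Phi> I) \<kappa> = P \<kappa>"
    "\<And>\<kappa>. P (dual_codeg \<kappa>) = P \<kappa>" "quasi_poly P"
    using rec unfolding reciprocal_def by blast
  have l0L: "l0 \<in> dual_lat G" and l0_deg: "\<And>w. 0 \<le> vcodeg l0 w"
    using l0 by (auto simp: lipman_cone_def int_form_E_curve)
  obtain x where x: "x \<in> dual_lat G" "h = cls G x" using h disc_carrier by blast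
  define r where "r = repr G h"
  have r: "r \<in> dual_lat G" "cls G r = h" "\<And>v. 0 \<le> r $ v" "\<And>v. r $ v < 1"
    using repr_cls[OF x(1)] unfolding r_def x(2) by auto
  define y where "y = r - l0"
  have y: "y \<in> dual_lat G" using r(1) l0L by (simp add: y_def dual_lat_closed)
  have g: "g = cls G y" using disc_diff_cls[OF r(1) l0L] by (simp add: g_def r(2) y_def)
  have h': "h' = cls G (Z_K G - y)"
    using disc_diff_cls[OF Z_K(1) r(1)] disc_mult[OF dual_lat_closed(2)[OF Z_K(1) r(1)] l0L]
    by (simp add: h'_def r(2) y_def algebra_simps)
  define rg where "rg = repr G g"
  have rg: "rg \<in> dual_lat G" "cls G rg = g" using repr_cls[OF y] unfolding rg_def g by auto
  \<comment> \<open>only the class and the coordinates in \<open>I\<close> matter, so this applies to both \<open>y\<close> and its projected variant\<close>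
  have cone: "P (int_codeg x') = V" if x': "x' \<in> dual_lat G" "cls G x' = cls G y" "\<And>v. v \<in> I \<Longrightarrow> x' $ v = y $ v" for x'
  proof -
    have zx: "Z_K G - x' \<in> dual_lat G" using x' Z_K(1) by (simp add: dual_lat_closed)
    have "effective_below (int_codeg (Z_K G - x')) I (\<lambda>u. (Z_K G + l0 + (\<chi> u. - 1) - (Z_K G - x')) $ u)"
    proof (rule effective_below_relative[OF zx])
      show "real (val G w) - 2 \<le> vcodeg (Z_K G + l0 + (\<chi> u. - 1)) w" for w
        using l0_deg[of w] by (simp add: Z_K vcodeg_minus_one)
      show "(Z_K G + l0 + (\<chi> u. - 1)) $ u < (Z_K G - x') $ u \<and>
          (Z_K G - x') $ u \<le> (Z_K G + l0 + (\<chi> u. - 1)) $ u + 1" if "u \<in> I" for u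
        using x'(3)[OF that] r(3,4)[of u] by (simp add: y_def)
    qed
    then have "P (int_codeg (Z_K G - x')) = region_sum (region \<Phi> I) (int_codeg (Z_K G - x'))" using P(1) by metis
    also have "\<dots> = count \<Phi> I (zcoeff G) (cls G (Z_K G - x')) (Z_K G - x')"
      by (rule count_eq_region_sum[where \<Phi> = \<Phi>, OF zx \<Phi>, symmetric])
    also have "cls G (Z_K G - x') = h'"
      using x'(2) lat_closed(2)[OF lat_closed(3), of "x' - y"] by (simp add: h' cls_eq_iff)
    also have "count \<Phi> I (zcoeff G) h' (Z_K G - x') = V"
      unfolding V_def by (rule count_cong) (use x'(3) in \<open>simp add: y_def r_def\<close>)
    finally show ?thesis using P(2) int_codeg_dual_codeg[OF x'(1)] by simp
  qed
  have count: "count \<Phi> I (zcoeff G) (cls G x') (x' + l) = region_sum (region \<Phi> I) (int_codeg (x' + l))"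
    if "x' \<in> dual_lat G" "l \<in> lat_on I" for x' l
  proof -
    have l: "l \<in> lat" using that(2) by (rule lat_on_lat)
    have "cls G (x' + l) = cls G x'" using l by (simp add: cls_eq_iff)
    then show ?thesis
      using count_eq_region_sum[where \<Phi> = \<Phi> and I = I, OF dual_lat_closed(1)[OF that(1) dual_lat_closed(3)[OF l]] \<Phi>] by simp
  qed
  have cong: "quasi_polynomial_in_cone (lipman_proj G I) N F f \<longleftrightarrow> quasi_polynomial_in_cone (lipman_proj G I) N F' f"
    if "N \<subseteq> lat_on I" "\<And>l. l \<in> lat_on I \<Longrightarrow> F l = F' l" for N F F' f
    unfolding quasi_polynomial_in_cone_def
    by (intro arg_cong2[of _ _ _ _ "(\<and>)"] bex_cong refl ball_cong) (use that in auto)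
  have full: "finite_index_sublattice (lat_on I) (lat_on I :: (real ^ 'v) set)"
    using finite_index_scaled[of 1 I] by simp
  have zero: "0 \<in> N" and sub: "N \<subseteq> lat_on I"
    if "finite_index_sublattice N (lat_on I :: (real ^ 'v) set)" for N
    using that subgroup_add_groupD by (auto simp: finite_index_sublattice_def)
  let ?F = "\<lambda>x' l. region_sum (region \<Phi> I) (int_codeg (x' + l))"
  have quasi: "quasi_polynomial_in_cone (lipman_proj G I) (lat_on I) (?F x') (\<lambda>l. P (int_codeg (x' + l)))"
    if "x' \<in> dual_lat G" for x'
    by (rule quasi_polynomial_in_cone_translate[OF that P(3)]) (rule P(1))
  have twisted: "count \<Phi> I (twisted_zcoeff G l0) h (proj I (repr G h) + l) = ?F y l" if "l \<in> lat_on I" for l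
  proof -
    have "count \<Phi> I (twisted_zcoeff G l0) h (proj I r + l) =
       count \<Phi> I (zcoeff G) (cls G y) (proj I r + l - l0)"
      using count_twisted[OF l0L, of \<Phi> I r "proj I r + l"] by (simp only: r(2) y_def)
    also have "\<dots> = count \<Phi> I (zcoeff G) (cls G y) (y + l)"
      by (rule count_cong) (simp add: y_def)
    finally show ?thesis using count[OF y that] by (simp add: r_def)
  qed
  show "?mpc = V"
  proof (rule the_equality)
    show "\<exists>N f. finite_index_sublattice N (lat_on I) \<and> quasi_polynomial_in_cone (lipman_proj G I) N
      (\<lambda>l. count \<Phi> I (twisted_zcoeff G l0) h (proj I (repr G h) + l)) f \<and> V = f 0"
    proof (intro exI[of _ "lat_on I"] exI[of _ "\<lambda>l. P (int_codeg (y + l))"] conjI full)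
      show "quasi_polynomial_in_cone (lipman_proj G I) (lat_on I)
         (\<lambda>l. count \<Phi> I (twisted_zcoeff G l0) h (proj I (repr G h) + l)) (\<lambda>l. P (int_codeg (y + l)))"
        using quasi[OF y] by (subst cong[OF order_refl twisted])
      show "V = P (int_codeg (y + 0))" using cone[OF y] by simp
    qed
    fix c assume "\<exists>N f. finite_index_sublattice N (lat_on I) \<and> quasi_polynomial_in_cone (lipman_proj G I) N
      (\<lambda>l. count \<Phi> I (twisted_zcoeff G l0) h (proj I (repr G h) + l)) f \<and> c = f 0"
    then obtain N f where N: "finite_index_sublattice N (lat_on I)" and c: "c = f 0"
      and f: "quasi_polynomial_in_cone (lipman_proj G I) N
        (\<lambda>l. count \<Phi> I (twisted_zcoeff G l0) h (proj I (repr G h) + l)) f" by blast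
    have "quasi_polynomial_in_cone (lipman_proj G I) N (?F y) f"
      using f by (subst (asm) cong[OF sub[OF N] twisted])
    from quasi_polynomial_unique[OF N this quasi[OF y] zero[OF N]]
    show "c = V" using c cone[OF y] by simp
  qed
  let ?z = "repr G h - ell_check G l0 h"
  have z: "?z = y - rg" by (simp add: ell_check_def y_def r_def rg_def g_def)
  have zlat: "y - rg \<in> lat" using rg(2) by (simp add: g flip: cls_eq_iff)
  have value_at: "P (int_codeg (rg + proj I ?z)) = V"
  proof (rule cone)
    have pz: "proj I ?z \<in> lat" unfolding z by (rule lat_on_lat[OF proj_lat[OF zlat]])
    then show "rg + proj I ?z \<in> dual_lat G"
      by (rule dual_lat_closed(1)[OF rg(1) dual_lat_closed(3)])
    have "cls G (rg + proj I ?z) = cls G rg" using pz by (simp add: cls_eq_iff)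
    then show "cls G (rg + proj I ?z) = cls G y" using rg(2) g by simp
    show "(rg + proj I ?z) $ v = y $ v" if "v \<in> I" for v using that unfolding z by simp
  qed
  have untwisted: "count \<Phi> I (zcoeff G) g (proj I (repr G g) + l) = ?F rg l" if "l \<in> lat_on I" for l
  proof -
    have "count \<Phi> I (zcoeff G) g (proj I rg + l) = count \<Phi> I (zcoeff G) g (rg + l)"
      by (rule count_cong) simp
    also have "\<dots> = ?F rg l" using count[OF rg(1) that] by (simp only: rg(2))
    finally show ?thesis by (simp only: rg_def)
  qed
  show "?tilde = V"
  proof (rule the_equality)
    show "\<exists>f. quasi_polynomial_in_cone (lipman_proj G I) (lat_on I)
      (\<lambda>l. count \<Phi> I (zcoeff G) g (proj I (repr G g) + l)) f \<and> V = f (proj I ?z)"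
    proof (intro exI[of _ "\<lambda>l. P (int_codeg (rg + l))"] conjI)
      show "quasi_polynomial_in_cone (lipman_proj G I) (lat_on I)
         (\<lambda>l. count \<Phi> I (zcoeff G) g (proj I (repr G g) + l)) (\<lambda>l. P (int_codeg (rg + l)))"
        using quasi[OF rg(1)] by (subst cong[OF order_refl untwisted])
    qed (simp only: value_at)
    fix c assume "\<exists>f. quasi_polynomial_in_cone (lipman_proj G I) (lat_on I)
      (\<lambda>l. count \<Phi> I (zcoeff G) g (proj I (repr G g) + l)) f \<and> c = f (proj I ?z)"
    then obtain f where c: "c = f (proj I ?z)" and f: "quasi_polynomial_in_cone (lipman_proj G I) (lat_on I)
        (\<lambda>l. count \<Phi> I (zcoeff G) g (proj I (repr G g) + l)) f" by blast
    have "quasi_polynomial_in_cone (lipman_proj G I) (lat_on I) (?F rg) f"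
      using f by (subst (asm) cong[OF order_refl untwisted])
    moreover have "proj I ?z \<in> lat_on I" unfolding z by (rule proj_lat[OF zlat])
    ultimately have "f (proj I ?z) = P (int_codeg (rg + proj I ?z))"
      using quasi_polynomial_unique[OF full _ quasi[OF rg(1)]] by blast
    then show "c = V" using c value_at by simp
  qed
qed

end

theorem theorem5p4:
  fixes G :: "'v::finite resolution_graph"
    and I :: "'v set" and l0 :: "real ^ 'v" and h h0 :: "(real ^ 'v) set"
  assumes "QHS_resolution_graph G"
    and "I \<noteq> {}"
    and "l0 \<in> lipman_cone G" and "cls G l0 = h0"
    and "h \<in> carrier (disc_group G)"
  shows "(mpc G (lipman_proj G I) (twisted_zcoeff G l0) h I
            = q_tilde G (disc_diff G h h0) I (repr G h - ell_check G l0 h) \<and>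
          q_tilde G (disc_diff G h h0) I (repr G h - ell_check G l0 h)
            = q_count G (zcoeff G)
                (disc_diff G (cls G (Z_K G)) h \<otimes>\<^bsub>disc_group G\<^esub> h0) I
                (Z_K G - repr G h + l0)) \<and>
         (pc G (lipman_proj G I) (twisted_zcoeff G l0) h I
            = Q_tilde G (disc_diff G h h0) I (repr G h - ell_check G l0 h) \<and>
          Q_tilde G (disc_diff G h h0) I (repr G h - ell_check G l0 h)
            = Q_count G (zcoeff G)
                (disc_diff G (cls G (Z_K G)) h \<otimes>\<^bsub>disc_group G\<^esub> h0) I
                (Z_K G - repr G h + l0))"
proof -
  interpret plumbing G by unfold_locales (rule assms(1))
  have "region (\<lambda>B. B = I) I = everywhere_neg I" by (auto simp: region_def everywhere_neg_def)
  then have all: "reciprocal I (region_sum (region (\<lambda>B. B = I) I))"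
    using reciprocal_everywhere_neg[OF assms(2)] by simp
  have "region (\<lambda>B. B \<noteq> {}) I = somewhere_neg I" by (auto simp: region_def somewhere_neg_def)
  then have some: "reciprocal I (region_sum (region (\<lambda>B. B \<noteq> {}) I))"
    using reciprocal_somewhere_neg by simp
  have I: "\<not> {} = I" using assms(2) by blast
  show ?thesis
    unfolding mpc_def pc_def q_tilde_def Q_tilde_def q_count_eq_count Q_count_eq_count assms(4)[symmetric]
    using duality[where \<Phi> = "\<lambda>B. B = I", OF all I assms(3,5)]
      duality[where \<Phi> = "\<lambda>B. B \<noteq> {}", OF some _ assms(3,5)] by simp
qed

end
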